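(* In the general setting described in the context, suppose additionally that $\epsilon\le\frac1{12}$ and $\gamma\le\frac{\epsilon^2}{13\log(m/\epsilon)}$, and let $\check x_1,\dots,\check x_n$ be produced by the Exponentiated Subgradient Algorithm (ESA) described in the context, run with parameters $\epsilon$ and $\gamma$ on the randomly permuted input $(f_{\sigma(1)},A_{\sigma(1)}),\dots,(f_{\sigma(n)},A_{\sigma(n)})$. Then $$E\Big[\sum_{t=1}^n f_{\sigma(t)}(\check x_t)+\psi\Big(\sum_{t=1}^n A_{\sigma(t)}\check x_t\Big)\Big]\ge(1-12\epsilon)P^*,$$ where $\psi(u)=0$ if $u\le b$ and $\psi(u)=-\infty$ otherwise.
   Context: General setting. Let $m,k,n$ be positive integers and $b\in\mathbb{R}^m_{++}$. Let $\mathcal G$ be the set of proper, concave, upper semicontinuous functions $f:\mathbb{R}^k\to[-\infty,\infty)$ with bounded superlevel sets such that $\mathrm{dom} f\subset\mathbb{R}^k_+$ and $f(0)=0$. Let $f_1,\dots,f_n\in\mathcal G$ and $A_1,\dots,A_n\in\mathbb{R}_+^{m\times k}$. Let $P^*=\sup\{\sum_{t=1}^n f_t(x_t): x_t\in\mathbb{R}^k,\ \sum_{t=1}^n A_tx_t\le b\}$ and assume $P^*>0$. Let $\gamma>0$ satisfy, for every $t\in[n]$: $(A_tx)_i/b_i\le\gamma$ for all $i\in[m]$ and all $x$ with $f_t(x)\ge0$, and $f_t(x)\le\gamma P^*$ for all $x\in\mathrm{dom} f_t$. Let $\epsilon\in(0,1)$ be such that $L=\log_2(1/\epsilon)$ and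 $n\epsilon$ are integers. Let $\sigma$ be a uniformly random permutation of $[n]$; probabilities and expectations are over $\sigma$. Index maps. For $t\in[n(1-\epsilon)]$, $\kappa(t)=\lfloor\log_2\frac{n-t}{n\epsilon}\rfloor+1$, i.e. $\kappa(t)=k\in[L]$ iff $n(1-2^k\epsilon)<t\le n(1-2^{k-1}\epsilon)$. For $t\in\{n\epsilon+1,\dots,n\}$, $\eta(t)=h\in[L]$ iff $n2^{h-1}\epsilon<t\le n2^h\epsilon$. Estimates $P_h$. For $h\in\{0,\dots,L-1\}$ let $\theta_h=2^{-(h+1)/2}\epsilon^{1/2}$ and $$P_h=\sup\Big\{\tfrac{1}{2^h\epsilon(1-\theta_h)}\sum_{t=1}^{2^hn\epsilon}f_{\sigma(t)}(x_t)\ :\ x_t\in\mathbb{R}^k,\ \tfrac{1}{2^h\epsilon(1+\theta_h)}\sum_{t=1}^{2^hn\epsilon}A_{\sigma(t)}x_t\le b\Big\}.$$ For $t\in\{n\epsilon+1,\dots,n\}$, let $q_t=P_{\eta(t)-1}$ if $P_{\eta(t)-1}\neq0$ and $q_t=\epsilon$ otherwise. Parameters. For $t\in\{n\epsilon+1,\dots,n(1-\epsilon)\}$: $\alpha_t=\frac{1-2^{-\eta(t)/2}\epsilon^{1/2}}{1+2^{-\eta(t)/2+1}\epsilon^{1/2}}$, $\beta_t=\frac{\epsilon}{\gamma n}(1+2^{-\kappa(t)/2}\epsilon^{1/2})$, $\beta'_t=\frac{\epsilon}{\gamma n}(1-2^{-\kappa(t)/2}\epsilon^{1/2})\alpha_t$;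 for $t\in\{n(1-\epsilon)+1,\dots,n+1\}$, $\beta_t=\beta_{n(1-\epsilon)}$ and $\beta'_t=\beta'_{n(1-\epsilon)}$. Let $\nu=\frac1\gamma\log(1+\epsilon)$, $\nu'=-\frac1\gamma\log(1-\epsilon)$. ESA. For $t=1,\dots,n\epsilon$ set $\check x_t=0$. Set $y'_{n\epsilon+1}=\exp(\beta'_{n\epsilon+1})$ and $y_{n\epsilon+1,i}=\exp(-\beta_{n\epsilon+1})/m$ for all $i\in[m]$. For $t=n\epsilon+1,\dots,n$: choose $$x_t\in\arg\min_{z\in\mathbb{R}^k}\ \sum_{i=1}^m\frac{y_{t,i}}{b_i}(A_{\sigma(t)}z)_i-\frac{y'_t}{q_t}f_{\sigma(t)}(z);$$ update $y_{t+1,i}=y_{t,i}\exp\big(\frac{\nu}{b_i}(A_{\sigma(t)}x_t)_i-\beta_{t+1}\big)$ for all $i$, and $y'_{t+1}=y'_t\exp\big(-\frac{\nu'}{q_t}f_{\sigma(t)}(x_t)+\beta'_{t+1}\big)$; set $\check x_t=x_t$ if $\sum_{s=n\epsilon+1}^tA_{\sigma(s)}x_s\le b$ and $\check x_t=0$ otherwise. *)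

theory Defs
  imports "HOL-Analysis.Analysis" "HOL-Combinatorics.Permutations"
begin

definition hypo :: "('a \<Rightarrow> ereal) \<Rightarrow> ('a \<times> real) set" where
  "hypo f = {(x, r). ereal r \<le> f x}"

definition concave_ext :: "('a::real_vector \<Rightarrow> ereal) \<Rightarrow> bool" where
  "concave_ext f \<longleftrightarrow> convex (hypo f)"

definition usc_ext :: "('a::topological_space \<Rightarrow> ereal) \<Rightarrow> bool" where
  "usc_ext f \<longleftrightarrow> (\<forall>x. Limsup (at x) f \<le> f x)"

definition effdom :: "('a \<Rightarrow> ereal) \<Rightarrow> 'a set" where
  "effdom f = {x. f x \<noteq> -\<infinity>}"

definition class_G :: "(real^'k \<Rightarrow> ereal) \<Rightarrow> bool" where
  "class_G f \<longleftrightarrow>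
     (\<forall>x. f x \<noteq> \<infinity>) \<and> effdom f \<noteq> {} \<and>
     concave_ext f \<and> usc_ext f \<and>
     (\<forall>c::real. bounded {x. ereal c \<le> f x}) \<and>
     effdom f \<subseteq> {x. \<forall>j. 0 \<le> x $ j} \<and>
     f 0 = 0"

definition Pstar :: "nat \<Rightarrow> (nat \<Rightarrow> real^'k \<Rightarrow> ereal) \<Rightarrow> (nat \<Rightarrow> real^'k^'m) \<Rightarrow> real^'m \<Rightarrow> ereal" where
  "Pstar n f A b = Sup {(\<Sum>t\<in>{1..n}. f t (x t)) | x.
      \<forall>i. (\<Sum>t\<in>{1..n}. A t *v x t) $ i \<le> b $ i}"

text \<open>n*eps as a natural number (n*eps is assumed to be an integer).\<close>
definition neps :: "nat \<Rightarrow> real \<Rightarrow> nat" where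
  "neps n eps = nat \<lfloor>real n * eps\<rfloor>"

definition kappa :: "nat \<Rightarrow> real \<Rightarrow> nat \<Rightarrow> nat" where
  "kappa n eps t = nat (\<lfloor>log 2 ((real n - real t) / (real n * eps))\<rfloor> + 1)"

definition eta :: "nat \<Rightarrow> real \<Rightarrow> nat \<Rightarrow> nat" where
  "eta n eps t = (THE h::nat. 1 \<le> h \<and> real n * 2 ^ (h - 1) * eps < real t \<and> real t \<le> real n * 2 ^ h * eps)"

definition theta :: "real \<Rightarrow> nat \<Rightarrow> real" where
  "theta eps h = 2 powr (- (real h + 1) / 2) * sqrt eps"

definition Pest :: "nat \<Rightarrow> real \<Rightarrow> (nat \<Rightarrow> real^'k \<Rightarrow> ereal) \<Rightarrow> (nat \<Rightarrow> real^'k^'m) \<Rightarrow> real^'m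
    \<Rightarrow> (nat \<Rightarrow> nat) \<Rightarrow> nat \<Rightarrow> ereal" where
  "Pest n eps f A b \<sigma> h = Sup {ereal (1 / (2 ^ h * eps * (1 - theta eps h))) *
        (\<Sum>t\<in>{1..2 ^ h * neps n eps}. f (\<sigma> t) (x t)) | x.
      \<forall>i. (1 / (2 ^ h * eps * (1 + theta eps h))) *
           (\<Sum>t\<in>{1..2 ^ h * neps n eps}. A (\<sigma> t) *v x t) $ i \<le> b $ i}"

definition qq :: "nat \<Rightarrow> real \<Rightarrow> (nat \<Rightarrow> real^'k \<Rightarrow> ereal) \<Rightarrow> (nat \<Rightarrow> real^'k^'m) \<Rightarrow> real^'m
    \<Rightarrow> (nat \<Rightarrow> nat) \<Rightarrow> nat \<Rightarrow> real" where
  "qq n eps f A b \<sigma> t =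
     (let P = Pest n eps f A b \<sigma> (eta n eps t - 1) in if P \<noteq> 0 then real_of_ereal P else eps)"

definition alpha :: "nat \<Rightarrow> real \<Rightarrow> nat \<Rightarrow> real" where
  "alpha n eps t = (1 - 2 powr (- real (eta n eps t) / 2) * sqrt eps) /
                   (1 + 2 powr (- real (eta n eps t) / 2 + 1) * sqrt eps)"

definition beta :: "nat \<Rightarrow> real \<Rightarrow> real \<Rightarrow> nat \<Rightarrow> real" where
  "beta n eps gamma t = (let s = min t (n - neps n eps) in
     eps / (gamma * real n) * (1 + 2 powr (- real (kappa n eps s) / 2) * sqrt eps))"

definition beta' :: "nat \<Rightarrow> real \<Rightarrow> real \<Rightarrow> nat \<Rightarrow> real" where
  "beta' n eps gamma t = (let s = min t (n - neps n eps) in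
     eps / (gamma * real n) * (1 - 2 powr (- real (kappa n eps s) / 2) * sqrt eps) * alpha n eps s)"

definition nu :: "real \<Rightarrow> real \<Rightarrow> real" where
  "nu eps gamma = ln (1 + eps) / gamma"

definition nu' :: "real \<Rightarrow> real \<Rightarrow> real" where
  "nu' eps gamma = - ln (1 - eps) / gamma"

text \<open>ESA_state ... x j = (y_t, y'_t) for t = n eps + 1 + j, given the decisions x.\<close>
fun ESA_state :: "nat \<Rightarrow> real \<Rightarrow> real \<Rightarrow> real^'m \<Rightarrow> (nat \<Rightarrow> real^'k \<Rightarrow> ereal) \<Rightarrow> (nat \<Rightarrow> real^'k^'m)
    \<Rightarrow> (nat \<Rightarrow> nat) \<Rightarrow> (nat \<Rightarrow> real^'k) \<Rightarrow> nat \<Rightarrow> (real^'m) \<times> real" where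
  "ESA_state n eps gamma b f A \<sigma> x 0 =
     ((\<chi> i. exp (- beta n eps gamma (neps n eps + 1)) / real CARD('m)),
      exp (beta' n eps gamma (neps n eps + 1)))"
| "ESA_state n eps gamma b f A \<sigma> x (Suc j) =
     (let t = neps n eps + 1 + j;
          (y, y') = ESA_state n eps gamma b f A \<sigma> x j
      in ((\<chi> i. y $ i * exp (nu eps gamma / b $ i * (A (\<sigma> t) *v x t) $ i - beta n eps gamma (t + 1))),
          y' * exp (- nu' eps gamma / qq n eps f A b \<sigma> t * real_of_ereal (f (\<sigma> t) (x t))
                    + beta' n eps gamma (t + 1))))"

definition ESA_y :: "nat \<Rightarrow> real \<Rightarrow> real \<Rightarrow> real^'m \<Rightarrow> (nat \<Rightarrow> real^'k \<Rightarrow> ereal) \<Rightarrow> (nat \<Rightarrow> real^'k^'m)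
    \<Rightarrow> (nat \<Rightarrow> nat) \<Rightarrow> (nat \<Rightarrow> real^'k) \<Rightarrow> nat \<Rightarrow> real^'m" where
  "ESA_y n eps gamma b f A \<sigma> x t = fst (ESA_state n eps gamma b f A \<sigma> x (t - neps n eps - 1))"

definition ESA_y' :: "nat \<Rightarrow> real \<Rightarrow> real \<Rightarrow> real^'m \<Rightarrow> (nat \<Rightarrow> real^'k \<Rightarrow> ereal) \<Rightarrow> (nat \<Rightarrow> real^'k^'m)
    \<Rightarrow> (nat \<Rightarrow> nat) \<Rightarrow> (nat \<Rightarrow> real^'k) \<Rightarrow> nat \<Rightarrow> real" where
  "ESA_y' n eps gamma b f A \<sigma> x t = snd (ESA_state n eps gamma b f A \<sigma> x (t - neps n eps - 1))"

text \<open>Objective minimized in step t (value +inf where f = -inf).\<close>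
definition ESA_obj :: "nat \<Rightarrow> real \<Rightarrow> real \<Rightarrow> real^'m \<Rightarrow> (nat \<Rightarrow> real^'k \<Rightarrow> ereal) \<Rightarrow> (nat \<Rightarrow> real^'k^'m)
    \<Rightarrow> (nat \<Rightarrow> nat) \<Rightarrow> (nat \<Rightarrow> real^'k) \<Rightarrow> nat \<Rightarrow> real^'k \<Rightarrow> ereal" where
  "ESA_obj n eps gamma b f A \<sigma> x t z =
     ereal (\<Sum>i\<in>UNIV. ESA_y n eps gamma b f A \<sigma> x t $ i / b $ i * (A (\<sigma> t) *v z) $ i)
     - ereal (ESA_y' n eps gamma b f A \<sigma> x t / qq n eps f A b \<sigma> t) * f (\<sigma> t) z"

definition ESA_run :: "nat \<Rightarrow> real \<Rightarrow> real \<Rightarrow> real^'m \<Rightarrow> (nat \<Rightarrow> real^'k \<Rightarrow> ereal) \<Rightarrow> (nat \<Rightarrow> real^'k^'m)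
    \<Rightarrow> (nat \<Rightarrow> nat) \<Rightarrow> (nat \<Rightarrow> real^'k) \<Rightarrow> bool" where
  "ESA_run n eps gamma b f A \<sigma> x \<longleftrightarrow>
     (\<forall>t\<in>{neps n eps + 1..n}. \<forall>z.
        ESA_obj n eps gamma b f A \<sigma> x t (x t) \<le> ESA_obj n eps gamma b f A \<sigma> x t z)"

definition ESA_check :: "nat \<Rightarrow> real \<Rightarrow> real^'m \<Rightarrow> (nat \<Rightarrow> real^'k^'m)
    \<Rightarrow> (nat \<Rightarrow> nat) \<Rightarrow> (nat \<Rightarrow> real^'k) \<Rightarrow> nat \<Rightarrow> real^'k" where
  "ESA_check n eps b A \<sigma> x t =
     (if t \<le> neps n eps then 0
      else if (\<forall>i. (\<Sum>s\<in>{neps n eps + 1..t}. A (\<sigma> s) *v x s) $ i \<le> b $ i) then x t else 0)"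

definition psi :: "real^'m \<Rightarrow> real^'m \<Rightarrow> ereal" where
  "psi b u = (if \<forall>i. u $ i \<le> b $ i then 0 else -\<infinity>)"

definition ESA_value :: "nat \<Rightarrow> real \<Rightarrow> real^'m \<Rightarrow> (nat \<Rightarrow> real^'k \<Rightarrow> ereal) \<Rightarrow> (nat \<Rightarrow> real^'k^'m)
    \<Rightarrow> (nat \<Rightarrow> nat) \<Rightarrow> (nat \<Rightarrow> real^'k) \<Rightarrow> ereal" where
  "ESA_value n eps b f A \<sigma> x =
     (\<Sum>t\<in>{1..n}. f (\<sigma> t) (ESA_check n eps b A \<sigma> x t))
     + psi b (\<Sum>t\<in>{1..n}. A (\<sigma> t) *v ESA_check n eps b A \<sigma> x t)"

end

theory Submission
  imports Defs
begin

text \<open>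
  Let \<open>d(k) = 2\<^sup>-\<^sup>k\<^sup>/\<^sup>2 \<epsilon>\<^sup>1\<^sup>/\<^sup>2\<close>. A uniform sample of \<open>2\<^sup>k\<^sup>-\<^sup>1 n \<epsilon>\<close> indices estimates the resource use and
  the value of the offline optimum up to a factor \<open>1 \<plusminus> d(k)\<close>, except with probability
  \<open>exp(-\<epsilon>\<^sup>2/(5\<gamma>))\<close>. This applies to the prefixes from which \<open>P\<^sub>h\<close> is computed, where weak duality
  with a fixed optimal multiplier gives the upper bound on \<open>P\<^sub>h\<close>, and, through the maximal
  inequality for the martingale of means over the unseen indices, simultaneously to all suffixes
  whose length lies in a dyadic block.

  As long as these estimates are accurate, the step sizes \<open>\<beta>\<^sub>t\<close> and \<open>\<beta>'\<^sub>t\<close> make the potential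
  \<open>\<Sum>\<^sub>i exp(\<nu> a\<^sub>i - \<Sum> \<beta>)/m + exp(-\<nu>' r + \<Sum> \<beta>')\<close> a supermartingale, where \<open>a\<^sub>i\<close> is the relative use of
  resource \<open>i\<close> and \<open>r\<close> the value collected so far in units of \<open>q\<^sub>t\<close>: the choice of \<open>x\<^sub>t\<close> is at least as
  good as the offline optimum, whose conditional mean is known. The potential starts at 2, and
  at time \<open>n - 2 n \<epsilon>\<close> it would exceed \<open>(m/\<epsilon>)\<^sup>2\<close> if a constraint were violated or less than
  \<open>1 - 23\<epsilon>/2\<close> of the optimum were collected. By Markov's inequality the total failure
  probability is at most \<open>\<epsilon>/2\<close>, and the value is never negative.
\<close>

section \<open>Averages over permutations\<close>

text \<open>\<open>P\<^sub>h\<close> is a supremum over points that depend on the sample, so no tail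
  bound applies to it directly. For a fixed optimal dual pair, a sampled value is at most the
  sampled sum of the \<open>h t\<close> plus a term bounded by the budget; only that sum is random,
  and the supremum is gone. For the suffixes the obstacle is the number of times \<open>t\<close>:
  the maximal inequality leaves a few events per level, with only \<open>L\<close> levels.

  Accuracy cannot simply be assumed, so the potential is multiplied by its indicator, which has to
  be determined before the next index is drawn. This works because every estimate used at time
  \<open>t\<close> is a function of the first \<open>t - 1\<close> indices. Conditional expectations
  are expressed by exchanging two positions of the permutation.

  Constants, in units of \<epsilon>: the widths sum to at most 12/7 and the steps left out amount to
  3, so the exponents of the potential lose at least 9/7 and at most 69/7. The 23/2 exceeds 69/7 +
  16/15 by more than 1/2, and 23/2 + 1/2 = 12. The 13 in the bound on \<gamma> is used through 13/5
  \<ge> 5/2.\<close>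

definition perms :: "nat \<Rightarrow> (nat \<Rightarrow> nat) set" where
  "perms n = {\<sigma>. \<sigma> permutes {1..n}}"

definition pexp :: "nat \<Rightarrow> ((nat \<Rightarrow> nat) \<Rightarrow> real) \<Rightarrow> real" where
  "pexp n F = (\<Sum>\<sigma>\<in>perms n. F \<sigma>) / real (card (perms n))"

text \<open>Stands for measurability with respect to the first \<open>t\<close> values. The value
  type is arbitrary, so that predicates and real functions are treated alike.\<close>

definition adapted :: "nat \<Rightarrow> nat \<Rightarrow> ((nat \<Rightarrow> nat) \<Rightarrow> 'a) \<Rightarrow> bool" where
  "adapted n t G \<longleftrightarrow>
     (\<forall>\<sigma>\<in>perms n. \<forall>\<sigma>'\<in>perms n. (\<forall>s\<in>{1..t}. \<sigma> s = \<sigma>' s) \<longrightarrow> G \<sigma> = G \<sigma>')"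

lemma adaptedI:
  "(\<And>\<sigma> \<sigma>'. \<sigma> \<in> perms n \<Longrightarrow> \<sigma>' \<in> perms n \<Longrightarrow> (\<And>s. s \<in> {1..t} \<Longrightarrow> \<sigma> s = \<sigma>' s) \<Longrightarrow> G \<sigma> = G \<sigma>')
    \<Longrightarrow> adapted n t G"
  unfolding adapted_def by blast

lemma adaptedD:
  assumes "adapted n t G" "\<sigma> \<in> perms n" "\<sigma>' \<in> perms n" "\<And>s. s \<in> {1..t} \<Longrightarrow> \<sigma> s = \<sigma>' s"
  shows "G \<sigma> = G \<sigma>'"
  using assms unfolding adapted_def by blast

lemma finite_perms [simp]: "finite (perms n)"
  unfolding perms_def by (rule finite_permutations) simp

lemma perms_in: "\<sigma> \<in> perms n \<Longrightarrow> t \<in> {1..n} \<Longrightarrow> \<sigma> t \<in> {1..n}"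
  unfolding perms_def using permutes_in_image[of \<sigma> "{1..n}" t] by blast

lemma card_perms_pos [simp]: "0 < card (perms n)"
proof -
  have "id \<in> perms n" unfolding perms_def using permutes_id by blast
  then show ?thesis by (metis card_gt_0_iff empty_iff finite_perms)
qed

lemma sum_perms:
  assumes "\<sigma> \<in> perms n"
  shows "(\<Sum>u\<in>{1..n}. z (\<sigma> u)) = (\<Sum>j\<in>{1..n}. z j)"
  using assms sum.permute[of \<sigma> "{1..n}" z] unfolding perms_def by (simp add: comp_def)

lemma pexp_mono: "(\<And>\<sigma>. \<sigma> \<in> perms n \<Longrightarrow> F \<sigma> \<le> G \<sigma>) \<Longrightarrow> pexp n F \<le> pexp n G"
  unfolding pexp_def by (intro divide_right_mono sum_mono) auto

lemma pexp_cong: "(\<And>\<sigma>. \<sigma> \<in> perms n \<Longrightarrow> F \<sigma> = G \<sigma>) \<Longrightarrow> pexp n F = pexp n G"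
  unfolding pexp_def by (intro arg_cong2[where f="(/)"] sum.cong) auto

lemma pexp_nonneg: "(\<And>\<sigma>. \<sigma> \<in> perms n \<Longrightarrow> 0 \<le> F \<sigma>) \<Longrightarrow> 0 \<le> pexp n F"
  unfolding pexp_def by (intro divide_nonneg_nonneg sum_nonneg) auto

lemma pexp_const [simp]: "pexp n (\<lambda>_. c) = c"
proof -
  have "real (card (perms n)) \<noteq> 0" using card_perms_pos[of n] by linarith
  then show ?thesis unfolding pexp_def sum_constant by (rule nonzero_mult_div_cancel_left)
qed

lemma pexp_add: "pexp n (\<lambda>\<sigma>. F \<sigma> + G \<sigma>) = pexp n F + pexp n G"
  unfolding pexp_def by (simp add: sum.distrib add_divide_distrib)

lemma pexp_diff: "pexp n (\<lambda>\<sigma>. F \<sigma> - G \<sigma>) = pexp n F - pexp n G"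
  unfolding pexp_def by (simp add: sum_subtractf diff_divide_distrib)

lemma pexp_cmult: "pexp n (\<lambda>\<sigma>. c * F \<sigma>) = c * pexp n F"
  unfolding pexp_def by (simp add: sum_distrib_left)

lemma pexp_sum: "pexp n (\<lambda>\<sigma>. \<Sum>i\<in>I. F i \<sigma>) = (\<Sum>i\<in>I. pexp n (F i))"
  unfolding pexp_def by (subst sum.swap) (simp add: sum_divide_distrib)

lemma pexp_union_bound:
  assumes "finite I" "\<And>\<sigma>. \<sigma> \<in> perms n \<Longrightarrow> Q \<sigma> \<Longrightarrow> \<exists>i\<in>I. R i \<sigma>"
  shows "pexp n (\<lambda>\<sigma>. of_bool (Q \<sigma>)) \<le> (\<Sum>i\<in>I. pexp n (\<lambda>\<sigma>. of_bool (R i \<sigma>)))"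
  unfolding pexp_sum[symmetric]
proof (rule pexp_mono)
  fix \<sigma> assume s: "\<sigma> \<in> perms n"
  show "of_bool (Q \<sigma>) \<le> (\<Sum>i\<in>I. of_bool (R i \<sigma>) :: real)"
  proof (cases "Q \<sigma>")
    case True
    then obtain i where "i \<in> I" "R i \<sigma>" using assms s by blast
    then have "of_bool (R i \<sigma>) \<le> (\<Sum>i\<in>I. of_bool (R i \<sigma>) :: real)"
      using assms(1) by (intro member_le_sum) auto
    then show ?thesis using \<open>R i \<sigma>\<close> True by simp
  qed (simp add: sum_nonneg)
qed

section \<open>Exchangeability: conditioning on a prefix by swapping positions\<close>

lemma adapted_mono: "adapted n s G \<Longrightarrow> s \<le> t \<Longrightarrow> adapted n t G"
  unfolding adapted_def by (meson atLeastAtMost_iff order_trans)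

lemma transpose_in_perms:
  "\<sigma> \<in> perms n \<Longrightarrow> t \<in> {1..n} \<Longrightarrow> u \<in> {1..n} \<Longrightarrow> \<sigma> \<circ> Transposition.transpose t u \<in> perms n"
  unfolding perms_def by (simp add: permutes_compose permutes_swap_id)

lemma pexp_transpose:
  assumes "t \<in> {1..n}" "u \<in> {1..n}"
  shows "pexp n (\<lambda>\<sigma>. F (\<sigma> \<circ> Transposition.transpose t u)) = pexp n F"
proof -
  let ?h = "\<lambda>\<sigma>. \<sigma> \<circ> Transposition.transpose t u"
  have inv: "\<forall>\<sigma>\<in>perms n. ?h (?h \<sigma>) = \<sigma>" by (simp add: comp_assoc)
  have img: "?h ` perms n \<subseteq> perms n"
    using transpose_in_perms[OF _ assms] by (rule image_subsetI)
  have "bij_betw ?h (perms n) (perms n)"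
    by (rule bij_betw_byWitness[OF inv inv img img])
  from sum.reindex_bij_betw[OF this, of F] show ?thesis
    unfolding pexp_def by (rule arg_cong)
qed

text \<open>The swap of \<open>t\<close> and \<open>u\<close> fixes the positions before
  \<open>t\<close>, which are all that \<open>G _ j\<close> can see, so its only effect is that
  \<open>\<sigma> t\<close> becomes \<open>\<sigma> u\<close>.\<close>

lemma pexp_swap:
  assumes "\<And>j. adapted n (t-1) (\<lambda>\<sigma>. G \<sigma> j)" "1 \<le> t" "t \<le> u" "u \<le> n"
  shows "pexp n (\<lambda>\<sigma>. G \<sigma> (\<sigma> t)) = pexp n (\<lambda>\<sigma>. G \<sigma> (\<sigma> u))"
proof -
  have "pexp n (\<lambda>\<sigma>. G \<sigma> (\<sigma> t)) = pexp n (\<lambda>\<sigma>. G (\<sigma> \<circ> Transposition.transpose t u) ((\<sigma> \<circ> Transposition.transpose t u) t))"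
    using assms by (intro pexp_transpose[symmetric]) auto
  also have "\<dots> = pexp n (\<lambda>\<sigma>. G \<sigma> (\<sigma> u))"
  proof (rule pexp_cong)
    fix \<sigma> assume s: "\<sigma> \<in> perms n"
    have "\<sigma> \<circ> Transposition.transpose t u \<in> perms n" using s assms by (intro transpose_in_perms) auto
    moreover have "\<forall>s\<in>{1..t-1}. (\<sigma> \<circ> Transposition.transpose t u) s = \<sigma> s"
      using assms by (auto simp: Transposition.transpose_def)
    ultimately have "G (\<sigma> \<circ> Transposition.transpose t u) (\<sigma> u) = G \<sigma> (\<sigma> u)"
      by (intro adaptedD[OF assms(1)] s) blast+
    then show "G (\<sigma> \<circ> Transposition.transpose t u) ((\<sigma> \<circ> Transposition.transpose t u) t) = G \<sigma> (\<sigma> u)"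
      by simp
  qed
  finally show ?thesis .
qed

text \<open>Given the first \<open>t - 1\<close> values, \<open>\<sigma> t\<close> is uniform on the
  remaining ones. The conditional expectation appears as the average over positions
  \<open>u \<ge> t\<close>, which does not depend on the order of the unseen values.\<close>

lemma pexp_conditional:
  assumes "\<And>j. adapted n (t-1) (\<lambda>\<sigma>. G \<sigma> j)" "1 \<le> t" "t \<le> n"
  shows "pexp n (\<lambda>\<sigma>. G \<sigma> (\<sigma> t)) = pexp n (\<lambda>\<sigma>. (\<Sum>u\<in>{t..n}. G \<sigma> (\<sigma> u)) / (real n - real t + 1))"
proof -
  have "pexp n (\<lambda>\<sigma>. (\<Sum>u\<in>{t..n}. G \<sigma> (\<sigma> u)) / (real n - real t + 1))
      = pexp n (\<lambda>\<sigma>. inverse (real n - real t + 1) * (\<Sum>u\<in>{t..n}. G \<sigma> (\<sigma> u)))"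
    by (simp add: divide_inverse mult.commute)
  also have "\<dots> = inverse (real n - real t + 1) * (\<Sum>u\<in>{t..n}. pexp n (\<lambda>\<sigma>. G \<sigma> (\<sigma> u)))"
    by (simp only: pexp_cmult pexp_sum)
  also have "(\<Sum>u\<in>{t..n}. pexp n (\<lambda>\<sigma>. G \<sigma> (\<sigma> u))) = (\<Sum>u\<in>{t..n}. pexp n (\<lambda>\<sigma>. G \<sigma> (\<sigma> t)))"
    by (intro sum.cong refl pexp_swap[symmetric] assms) (use assms in auto)
  also have "\<dots> = (real n - real t + 1) * pexp n (\<lambda>\<sigma>. G \<sigma> (\<sigma> t))"
    using assms by (simp add: of_nat_diff)
  also have "inverse (real n - real t + 1) * \<dots> = pexp n (\<lambda>\<sigma>. G \<sigma> (\<sigma> t))"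
    using assms by simp
  finally show ?thesis by (rule sym)
qed

text \<open>Maclaurin's inequality, used as sampling without replacement being dominated by sampling
  with replacement. The factors are negatively correlated, as exchanging two positions
  produces a square.\<close>

lemma pexp_prod_le:
  fixes z :: "nat \<Rightarrow> real"
  assumes z: "\<And>j. j \<in> {1..n} \<Longrightarrow> 0 \<le> z j" and T: "T \<subseteq> {1..n}"
  shows "pexp n (\<lambda>\<sigma>. \<Prod>t\<in>T. z (\<sigma> t)) \<le> ((\<Sum>j\<in>{1..n}. z j) / real n) ^ card T"
proof -
  have "finite T" using T finite_subset by blast
  then show ?thesis using T
  proof (induction T rule: finite_induct)
    case empty then show ?case by simp
  next
    case (insert v T)
    then have v: "v \<in> {1..n}" and TT: "T \<subseteq> {1..n}" by auto
    have npos: "0 < real n" using v by auto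
    let ?Q = "\<lambda>S \<sigma>. \<Prod>t\<in>S. z (\<sigma> t)"
    have Q0: "0 \<le> ?Q S \<sigma>" if "S \<subseteq> {1..n}" "\<sigma> \<in> perms n" for S \<sigma>
    proof (rule prod_nonneg)
      fix t assume "t \<in> S"
      then show "0 \<le> z (\<sigma> t)" using z perms_in that by blast
    qed
    have key: "pexp n (\<lambda>\<sigma>. ?Q T \<sigma> * z (\<sigma> v)) \<le> pexp n (\<lambda>\<sigma>. ?Q T \<sigma> * z (\<sigma> u))"
      if u: "u \<in> {1..n}" for u
    proof (cases "u \<in> T")
      case False
      have "pexp n (\<lambda>\<sigma>. ?Q T \<sigma> * z (\<sigma> u))
          = pexp n (\<lambda>\<sigma>. ?Q T (\<sigma> \<circ> Transposition.transpose u v) * z ((\<sigma> \<circ> Transposition.transpose u v) u))"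
        by (rule pexp_transpose[OF u v, symmetric])
      also have "\<dots> = pexp n (\<lambda>\<sigma>. ?Q T \<sigma> * z (\<sigma> v))"
      proof (rule pexp_cong, rule arg_cong2[where f="(*)"])
        show "?Q T (\<sigma> \<circ> Transposition.transpose u v) = ?Q T \<sigma>" for \<sigma>
          using False insert.hyps by (intro prod.cong) (auto simp: Transposition.transpose_def)
      qed simp
      finally show ?thesis by simp
    next
      case True
      let ?S = "T - {u}"
      have uv: "u \<noteq> v" using True insert.hyps by auto
      have QT: "?Q T \<sigma> = z (\<sigma> u) * ?Q ?S \<sigma>" for \<sigma>
        using True insert.hyps by (simp add: prod.remove)
      have QS: "?Q ?S (\<sigma> \<circ> Transposition.transpose u v) = ?Q ?S \<sigma>" for \<sigma>
        using insert.hyps by (intro prod.cong) (auto simp: Transposition.transpose_def)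
      have "pexp n (\<lambda>\<sigma>. ?Q ?S \<sigma> * (z (\<sigma> u))\<^sup>2)
          = pexp n (\<lambda>\<sigma>. ?Q ?S (\<sigma> \<circ> Transposition.transpose u v) * (z ((\<sigma> \<circ> Transposition.transpose u v) u))\<^sup>2)"
        by (rule pexp_transpose[OF u v, symmetric])
      also have "\<dots> = pexp n (\<lambda>\<sigma>. ?Q ?S \<sigma> * (z (\<sigma> v))\<^sup>2)"
        unfolding QS by simp
      finally have e: "pexp n (\<lambda>\<sigma>. ?Q ?S \<sigma> * (z (\<sigma> u))\<^sup>2) = pexp n (\<lambda>\<sigma>. ?Q ?S \<sigma> * (z (\<sigma> v))\<^sup>2)" .
      have "0 \<le> pexp n (\<lambda>\<sigma>. ?Q ?S \<sigma> * (z (\<sigma> u) - z (\<sigma> v))\<^sup>2)"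
        using Q0[of ?S] TT by (intro pexp_nonneg mult_nonneg_nonneg) auto
      also have "\<dots> = pexp n (\<lambda>\<sigma>. (?Q ?S \<sigma> * (z (\<sigma> u))\<^sup>2 + ?Q ?S \<sigma> * (z (\<sigma> v))\<^sup>2)
          - 2 * (?Q T \<sigma> * z (\<sigma> v)))"
        unfolding QT by (rule pexp_cong) (simp add: algebra_simps power2_eq_square)
      also have "\<dots> = 2 * pexp n (\<lambda>\<sigma>. ?Q ?S \<sigma> * (z (\<sigma> u))\<^sup>2) - 2 * pexp n (\<lambda>\<sigma>. ?Q T \<sigma> * z (\<sigma> v))"
        by (simp only: pexp_diff pexp_add pexp_cmult e)
      also have "pexp n (\<lambda>\<sigma>. ?Q ?S \<sigma> * (z (\<sigma> u))\<^sup>2) = pexp n (\<lambda>\<sigma>. ?Q T \<sigma> * z (\<sigma> u))"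
        unfolding QT by (rule pexp_cong) (simp add: algebra_simps power2_eq_square)
      finally show ?thesis by simp
    qed
    \<comment> \<open>Summed over all \<open>u\<close>, the factor \<open>z (\<sigma> u)\<close>
      turns into the total of \<open>z\<close>, the same for every permutation, so it leaves the
      mean.\<close>
    have "real n * pexp n (\<lambda>\<sigma>. ?Q T \<sigma> * z (\<sigma> v)) \<le> (\<Sum>u\<in>{1..n}. pexp n (\<lambda>\<sigma>. ?Q T \<sigma> * z (\<sigma> u)))"
      using sum_mono[of "{1..n}" "\<lambda>_. pexp n (\<lambda>\<sigma>. ?Q T \<sigma> * z (\<sigma> v))", OF key] by simp
    also have "\<dots> = pexp n (\<lambda>\<sigma>. (\<Sum>j\<in>{1..n}. z j) * ?Q T \<sigma>)"
      unfolding pexp_sum[symmetric]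
    proof (rule pexp_cong)
      show "(\<Sum>u\<in>{1..n}. ?Q T \<sigma> * z (\<sigma> u)) = (\<Sum>j\<in>{1..n}. z j) * ?Q T \<sigma>" if "\<sigma> \<in> perms n" for \<sigma>
        unfolding sum_distrib_left[symmetric] sum_perms[OF that] by (rule mult.commute)
    qed
    also have "\<dots> \<le> (\<Sum>j\<in>{1..n}. z j) * ((\<Sum>j\<in>{1..n}. z j) / real n) ^ card T"
      unfolding pexp_cmult using insert.IH TT z by (intro mult_left_mono sum_nonneg) auto
    finally have "pexp n (\<lambda>\<sigma>. ?Q T \<sigma> * z (\<sigma> v)) \<le> ((\<Sum>j\<in>{1..n}. z j) / real n) ^ Suc (card T)"
      using npos by (simp add: field_simps)
    then show ?case using insert.hyps by (simp add: mult.commute)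
  qed
qed

section \<open>Exponential moments of sampled sums\<close>

lemma exp_le_chord:
  fixes x :: real
  assumes "0 \<le> x" "x \<le> 1"
  shows "exp (x * y) \<le> 1 + (exp y - 1) * x"
proof -
  have "exp ((1 - x) *\<^sub>R 0 + x *\<^sub>R y) \<le> (1 - x) * exp 0 + x * exp y"
    using assms by (intro convex_onD[OF exp_convex]) auto
  then show ?thesis by (simp add: algebra_simps)
qed

text \<open>Tight at both ends \<open>0\<close> and \<open>g\<close>. With
  \<open>y * g = ln (1 + eps)\<close> the slope is exactly \<open>eps / g\<close>, which explains
  the logarithm in \<open>nu\<close>; likewise for \<open>nu'\<close> and
  \<open>1 - eps\<close>.\<close>

lemma exp_le_chord_scaled:
  fixes x g :: real
  assumes "0 \<le> x" "x \<le> g" "0 < g"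
  shows "exp (y * x) \<le> 1 + (exp (y * g) - 1) / g * x"
  using exp_le_chord[of "x / g" "y * g"] assms by (simp add: field_simps)

text \<open>The chord makes each factor affine in \<open>c\<close>, so after Maclaurin's inequality
  only the total of \<open>c\<close> remains. The sign of \<open>u\<close> is free: positive for
  upper tails, negative for lower ones.\<close>

lemma pexp_mgf_le:
  fixes c :: "nat \<Rightarrow> real"
  assumes c: "\<And>j. j \<in> {1..n} \<Longrightarrow> 0 \<le> c j \<and> c j \<le> g" and g: "0 < g" and T: "T \<subseteq> {1..n}" and n: "0 < n"
  shows "pexp n (\<lambda>\<sigma>. exp (u * (\<Sum>t\<in>T. c (\<sigma> t))))
    \<le> exp (real (card T) / real n * ((exp (u * g) - 1) / g * (\<Sum>j\<in>{1..n}. c j)))"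
proof -
  let ?K = "(exp (u * g) - 1) / g * (\<Sum>j\<in>{1..n}. c j)"
  have fT: "finite T" using T finite_subset by blast
  have "pexp n (\<lambda>\<sigma>. exp (u * (\<Sum>t\<in>T. c (\<sigma> t)))) = pexp n (\<lambda>\<sigma>. \<Prod>t\<in>T. exp (u * c (\<sigma> t)))"
    using fT by (simp add: exp_sum sum_distrib_left)
  also have "\<dots> \<le> ((\<Sum>j\<in>{1..n}. exp (u * c j)) / real n) ^ card T"
    using T by (intro pexp_prod_le) auto
  also have "\<dots> \<le> (exp (?K / n)) ^ card T"
  proof (rule power_mono)
    have "(\<Sum>j\<in>{1..n}. exp (u * c j)) \<le> (\<Sum>j\<in>{1..n}. 1 + (exp (u * g) - 1) / g * c j)"
      using exp_le_chord_scaled c g by (intro sum_mono) auto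
    also have "\<dots> = real n + ?K" by (simp add: sum.distrib sum_distrib_left)
    finally have "(\<Sum>j\<in>{1..n}. exp (u * c j)) / real n \<le> (real n + ?K) / n" by (rule divide_right_mono) simp
    also have "\<dots> = 1 + ?K / n" using n by (simp add: add_divide_distrib)
    also have "\<dots> \<le> exp (?K / n)" by simp
    finally show "(\<Sum>j\<in>{1..n}. exp (u * c j)) / real n \<le> exp (?K / n)" .
  qed (simp add: sum_nonneg)
  also have "\<dots> = exp (real (card T) / real n * ?K)"
    by (simp flip: exp_of_nat_mult)
  finally show ?thesis .
qed

section \<open>The martingale of means over the unseen indices\<close>

definition rem_mean :: "nat \<Rightarrow> (nat \<Rightarrow> real) \<Rightarrow> nat \<Rightarrow> (nat \<Rightarrow> nat) \<Rightarrow> real" where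
  "rem_mean n c t \<sigma> = (\<Sum>u\<in>{t+1..n}. c (\<sigma> u)) / (real n - real t)"

lemma rem_sum_eq:
  assumes "\<sigma> \<in> perms n" "t \<le> n"
  shows "(\<Sum>u\<in>{t+1..n}. c (\<sigma> u)) = (\<Sum>j\<in>{1..n}. c j) - (\<Sum>u\<in>{1..t}. c (\<sigma> u) :: real)"
proof -
  have "{1..n} = {1..t} \<union> {t+1..n}" using assms by auto
  then have "(\<Sum>u\<in>{1..n}. c (\<sigma> u)) = (\<Sum>u\<in>{1..t}. c (\<sigma> u)) + (\<Sum>u\<in>{t+1..n}. c (\<sigma> u))"
    by (simp add: sum.union_disjoint)
  then show ?thesis using sum_perms[OF assms(1), of c] by simp
qed

text \<open>The total over all indices is the same for every permutation, so the unseen part is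
  known once the seen part is.\<close>

lemma adapted_rem_mean:
  assumes "t \<le> n" shows "adapted n t (rem_mean n c t)"
  unfolding adapted_def
proof (intro ballI impI)
  fix \<sigma> \<sigma>' assume s: "\<sigma> \<in> perms n" "\<sigma>' \<in> perms n" "\<forall>s\<in>{1..t}. \<sigma> s = \<sigma>' s"
  then have "(\<Sum>u\<in>{1..t}. c (\<sigma> u)) = (\<Sum>u\<in>{1..t}. c (\<sigma>' u))" by (intro sum.cong) auto
  then show "rem_mean n c t \<sigma> = rem_mean n c t \<sigma>'"
    unfolding rem_mean_def rem_sum_eq[OF s(1) assms] rem_sum_eq[OF s(2) assms] by simp
qed

text \<open>\<open>D\<close> will be the indicator that a level has already been reached. The step
  of the mean from \<open>t\<close> to \<open>t + 1\<close> has conditional mean zero, and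
  \<open>exp x \<ge> 1 + x\<close> at that step takes the place of Jensen's inequality.\<close>

lemma pexp_rem_mean_submartingale:
  assumes "t + 1 < n" "adapted n t D" "\<And>\<sigma>. \<sigma> \<in> perms n \<Longrightarrow> 0 \<le> D \<sigma>"
  shows "pexp n (\<lambda>\<sigma>. D \<sigma> * exp (l * rem_mean n c t \<sigma>))
    \<le> pexp n (\<lambda>\<sigma>. D \<sigma> * exp (l * rem_mean n c (t+1) \<sigma>))"
proof -
  let ?M = "rem_mean n c t"
  \<comment> \<open>The first-order term of the increment of \<open>exp (l * ?M)\<close>;
    \<open>t + 1 < n\<close> keeps its divisor positive.\<close>
  define G where "G \<sigma> j = D \<sigma> * exp (l * ?M \<sigma>) * (l * ((?M \<sigma> - c j) / (real n - real t - 1)))" for \<sigma> j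
  have M: "adapted n t ?M" using assms by (intro adapted_rem_mean) auto
  have "adapted n (t + 1 - 1) (\<lambda>\<sigma>. G \<sigma> j)" for j
    unfolding adapted_def G_def add_diff_cancel_right'
  proof (intro ballI impI)
    fix \<sigma> \<sigma>' assume s: "\<sigma> \<in> perms n" "\<sigma>' \<in> perms n" "\<forall>s\<in>{1..t}. \<sigma> s = \<sigma>' s"
    then have "?M \<sigma> = ?M \<sigma>'" "D \<sigma> = D \<sigma>'" using M assms(2) unfolding adapted_def by blast+
    then show "D \<sigma> * exp (l * ?M \<sigma>) * (l * ((?M \<sigma> - c j) / (real n - real t - 1)))
      = D \<sigma>' * exp (l * ?M \<sigma>') * (l * ((?M \<sigma>' - c j) / (real n - real t - 1)))" by simp
  qed
  then have "pexp n (\<lambda>\<sigma>. G \<sigma> (\<sigma> (t+1)))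
      = pexp n (\<lambda>\<sigma>. (\<Sum>u\<in>{t+1..n}. G \<sigma> (\<sigma> u)) / (real n - real (t+1) + 1))"
    using assms by (intro pexp_conditional) auto
  also have "\<dots> = pexp n (\<lambda>\<sigma>. 0)"
  proof (rule pexp_cong)
    fix \<sigma> assume "\<sigma> \<in> perms n"
    have "(\<Sum>u\<in>{t+1..n}. ?M \<sigma> - c (\<sigma> u)) = 0"
      using assms by (simp add: sum_subtractf rem_mean_def of_nat_diff)
    then show "(\<Sum>u\<in>{t+1..n}. G \<sigma> (\<sigma> u)) / (real n - real (t+1) + 1) = 0"
      unfolding G_def by (simp add: sum_distrib_left[symmetric] sum_divide_distrib[symmetric])
  qed
  finally have G0: "pexp n (\<lambda>\<sigma>. G \<sigma> (\<sigma> (t+1))) = 0" by simp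
  have "pexp n (\<lambda>\<sigma>. D \<sigma> * exp (l * ?M \<sigma>)) = pexp n (\<lambda>\<sigma>. D \<sigma> * exp (l * ?M \<sigma>) + G \<sigma> (\<sigma> (t+1)))"
    by (simp only: pexp_add G0 add_0_right)
  also have "\<dots> \<le> pexp n (\<lambda>\<sigma>. D \<sigma> * exp (l * rem_mean n c (t+1) \<sigma>))"
  proof (rule pexp_mono)
    fix \<sigma> assume s: "\<sigma> \<in> perms n"
    let ?M' = "rem_mean n c (t+1) \<sigma>"
    have "{t+1..n} = insert (t+1) {t+1+1..n}" using assms by auto
    then have "(real n - real t) * ?M \<sigma> = c (\<sigma> (t+1)) + (real n - real t - 1) * ?M'"
      unfolding rem_mean_def using assms by (simp add: divide_simps) (simp add: algebra_simps)
    then have d: "?M' - ?M \<sigma> = (?M \<sigma> - c (\<sigma> (t+1))) / (real n - real t - 1)"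
      using assms by (simp add: field_simps)
    have "exp (l * ?M \<sigma>) * (1 + l * (?M' - ?M \<sigma>)) \<le> exp (l * ?M \<sigma>) * exp (l * (?M' - ?M \<sigma>))"
      by (intro mult_left_mono exp_ge_add_one_self) auto
    also have "\<dots> = exp (l * ?M')" by (simp add: exp_add[symmetric] algebra_simps)
    finally have "D \<sigma> * (exp (l * ?M \<sigma>) * (1 + l * (?M' - ?M \<sigma>))) \<le> D \<sigma> * exp (l * ?M')"
      using assms(3)[OF s] by (rule mult_left_mono)
    then show "D \<sigma> * exp (l * ?M \<sigma>) + G \<sigma> (\<sigma> (t+1)) \<le> D \<sigma> * exp (l * ?M')"
      unfolding G_def d[symmetric] by (simp add: algebra_simps)
  qed
  finally show ?thesis .
qed

text \<open>Doob's maximal inequality: the event is split by the first time at which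
  \<open>k\<close> is reached, and the weight already collected is carried forward by the
  submartingale property. A negative \<open>l\<close> turns it into a statement about small
  means.\<close>

lemma pexp_rem_mean_maximal:
  assumes "T < n"
  shows "pexp n (\<lambda>\<sigma>. of_bool (\<exists>t\<le>T. k \<le> l * rem_mean n c t \<sigma>))
     \<le> exp (- k) * pexp n (\<lambda>\<sigma>. exp (l * rem_mean n c T \<sigma>))"
proof -
  let ?C = "\<lambda>T \<sigma>. \<exists>t\<le>T. k \<le> l * rem_mean n c t \<sigma>"
  have "exp k * pexp n (\<lambda>\<sigma>. of_bool (?C T \<sigma>)) \<le> pexp n (\<lambda>\<sigma>. of_bool (?C T \<sigma>) * exp (l * rem_mean n c T \<sigma>))"
    using assms
  proof (induction T)
    case 0
    then show ?case unfolding pexp_cmult[symmetric] by (intro pexp_mono) auto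
  next
    case (Suc T)
    let ?E = "\<lambda>\<sigma>. k \<le> l * rem_mean n c (T+1) \<sigma> \<and> \<not> ?C T \<sigma>"
    have split: "of_bool (?C (Suc T) \<sigma>) = of_bool (?C T \<sigma>) + (of_bool (?E \<sigma>) :: real)" for \<sigma>
      using le_Suc_eq by auto
    have "adapted n T (\<lambda>\<sigma>. of_bool (?C T \<sigma>) :: real)"
    proof (rule adaptedI)
      fix \<sigma> \<sigma>' assume s: "\<sigma> \<in> perms n" "\<sigma>' \<in> perms n" "\<And>s. s \<in> {1..T} \<Longrightarrow> \<sigma> s = \<sigma>' s"
      have "rem_mean n c t \<sigma> = rem_mean n c t \<sigma>'" if "t \<le> T" for t
        using that Suc.prems s by (intro adaptedD[OF adapted_rem_mean]) auto
      then have "?C T \<sigma> \<longleftrightarrow> ?C T \<sigma>'" by (intro ex_cong1 conj_cong) simp_all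
      then show "of_bool (?C T \<sigma>) = (of_bool (?C T \<sigma>') :: real)" by (rule arg_cong)
    qed
    then have "pexp n (\<lambda>\<sigma>. of_bool (?C T \<sigma>) * exp (l * rem_mean n c T \<sigma>))
       \<le> pexp n (\<lambda>\<sigma>. of_bool (?C T \<sigma>) * exp (l * rem_mean n c (T+1) \<sigma>))"
      using Suc.prems by (intro pexp_rem_mean_submartingale) auto
    moreover have "exp k * pexp n (\<lambda>\<sigma>. of_bool (?E \<sigma>)) \<le> pexp n (\<lambda>\<sigma>. of_bool (?E \<sigma>) * exp (l * rem_mean n c (T+1) \<sigma>))"
      unfolding pexp_cmult[symmetric] by (rule pexp_mono) auto
    ultimately show ?case
      using Suc.IH Suc.prems unfolding split by (simp add: pexp_add distrib_right distrib_left)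
  qed
  also have "\<dots> \<le> pexp n (\<lambda>\<sigma>. exp (l * rem_mean n c T \<sigma>))"
    by (rule pexp_mono) auto
  finally show ?thesis by (simp add: exp_minus field_simps)
qed

section \<open>Concentration of sampled and remaining means\<close>

lemma ln_one_plus_ge:
  fixes x :: real
  assumes "0 \<le> x"
  shows "x - x\<^sup>2 / 2 \<le> ln (1 + x)"
proof -
  let ?h = "\<lambda>x::real. ln (1 + x) - (x - x\<^sup>2 / 2)"
  have "?h 0 \<le> ?h x"
  proof (rule DERIV_nonneg_imp_nondecreasing[OF assms])
    fix y :: real assume y: "0 \<le> y" "y \<le> x"
    have "(?h has_real_derivative (1 / (1 + y) - (1 - y))) (at y)"
      using y by (auto intro!: derivative_eq_intros)
    moreover have "1 / (1 + y) - (1 - y) = y\<^sup>2 / (1 + y)"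
      using y by (simp add: field_simps power2_eq_square)
    ultimately show "\<exists>z. (?h has_real_derivative z) (at y) \<and> 0 \<le> z"
      using y by (intro exI[of _ "y\<^sup>2 / (1 + y)"]) auto
  qed
  then show ?thesis by simp
qed

text \<open>\<open>2 / 5\<close> is \<open>(1 - x) / 2\<close> at \<open>x = 1 / 5\<close>, the
  bound available for all widths. It is the origin of the \<open>5\<close> in the failure
  probability \<open>B\<close>.\<close>

lemma entropy_plus_ge:
  fixes x :: real
  assumes "0 \<le> x" "x \<le> 1 / 5"
  shows "(2 / 5) * x\<^sup>2 \<le> (1 + x) * ln (1 + x) - x"
proof -
  have "(1 + x) * (x - x\<^sup>2 / 2) \<le> (1 + x) * ln (1 + x)"
    using assms ln_one_plus_ge by (intro mult_left_mono) auto
  moreover have "(1 + x) * (x - x\<^sup>2 / 2) - x = x\<^sup>2 * ((1 - x) / 2)"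
    by (simp add: field_simps power2_eq_square)
  moreover have "x\<^sup>2 * (2 / 5) \<le> x\<^sup>2 * ((1 - x) / 2)"
    using assms by (intro mult_left_mono) auto
  ultimately show ?thesis by simp
qed

text \<open>The argument gives \<open>x\<^sup>2 / 2\<close>; the weaker constant lets both tails
  share one exponent.\<close>

lemma entropy_minus_ge:
  fixes x :: real
  assumes "0 \<le> x" "x < 1"
  shows "(2 / 5) * x\<^sup>2 \<le> (1 - x) * ln (1 - x) + x"
proof -
  let ?h = "\<lambda>x::real. (1 - x) * ln (1 - x) + x - x\<^sup>2 / 2"
  have "?h 0 \<le> ?h x"
  proof (rule DERIV_nonneg_imp_nondecreasing[OF assms(1)])
    fix y :: real assume y: "0 \<le> y" "y \<le> x"
    have "(?h has_real_derivative (- ln (1 - y) - y)) (at y)"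
      by (rule derivative_eq_intros refl | use y assms in simp)+
    moreover have "ln (1 - y) \<le> - y" using ln_add_one_self_le_self2[of "- y"] y assms by simp
    ultimately show "\<exists>z. (?h has_real_derivative z) (at y) \<and> 0 \<le> z"
      by (intro exI[of _ "- ln (1 - y) - y"]) auto
  qed
  then have "x\<^sup>2 / 2 \<le> (1 - x) * ln (1 - x) + x" by simp
  then show ?thesis using zero_le_power2[of x] by linarith
qed

text \<open>The deviation is additive, \<open>C + x\<close> and not \<open>C * (1 + x)\<close>,
  because the total use \<open>C\<close> of a resource may be tiny or zero. The parameter
  \<open>u\<close> is the optimal one for \<open>C = 1\<close>, which is the worst case since
  \<open>ln (1 + x) \<le> x\<close>.\<close>

lemma chernoff_upper_exponent:
  fixes s C x g :: real
  assumes "0 < g" "0 \<le> s" "C \<le> 1" "0 \<le> x" "x \<le> 1 / 5" and u: "u = ln (1 + x) / g"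
  shows "exp (- (u * (s * (C + x)))) * exp (s * ((exp (u * g) - 1) / g * C)) \<le> exp (- (2 / 5) * s * x\<^sup>2 / g)"
proof -
  have e: "exp (u * g) = 1 + x" using assms by simp
  have "(x - ln (1 + x)) * C \<le> (x - ln (1 + x)) * 1"
    using assms ln_add_one_self_le_self by (intro mult_left_mono) auto
  then have "x * C - ln (1 + x) * (C + x) \<le> x - (1 + x) * ln (1 + x)" by (simp add: algebra_simps)
  also have "\<dots> \<le> - (2 / 5) * x\<^sup>2" using entropy_plus_ge assms by force
  finally have "(s / g) * (x * C - ln (1 + x) * (C + x)) \<le> (s / g) * (- (2 / 5) * x\<^sup>2)"
    using assms by (intro mult_left_mono) auto
  then have "- (u * (s * (C + x))) + s * ((exp (u * g) - 1) / g * C) \<le> - (2 / 5) * s * x\<^sup>2 / g"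
    unfolding e unfolding u by (simp add: algebra_simps diff_divide_distrib add_divide_distrib)
  then show ?thesis unfolding exp_add[symmetric] by simp
qed

lemma chernoff_lower_exponent:
  fixes s x g :: real
  assumes "0 < g" "0 \<le> s" "0 \<le> x" "x \<le> 1 / 5" and u: "u = ln (1 - x) / g"
  shows "exp (- (u * (s * (1 - x)))) * exp (s * ((exp (u * g) - 1) / g * 1)) \<le> exp (- (2 / 5) * s * x\<^sup>2 / g)"
proof -
  have e: "exp (u * g) = 1 - x" using assms by simp
  have "- x - (1 - x) * ln (1 - x) \<le> - (2 / 5) * x\<^sup>2" using entropy_minus_ge[of x] assms by auto
  then have "(s / g) * (- x - (1 - x) * ln (1 - x)) \<le> (s / g) * (- (2 / 5) * x\<^sup>2)"
    using assms by (intro mult_left_mono) auto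
  then have "- (u * (s * (1 - x))) + s * ((exp (u * g) - 1) / g * 1) \<le> - (2 / 5) * s * x\<^sup>2 / g"
    unfolding e unfolding u by (simp add: algebra_simps diff_divide_distrib add_divide_distrib)
  then show ?thesis unfolding exp_add[symmetric] by simp
qed

lemma markov_exp:
  assumes "\<And>\<sigma>. \<sigma> \<in> perms n \<Longrightarrow> Q \<sigma> \<Longrightarrow> k \<le> Y \<sigma>"
  shows "pexp n (\<lambda>\<sigma>. of_bool (Q \<sigma>)) \<le> exp (- k) * pexp n (\<lambda>\<sigma>. exp (Y \<sigma>))"
  unfolding pexp_cmult[symmetric]
proof (rule pexp_mono)
  fix \<sigma> assume s: "\<sigma> \<in> perms n"
  show "of_bool (Q \<sigma>) \<le> exp (- k) * exp (Y \<sigma>)"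
    unfolding exp_add[symmetric] using assms[OF s] by (cases "Q \<sigma>") auto
qed

context
  fixes n :: nat and g :: real and c :: "nat \<Rightarrow> real"
  assumes n: "0 < n" and g: "0 < g" and c: "\<And>j. j \<in> {1..n} \<Longrightarrow> 0 \<le> c j \<and> c j \<le> g"
begin

lemma sample_upper_tail:
  assumes T: "T \<subseteq> {1..n}" and s: "s = real (card T) / real n" and C: "(\<Sum>j\<in>{1..n}. c j) = C" "C \<le> 1"
    and x: "0 \<le> x" "x \<le> 1 / 5"
  shows "pexp n (\<lambda>\<sigma>. of_bool (s * (C + x) \<le> (\<Sum>t\<in>T. c (\<sigma> t)))) \<le> exp (- (2 / 5) * s * x\<^sup>2 / g)"
proof -
  define u where "u = ln (1 + x) / g"
  have u0: "0 \<le> u" using x g by (simp add: u_def)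
  have "pexp n (\<lambda>\<sigma>. of_bool (s * (C + x) \<le> (\<Sum>t\<in>T. c (\<sigma> t))))
      \<le> exp (- (u * (s * (C + x)))) * pexp n (\<lambda>\<sigma>. exp (u * (\<Sum>t\<in>T. c (\<sigma> t))))"
    using u0 by (intro markov_exp mult_left_mono)
  also have "\<dots> \<le> exp (- (u * (s * (C + x)))) * exp (s * ((exp (u * g) - 1) / g * C))"
    unfolding s C(1)[symmetric] by (intro mult_left_mono pexp_mgf_le c g T n) auto
  also have "\<dots> \<le> exp (- (2 / 5) * s * x\<^sup>2 / g)"
    using g C x by (intro chernoff_upper_exponent) (auto simp: u_def s)
  finally show ?thesis .
qed

lemma sample_lower_tail:
  assumes T: "T \<subseteq> {1..n}" and s: "s = real (card T) / real n" and C: "(\<Sum>j\<in>{1..n}. c j) = 1"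
    and x: "0 \<le> x" "x \<le> 1 / 5"
  shows "pexp n (\<lambda>\<sigma>. of_bool ((\<Sum>t\<in>T. c (\<sigma> t)) \<le> s * (1 - x))) \<le> exp (- (2 / 5) * s * x\<^sup>2 / g)"
proof -
  define u where "u = ln (1 - x) / g"
  have u0: "u \<le> 0" using x g by (auto simp: u_def divide_le_0_iff)
  have "pexp n (\<lambda>\<sigma>. of_bool ((\<Sum>t\<in>T. c (\<sigma> t)) \<le> s * (1 - x)))
      \<le> exp (- (u * (s * (1 - x)))) * pexp n (\<lambda>\<sigma>. exp (u * (\<Sum>t\<in>T. c (\<sigma> t))))"
    using u0 by (intro markov_exp mult_left_mono_neg)
  also have "\<dots> \<le> exp (- (u * (s * (1 - x)))) * exp (s * ((exp (u * g) - 1) / g * 1))"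
    using pexp_mgf_le[where c=c, OF c g T n, where u=u] unfolding s C by (intro mult_left_mono) auto
  also have "\<dots> \<le> exp (- (2 / 5) * s * x\<^sup>2 / g)"
    using g x by (intro chernoff_lower_exponent) (auto simp: u_def s)
  finally show ?thesis .
qed

lemma rem_mgf_le:
  assumes "T < n" and s: "s = (real n - real T) / real n"
  shows "pexp n (\<lambda>\<sigma>. exp (u * (real n - real T) * rem_mean n c T \<sigma>))
    \<le> exp (s * ((exp (u * g) - 1) / g * (\<Sum>j\<in>{1..n}. c j)))"
proof -
  have "pexp n (\<lambda>\<sigma>. exp (u * (real n - real T) * rem_mean n c T \<sigma>))
      = pexp n (\<lambda>\<sigma>. exp (u * (\<Sum>t\<in>{T+1..n}. c (\<sigma> t))))"
    using assms(1) by (simp add: rem_mean_def)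
  also have "\<dots> \<le> exp (real (card {T+1..n}) / real n * ((exp (u * g) - 1) / g * (\<Sum>j\<in>{1..n}. c j)))"
    by (intro pexp_mgf_le c g n) auto
  also have "real (card {T+1..n}) / real n = s" using assms by (simp add: of_nat_diff)
  finally show ?thesis .
qed

text \<open>With the parameter \<open>u * (n - T)\<close> the exponential of the mean at
  \<open>T\<close> becomes that of a plain sum over the last \<open>n - T\<close> positions. This
  one moment controls every \<open>t \<le> T\<close>, so no union over times is paid.\<close>

lemma rem_upper_tail:
  assumes T: "T < n" and s: "s = (real n - real T) / real n" and C: "(\<Sum>j\<in>{1..n}. c j) = C" "C \<le> 1"
    and x: "0 \<le> x" "x \<le> 1 / 5"
  shows "pexp n (\<lambda>\<sigma>. of_bool (\<exists>t\<le>T. (C + x) / real n \<le> rem_mean n c t \<sigma>)) \<le> exp (- (2 / 5) * s * x\<^sup>2 / g)"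
proof -
  define u where "u = ln (1 + x) / g"
  have u0: "0 \<le> u * (real n - real T)" using x g T by (simp add: u_def)
  have k: "u * (s * (C + x)) = u * (real n - real T) * ((C + x) / real n)" by (simp add: s)
  have "pexp n (\<lambda>\<sigma>. of_bool (\<exists>t\<le>T. (C + x) / real n \<le> rem_mean n c t \<sigma>))
      \<le> pexp n (\<lambda>\<sigma>. of_bool (\<exists>t\<le>T. u * (s * (C + x)) \<le> u * (real n - real T) * rem_mean n c t \<sigma>))"
    unfolding k by (intro pexp_mono, simp only: of_bool_less_eq_iff) (blast intro: mult_left_mono[OF _ u0])
  also have "\<dots> \<le> exp (- (u * (s * (C + x)))) * pexp n (\<lambda>\<sigma>. exp (u * (real n - real T) * rem_mean n c T \<sigma>))"
    using T by (rule pexp_rem_mean_maximal)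
  also have "\<dots> \<le> exp (- (u * (s * (C + x)))) * exp (s * ((exp (u * g) - 1) / g * C))"
    unfolding C(1)[symmetric] by (intro mult_left_mono rem_mgf_le T s) auto
  also have "\<dots> \<le> exp (- (2 / 5) * s * x\<^sup>2 / g)"
    using g C x T by (intro chernoff_upper_exponent) (auto simp: u_def s)
  finally show ?thesis .
qed

lemma rem_lower_tail:
  assumes T: "T < n" and s: "s = (real n - real T) / real n" and C: "(\<Sum>j\<in>{1..n}. c j) = 1"
    and x: "0 \<le> x" "x \<le> 1 / 5"
  shows "pexp n (\<lambda>\<sigma>. of_bool (\<exists>t\<le>T. rem_mean n c t \<sigma> \<le> (1 - x) / real n)) \<le> exp (- (2 / 5) * s * x\<^sup>2 / g)"
proof -
  define u where "u = ln (1 - x) / g"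
  have u0: "u * (real n - real T) \<le> 0" using x g T by (auto simp: u_def divide_le_0_iff mult_le_0_iff)
  have k: "u * (s * (1 - x)) = u * (real n - real T) * ((1 - x) / real n)" by (simp add: s)
  have "pexp n (\<lambda>\<sigma>. of_bool (\<exists>t\<le>T. rem_mean n c t \<sigma> \<le> (1 - x) / real n))
      \<le> pexp n (\<lambda>\<sigma>. of_bool (\<exists>t\<le>T. u * (s * (1 - x)) \<le> u * (real n - real T) * rem_mean n c t \<sigma>))"
    unfolding k by (intro pexp_mono, simp only: of_bool_less_eq_iff) (blast intro: mult_left_mono_neg[OF _ u0])
  also have "\<dots> \<le> exp (- (u * (s * (1 - x)))) * pexp n (\<lambda>\<sigma>. exp (u * (real n - real T) * rem_mean n c T \<sigma>))"
    using T by (rule pexp_rem_mean_maximal)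
  also have "\<dots> \<le> exp (- (u * (s * (1 - x)))) * exp (s * ((exp (u * g) - 1) / g * 1))"
    using rem_mgf_le[OF T s, where u=u] unfolding C by (intro mult_left_mono) auto
  also have "\<dots> \<le> exp (- (2 / 5) * s * x\<^sup>2 / g)"
    using g x T by (intro chernoff_lower_exponent) (auto simp: u_def s)
  finally show ?thesis .
qed

end

section \<open>Dyadic levels\<close>

text \<open>Both index maps of the algorithm are this one: \<open>\<eta>(t)\<close> is the level of \<open>t\<close>, and
  \<open>\<kappa>(t)\<close> the level of the number \<open>n - t + 1\<close> of elements still unseen at time \<open>t\<close>.\<close>

definition lev :: "nat \<Rightarrow> nat \<Rightarrow> nat" where
  "lev N t = (LEAST h. t \<le> N * 2 ^ h)"

definition wid :: "real \<Rightarrow> nat \<Rightarrow> real" where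
  "wid eps h = 2 powr (- real h / 2) * sqrt eps"

lemma lev_eqI:
  assumes "1 \<le> h" "N * 2 ^ (h - 1) < t" "t \<le> N * 2 ^ h"
  shows "lev N t = h"
  unfolding lev_def
proof (rule Least_equality)
  fix k assume k: "t \<le> N * 2 ^ k"
  show "h \<le> k"
  proof (rule ccontr)
    assume "\<not> h \<le> k"
    then have "(2::nat) ^ k \<le> 2 ^ (h - 1)" by (intro power_increasing) auto
    then have "N * 2 ^ k \<le> N * 2 ^ (h - 1)" by simp
    then show False using assms k by linarith
  qed
qed fact

lemma lev_bounds:
  assumes "N < t" "t \<le> N * 2 ^ K"
  shows "1 \<le> lev N t" "lev N t \<le> K" "N * 2 ^ (lev N t - 1) < t" "t \<le> N * 2 ^ lev N t"
proof -
  show le: "t \<le> N * 2 ^ lev N t" unfolding lev_def using assms(2) by (rule LeastI)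
  show "lev N t \<le> K" unfolding lev_def using assms(2) by (rule Least_le)
  show ge: "1 \<le> lev N t" using le assms(1) by (cases "lev N t") auto
  show "N * 2 ^ (lev N t - 1) < t"
    using not_less_Least[of "lev N t - 1" "\<lambda>h. t \<le> N * 2 ^ h"] ge unfolding lev_def by auto
qed

text \<open>Each new level adds \<open>N * 2 powr (K / 2) / sqrt 2\<close>, so an induction with
  constant \<open>c\<close> needs \<open>c + 1 / sqrt 2 \<le> c * sqrt 2\<close>, that is
  \<open>c \<ge> 1 + sqrt 2 / 2\<close>. \<open>12 / 7\<close> is a rational slightly above this,
  and for it the condition reads \<open>24 / 17 \<le> sqrt 2\<close>.\<close>

lemma sum_lev_le:
  "(\<Sum>t\<in>{N+1..N * 2 ^ K}. 2 powr (- real (lev N t) / 2)) \<le> (12 / 7) * real N * 2 powr (real K / 2)"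
proof (induction K)
  case 0 then show ?case by simp
next
  case (Suc K)
  let ?w = "\<lambda>t. 2 powr (- real (lev N t) / 2)"
  let ?r = "2 powr (real K / 2)"
  have sq: "24 / 17 \<le> sqrt 2"
    by (rule real_le_rsqrt) (simp add: power2_eq_square)
  have "(\<Sum>t\<in>{N+1..N * 2 ^ Suc K}. ?w t)
      = (\<Sum>t\<in>{N+1..N * 2 ^ K}. ?w t) + (\<Sum>t\<in>{N * 2 ^ K + 1..N * 2 ^ Suc K}. ?w t)"
  proof (subst sum.union_disjoint[symmetric])
    define M where "M = N * 2 ^ K"
    have M: "N \<le> M" "N * 2 ^ Suc K = 2 * M" by (simp_all add: M_def)
    show "sum ?w {N+1..N * 2 ^ Suc K} = sum ?w ({N+1..N * 2 ^ K} \<union> {N * 2 ^ K + 1..N * 2 ^ Suc K})"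
      unfolding M(2) M_def[symmetric] using M(1) by (intro arg_cong[where f = "sum ?w"]) auto
  qed auto
  also have "(\<Sum>t\<in>{N * 2 ^ K + 1..N * 2 ^ Suc K}. ?w t)
      = (\<Sum>t\<in>{N * 2 ^ K + 1..N * 2 ^ Suc K}. 2 powr (- real (Suc K) / 2))"
  proof (rule sum.cong)
    fix t assume "t \<in> {N * 2 ^ K + 1..N * 2 ^ Suc K}"
    then have "lev N t = Suc K" by (intro lev_eqI) auto
    then show "?w t = 2 powr (- real (Suc K) / 2)" by (rule arg_cong)
  qed simp
  also have "\<dots> = real N * 2 ^ K * 2 powr (- real (Suc K) / 2)"
    by simp
  also have "\<dots> = real N * 2 powr (real K + - real (Suc K) / 2)"
    unfolding powr_add by (simp add: powr_realpow)
  also have "real K + - real (Suc K) / 2 = real K / 2 - 1 / 2" by (simp add: field_simps)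
  also have "real N * 2 powr (real K / 2 - 1 / 2) = real N * ?r / sqrt 2"
    by (simp add: powr_diff powr_half_sqrt)
  finally have e: "(\<Sum>t\<in>{N+1..N * 2 ^ Suc K}. ?w t) = (\<Sum>t\<in>{N+1..N * 2 ^ K}. ?w t) + real N * ?r / sqrt 2" .
  also have "\<dots> \<le> (12 / 7) * real N * ?r + real N * ?r / sqrt 2" using Suc.IH by simp
  also have "\<dots> = real N * ?r * (12 / 7 + 1 / sqrt 2)" by (simp add: field_simps)
  also have "\<dots> \<le> real N * ?r * (12 / 7 * sqrt 2)"
  proof (rule mult_left_mono)
    have "1 / sqrt 2 = sqrt 2 / 2" by (simp add: real_div_sqrt field_simps)
    with sq show "12 / 7 + 1 / sqrt 2 \<le> 12 / 7 * sqrt 2" by simp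
  qed simp
  also have "\<dots> = (12 / 7) * real N * 2 powr (real (Suc K) / 2)"
    by (simp add: add_divide_distrib powr_add powr_half_sqrt)
  finally show ?case .
qed

text \<open>The integral form of the hypotheses on \<open>n\<close> and \<open>eps\<close>. As
  \<open>eps \<le> 1 / 12 < 1 / 8\<close> is a power of two, \<open>L \<ge> 4\<close> and
  \<open>eps \<le> 1 / 16\<close>, the bound used in the numerical estimates.\<close>

locale scale =
  fixes N L n :: nat and eps :: real
  assumes N1: "1 \<le> N" and L4: "4 \<le> L" and n_eq: "n = N * 2 ^ L" and eps_eq: "eps = 1 / 2 ^ L"
begin

lemma eps_pos: "0 < eps" by (simp add: eps_eq)

lemma eps_le: "eps \<le> 1 / 16"
proof -
  have "(2::real) ^ 4 \<le> 2 ^ L" using L4 by (intro power_increasing) auto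
  then show ?thesis by (simp add: eps_eq field_simps)
qed

lemma n_eps: "real n * eps = real N" by (simp add: n_eq eps_eq)

lemma n16: "16 * N \<le> n"
proof -
  have "(2::nat) ^ 4 \<le> 2 ^ L" using L4 by (intro power_increasing) auto
  then show ?thesis by (simp add: n_eq)
qed

lemma n_pos: "0 < n" using n16 N1 by linarith

lemma neps_eq: "neps n eps = N" by (simp add: neps_def n_eps)

text \<open>A union over the levels costs a factor \<open>L\<close>. A spare \<open>sqrt eps\<close>
  in the bound on \<open>B\<close> pays for it, because \<open>L ^ 2 \<le> 2 ^ L\<close> from
  \<open>L = 4\<close> on.\<close>

lemma L_sqrt_eps: "real L * sqrt eps \<le> 1"
proof -
  have "L ^ 2 \<le> 2 ^ L" using L4
  proof (induction L rule: dec_induct)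
    case (step k)
    have "(k + 1)\<^sup>2 \<le> 2 * k\<^sup>2"
    proof -
      have "4 * k \<le> k * k" using step by simp
      then have "1 + 2 * k \<le> k * k" using step by linarith
      then show ?thesis by (simp add: power2_eq_square algebra_simps)
    qed
    then show ?case using step by simp
  qed simp
  then have "real L ^ 2 * eps \<le> 1" unfolding eps_eq
    by (simp add: divide_le_eq) (metis of_nat_le_iff of_nat_power of_nat_numeral)
  then have "sqrt (real L ^ 2 * eps) \<le> 1" by simp
  then show ?thesis by (simp add: real_sqrt_mult)
qed

lemma theta_eq: "theta eps h = wid eps (Suc h)"
proof -
  have "- (real h + 1) / 2 = - real (Suc h) / 2" by simp
  then show ?thesis unfolding theta_def wid_def by (rule arg_cong)
qed

lemma wid_pos: "0 < wid eps h" using eps_pos by (simp add: wid_def)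

lemma wid_sq: "(wid eps h)\<^sup>2 = eps / 2 ^ h"
proof -
  have "(2 powr (- real h / 2))\<^sup>2 = 2 powr (- real h)"
    by (simp add: power2_eq_square flip: powr_add)
  also have "\<dots> = 1 / 2 ^ h" by (simp add: powr_minus_divide powr_realpow)
  finally show ?thesis using eps_pos by (simp add: wid_def power_mult_distrib)
qed

lemma wid_le: "1 \<le> h \<Longrightarrow> wid eps h \<le> 1 / 5"
proof (rule power2_le_imp_le)
  assume "1 \<le> h"
  then have "(2::real) ^ 1 \<le> 2 ^ h" by (intro power_increasing) auto
  then have "eps / 2 ^ h \<le> eps / 2" using eps_pos by (intro divide_left_mono) auto
  also have "\<dots> \<le> (1 / 5)\<^sup>2" using eps_le by (simp add: power2_eq_square)
  finally show "(wid eps h)\<^sup>2 \<le> (1 / 5)\<^sup>2" unfolding wid_sq .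
qed simp

text \<open>Sampled fraction times squared width does not depend on the level. The widths are chosen
  for this: all levels obtain the same failure bound.\<close>

lemma wid_scaled: "2 ^ h * eps * (wid eps (Suc h))\<^sup>2 = eps\<^sup>2 / 2"
  unfolding wid_sq by (simp add: power2_eq_square)

lemma eta_eq:
  assumes "t \<in> {N+1..n}" shows "eta n eps t = lev N t"
proof -
  have iff: "(1 \<le> h \<and> real n * 2 ^ (h - 1) * eps < real t \<and> real t \<le> real n * 2 ^ h * eps)
      \<longleftrightarrow> (1 \<le> h \<and> N * 2 ^ (h - 1) < t \<and> t \<le> N * 2 ^ h)" for h
  proof -
    have "real n * 2 ^ k * eps = real (N * 2 ^ k)" for k
    proof -
      have "real n * 2 ^ k * eps = (real n * eps) * 2 ^ k" by (rule mult.commute[THEN trans]) simp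
      then show ?thesis unfolding n_eps by simp
    qed
    then show ?thesis by (simp only: of_nat_less_iff of_nat_le_iff)
  qed
  show ?thesis unfolding eta_def iff
  proof (rule the_equality)
    show "1 \<le> lev N t \<and> N * 2 ^ (lev N t - 1) < t \<and> t \<le> N * 2 ^ lev N t"
      using lev_bounds[of N t L] assms n_eq by auto
  qed (metis lev_eqI)
qed

text \<open>The floor gives \<open>2 ^ (h - 1) \<le> (n - t) / N < 2 ^ h\<close>, while
  \<open>lev\<close> is strict on the left. Over the integers the two agree after the shift from
  \<open>n - t\<close> to \<open>n - t + 1\<close>.\<close>

lemma kappa_eq:
  assumes "t \<in> {1..n - N}" shows "kappa n eps t = lev N (n - t + 1)"
proof -
  define h where "h = lev N (n - t + 1)"
  have h: "1 \<le> h" "N * 2 ^ (h - 1) < n - t + 1" "n - t + 1 \<le> N * 2 ^ h"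
    using lev_bounds[of N "n - t + 1" L] assms n_eq n16 N1 unfolding h_def by auto
  let ?x = "(real n - real t) / (real n * eps)"
  have nt: "real n - real t = real (n - t)" using assms by (subst of_nat_diff) auto
  have "real (N * 2 ^ (h - 1)) \<le> real (n - t)" "real (n - t) < real (N * 2 ^ h)"
    using h by (simp_all only: of_nat_le_iff of_nat_less_iff)
  then have b: "2 ^ (h - 1) \<le> ?x" "?x < 2 ^ h"
    using N1 unfolding n_eps nt by (simp_all add: pos_le_divide_eq pos_divide_less_eq mult.commute)
  have x0: "0 < ?x" by (rule less_le_trans[OF _ b(1)]) simp
  have "real (h - 1) \<le> log 2 ?x" "log 2 ?x < real h"
    using b x0 by (simp_all add: le_log_iff log_less_iff powr_realpow)
  then have "\<lfloor>log 2 ?x\<rfloor> = int (h - 1)" using h(1) by (intro floor_unique) (auto simp: of_nat_diff)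
  then show ?thesis unfolding kappa_def h_def[symmetric] using h(1) by simp
qed

lemma wid_sum_le:
  "(\<Sum>t\<in>{N+1..n}. wid eps (lev N t)) \<le> (12 / 7) * real N"
proof -
  have e: "2 powr (real L / 2) * sqrt eps = 1"
    by (simp add: eps_eq real_sqrt_divide powr_half_sqrt[symmetric] powr_powr powr_realpow[symmetric])
  have "(\<Sum>t\<in>{N+1..n}. wid eps (lev N t)) = (\<Sum>t\<in>{N+1..n}. 2 powr (- real (lev N t) / 2)) * sqrt eps"
    by (simp add: wid_def sum_distrib_right)
  also have "\<dots> \<le> (12 / 7) * real N * 2 powr (real L / 2) * sqrt eps"
    unfolding n_eq using eps_pos by (intro mult_right_mono sum_lev_le) auto
  also have "\<dots> = (12 / 7) * real N" using e by simp
  finally show ?thesis .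
qed

end

section \<open>Optimal solutions and strong duality\<close>

lemma sum_ereal_not_MInf:
  fixes g :: "'a \<Rightarrow> ereal"
  assumes "finite I" "\<And>t. t \<in> I \<Longrightarrow> g t \<noteq> \<infinity>" "sum g I \<noteq> -\<infinity>" "t \<in> I"
  shows "g t \<noteq> -\<infinity>"
proof
  assume "g t = -\<infinity>"
  moreover have "sum g (I - {t}) \<noteq> \<infinity>" using assms by (subst sum_Pinfty) auto
  moreover have "sum g I = g t + sum g (I - {t})" using assms by (simp add: sum.remove)
  ultimately show False using assms(3) by simp
qed

lemma hypo_iff: "(x, r) \<in> hypo f \<longleftrightarrow> ereal r \<le> f x"
  by (simp add: hypo_def)

lemma usc_eventually_less:
  assumes "usc_ext f" "f l < c"
  shows "eventually (\<lambda>x. f x < c) (nhds l)"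
proof -
  have "Limsup (at l) f < c" using assms unfolding usc_ext_def by (meson order_le_less_trans)
  then have "eventually (\<lambda>x. f x < c) (at l)" by (rule Limsup_lessD)
  then show ?thesis unfolding eventually_at_filter using assms(2) by (auto elim: eventually_mono)
qed

context
  fixes f :: "real^'k \<Rightarrow> ereal"
  assumes G: "class_G f"
begin

lemma class_G_simps:
  "f x \<noteq> \<infinity>" "f 0 = 0" "usc_ext f" "convex (hypo f)" "f x \<noteq> -\<infinity> \<Longrightarrow> 0 \<le> x $ j"
  "bounded {x. ereal c \<le> f x}"
  using G unfolding class_G_def effdom_def concave_ext_def by auto

text \<open>Upper semicontinuity keeps \<open>f\<close> below 1 on a ball around 0, and
  \<open>N\<close> is chosen so that the superlevel set \<open>0 \<le> f\<close>, shrunk by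
  \<open>1 / N\<close>, lies in that ball. By concavity and \<open>f 0 = 0\<close>, a value of
  \<open>N\<close> at \<open>x\<close> would force the value 1 at \<open>x / N\<close>.\<close>

lemma class_G_bounded_above: "\<exists>c::real. \<forall>x. f x \<le> ereal c"
proof -
  have "eventually (\<lambda>x. f x < 1) (nhds 0)"
    using class_G_simps by (intro usc_eventually_less) auto
  then obtain d where d: "0 < d" "\<And>x. dist x 0 < d \<Longrightarrow> f x < 1"
    unfolding eventually_nhds_metric by blast
  obtain R where R: "0 < R" "\<And>x. 0 \<le> f x \<Longrightarrow> norm x \<le> R"
    using class_G_simps(6)[of 0] unfolding bounded_pos by (auto simp: zero_ereal_def)
  define N where "N = max 1 (R / d + 1)"
  have N: "1 \<le> N" "R / N < d"
  proof -
    show "1 \<le> N" by (simp add: N_def)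
    have "R / d < N" by (simp add: N_def)
    then show "R / N < d" using d(1) \<open>1 \<le> N\<close> by (simp add: field_simps)
  qed
  have "f x \<le> ereal N" for x
  proof (rule ccontr)
    assume "\<not> f x \<le> ereal N"
    then have x: "ereal N \<le> f x" by simp
    then have "(x, N) \<in> hypo f" "(0, 0) \<in> hypo f"
      using class_G_simps by (auto simp: hypo_iff zero_ereal_def)
    then have "(1 / N) *\<^sub>R (x, N) + (1 - 1 / N) *\<^sub>R (0, 0) \<in> hypo f"
      using N class_G_simps(4) by (intro convexD) auto
    then have "1 \<le> f ((1 / N) *\<^sub>R x)" using N by (simp add: hypo_iff one_ereal_def)
    moreover have "0 \<le> f x" using x N by (meson ereal_less_eq(3) order_trans zero_ereal_def ereal_less_eq(5) zero_le_one)
    then have "norm ((1 / N) *\<^sub>R x) \<le> R / N" using R N by (simp add: field_simps)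
    then have "f ((1 / N) *\<^sub>R x) < 1" using N(2) by (intro d) auto
    ultimately show False by simp
  qed
  then show ?thesis by blast
qed

end

lemma finite_family_convergent_subsequence:
  fixes X :: "nat \<Rightarrow> 'i \<Rightarrow> 'a::euclidean_space"
  assumes "finite I" "\<And>t. t \<in> I \<Longrightarrow> bounded (range (\<lambda>j. X j t))"
  shows "\<exists>r l. strict_mono (r :: nat \<Rightarrow> nat) \<and> (\<forall>t\<in>I. (\<lambda>j. X (r j) t) \<longlonglongrightarrow> l t)"
  using assms
proof (induction I rule: finite_induct)
  case empty
  show ?case by (intro exI[of _ id]) (auto simp: strict_mono_def)
next
  case (insert v I)
  then obtain r l where r: "strict_mono (r :: nat \<Rightarrow> nat)" "\<And>t. t \<in> I \<Longrightarrow> (\<lambda>j. X (r j) t) \<longlonglongrightarrow> l t" by auto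
  have "bounded (range (\<lambda>j. X (r j) v))"
    using insert.prems[of v] by (rule bounded_subset[OF _]) auto
  then obtain lv r' where r': "strict_mono (r' :: nat \<Rightarrow> nat)" "((\<lambda>j. X (r j) v) \<circ> r') \<longlonglongrightarrow> lv"
    using bounded_imp_convergent_subsequence by blast
  have "(\<lambda>j. X ((r \<circ> r') j) t) \<longlonglongrightarrow> (l(v := lv)) t" if "t \<in> insert v I" for t
  proof (cases "t = v")
    case True then show ?thesis using r'(2) by (simp add: comp_def)
  next
    case False
    then have "(\<lambda>j. X (r j) t) \<longlonglongrightarrow> l t" using that r(2) by simp
    from LIMSEQ_subseq_LIMSEQ[OF this r'(1)] show ?thesis using False by (simp add: comp_def)
  qed
  then show ?case using strict_mono_o[OF r(1) r'(1)] by blast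
qed

locale packing =
  fixes n :: nat and b :: "real^'m" and f :: "nat \<Rightarrow> real^'k \<Rightarrow> ereal" and A :: "nat \<Rightarrow> real^'k^'m"
  assumes b_pos: "0 < b $ i"
    and G: "t \<in> {1..n} \<Longrightarrow> class_G (f t)"
    and A_nonneg: "t \<in> {1..n} \<Longrightarrow> 0 \<le> A t $ i $ j"
    and Pstar_pos: "0 < Pstar n f A b"
begin

definition p :: real where "p = real_of_ereal (Pstar n f A b)"

lemma f_0: "t \<in> {1..n} \<Longrightarrow> f t 0 = 0"
  using class_G_simps(2)[OF G] .

lemma f_not_inf: "t \<in> {1..n} \<Longrightarrow> f t x \<noteq> \<infinity>"
  using class_G_simps(1)[OF G] .

lemma Ax_nonneg: "t \<in> {1..n} \<Longrightarrow> f t x \<noteq> -\<infinity> \<Longrightarrow> 0 \<le> (A t *v x) $ i"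
  unfolding matrix_vector_mult_def using A_nonneg class_G_simps(5)[OF G]
  by (auto intro!: sum_nonneg mult_nonneg_nonneg)

lemma le_Pstar:
  assumes "\<And>i. (\<Sum>t\<in>{1..n}. A t *v x t) $ i \<le> b $ i"
  shows "(\<Sum>t\<in>{1..n}. f t (x t)) \<le> Pstar n f A b"
  unfolding Pstar_def using assms by (intro Sup_upper) auto

lemma Pstar_eq: "Pstar n f A b = ereal p" and p_pos: "0 < p"
proof -
  have "\<exists>c::real. \<forall>x. f t x \<le> ereal c" if "t \<in> {1..n}" for t using class_G_bounded_above[OF G[OF that]] .
  then obtain c :: "nat \<Rightarrow> real" where c: "\<And>t x. t \<in> {1..n} \<Longrightarrow> f t x \<le> ereal (c t)" by metis
  have "Pstar n f A b \<le> ereal (\<Sum>t\<in>{1..n}. c t)"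
    unfolding Pstar_def sum_ereal[symmetric]
  proof (rule Sup_least, clarify)
    show "(\<Sum>t\<in>{1..n}. f t (x t)) \<le> (\<Sum>t\<in>{1..n}. ereal (c t))" for x :: "nat \<Rightarrow> real^'k"
      using c by (intro sum_mono)
  qed
  then have "\<bar>Pstar n f A b\<bar> \<noteq> \<infinity>" using Pstar_pos by auto
  then show "Pstar n f A b = ereal p" unfolding p_def by (simp add: ereal_real)
  then show "0 < p" using Pstar_pos by simp
qed

text \<open>Points of negative value are replaced by 0, which raises the objective and, as resource
  use is nonnegative on the domain, keeps feasibility. Only where \<open>0 \<le> f t x\<close> do
  boundedness and the bound by \<open>gamma\<close> apply.\<close>

lemma nonneg_solution:
  assumes "\<And>i. (\<Sum>t\<in>{1..n}. A t *v x t) $ i \<le> b $ i" "(\<Sum>t\<in>{1..n}. f t (x t)) \<noteq> -\<infinity>"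
  obtains x' where "\<And>i. (\<Sum>t\<in>{1..n}. A t *v x' t) $ i \<le> b $ i" "\<And>t. t \<in> {1..n} \<Longrightarrow> 0 \<le> f t (x' t)"
    "(\<Sum>t\<in>{1..n}. f t (x t)) \<le> (\<Sum>t\<in>{1..n}. f t (x' t))"
proof (rule that)
  let ?x = "\<lambda>t. if 0 \<le> f t (x t) then x t else 0"
  have dom: "f t (x t) \<noteq> -\<infinity>" if "t \<in> {1..n}" for t
    using sum_ereal_not_MInf[of "{1..n}" "\<lambda>t. f t (x t)" t] assms(2) f_not_inf that by auto
  show "0 \<le> f t (?x t)" if "t \<in> {1..n}" for t using f_0 that by auto
  show "(\<Sum>t\<in>{1..n}. f t (x t)) \<le> (\<Sum>t\<in>{1..n}. f t (?x t))"
    using f_0 by (intro sum_mono) auto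
  show "(\<Sum>t\<in>{1..n}. A t *v ?x t) $ i \<le> b $ i" for i
  proof -
    have "(\<Sum>t\<in>{1..n}. A t *v ?x t) $ i \<le> (\<Sum>t\<in>{1..n}. A t *v x t) $ i"
      unfolding sum_component using Ax_nonneg dom by (intro sum_mono) auto
    then show ?thesis using assms(1)[of i] by simp
  qed
qed

text \<open>A maximising sequence with nonnegative values lies in bounded superlevel sets; a
  convergent subsequence and upper semicontinuity give a maximiser.\<close>

lemma optimal_solution:
  obtains x where "\<And>i. (\<Sum>t\<in>{1..n}. A t *v x t) $ i \<le> b $ i" "\<And>t. t \<in> {1..n} \<Longrightarrow> 0 \<le> f t (x t)"
    "(\<Sum>t\<in>{1..n}. real_of_ereal (f t (x t))) = p"
proof -
  have "\<exists>x. (\<forall>i. (\<Sum>t\<in>{1..n}. A t *v x t) $ i \<le> b $ i) \<and> (\<forall>t\<in>{1..n}. 0 \<le> f t (x t))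
      \<and> ereal (p - inverse (real (Suc j))) \<le> (\<Sum>t\<in>{1..n}. f t (x t))" for j
  proof -
    have "ereal (p - inverse (real (Suc j))) < Pstar n f A b" unfolding Pstar_eq by simp
    then obtain x where x: "\<forall>i. (\<Sum>t\<in>{1..n}. A t *v x t) $ i \<le> b $ i"
      "ereal (p - inverse (real (Suc j))) < (\<Sum>t\<in>{1..n}. f t (x t))"
      unfolding Pstar_def less_Sup_iff by blast
    have "(\<Sum>t\<in>{1..n}. f t (x t)) \<noteq> -\<infinity>" using x(2) by auto
    then obtain x' where "\<And>i. (\<Sum>t\<in>{1..n}. A t *v x' t) $ i \<le> b $ i" "\<And>t. t \<in> {1..n} \<Longrightarrow> 0 \<le> f t (x' t)"
      "(\<Sum>t\<in>{1..n}. f t (x t)) \<le> (\<Sum>t\<in>{1..n}. f t (x' t))"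
      using nonneg_solution[OF spec[OF x(1)]] by blast
    moreover have "ereal (p - inverse (real (Suc j))) \<le> (\<Sum>t\<in>{1..n}. f t (x' t))"
      using x(2) calculation(3) by (rule less_imp_le[OF less_le_trans])
    ultimately show ?thesis by (intro exI[of _ x'] conjI allI ballI)
  qed
  then have "\<exists>X. \<forall>j. (\<forall>i. (\<Sum>t\<in>{1..n}. A t *v X j t) $ i \<le> b $ i) \<and> (\<forall>t\<in>{1..n}. 0 \<le> f t (X j t))
      \<and> ereal (p - inverse (real (Suc j))) \<le> (\<Sum>t\<in>{1..n}. f t (X j t))"
    by (intro choice allI)
  then obtain X where X0: "\<forall>j. (\<forall>i. (\<Sum>t\<in>{1..n}. A t *v X j t) $ i \<le> b $ i) \<and> (\<forall>t\<in>{1..n}. 0 \<le> f t (X j t))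
      \<and> ereal (p - inverse (real (Suc j))) \<le> (\<Sum>t\<in>{1..n}. f t (X j t))" ..
  have X: "(\<Sum>t\<in>{1..n}. A t *v X j t) $ i \<le> b $ i" "t \<in> {1..n} \<Longrightarrow> 0 \<le> f t (X j t)"
    "ereal (p - inverse (real (Suc j))) \<le> (\<Sum>t\<in>{1..n}. f t (X j t))" for i j t
    using spec[OF X0, of j] by blast+
  have "bounded (range (\<lambda>j. X j t))" if "t \<in> {1..n}" for t
  proof (rule bounded_subset)
    show "bounded {x. ereal 0 \<le> f t x}" using class_G_simps(6)[OF G[OF that]] .
    show "range (\<lambda>j. X j t) \<subseteq> {x. ereal 0 \<le> f t x}"
      using X(2)[OF that] by (intro image_subsetI) (simp add: zero_ereal_def)
  qed
  then obtain r l where r: "strict_mono (r :: nat \<Rightarrow> nat)"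
    and l: "\<And>t. t \<in> {1..n} \<Longrightarrow> (\<lambda>j. X (r j) t) \<longlonglongrightarrow> l t"
    using finite_family_convergent_subsequence[of "{1..n}" X] by blast
  have ev: "eventually (\<lambda>j. f t (X (r j) t) < c) sequentially" if "t \<in> {1..n}" "f t (l t) < c" for t c
    using usc_eventually_less[OF class_G_simps(3)[OF G[OF that(1)]] that(2)] l[OF that(1)]
    unfolding filterlim_iff by blast
  have l0: "0 \<le> f t (l t)" if "t \<in> {1..n}" for t
  proof (rule ccontr)
    assume "\<not> 0 \<le> f t (l t)"
    then have "eventually (\<lambda>j. f t (X (r j) t) < 0) sequentially" by (intro ev that) auto
    then have "eventually (\<lambda>j. False) sequentially"
      by (rule eventually_mono) (use X(2)[OF that] in \<open>auto simp: not_le[symmetric]\<close>)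
    then show False by simp
  qed
  have feas: "(\<Sum>t\<in>{1..n}. A t *v l t) $ i \<le> b $ i" for i
  proof (rule LIMSEQ_le_const2)
    show "(\<lambda>j. (\<Sum>t\<in>{1..n}. A t *v X (r j) t) $ i) \<longlonglongrightarrow> (\<Sum>t\<in>{1..n}. A t *v l t) $ i"
      unfolding sum_component matrix_vector_mult_def vec_lambda_beta
      using l by (intro tendsto_sum tendsto_mult tendsto_const tendsto_vec_nth) auto
  qed (use X(1) in auto)
  let ?F = "\<lambda>t x. real_of_ereal (f t x)"
  have F: "f t x = ereal (?F t x)" if "t \<in> {1..n}" "0 \<le> f t x" for t x
    using that f_not_inf[OF that(1), of x] by (cases "f t x") auto
  have "p \<le> (\<Sum>t\<in>{1..n}. ?F t (l t)) + e" if e: "0 < e" for e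
  proof -
    \<comment> \<open>The error \<open>e\<close> is shared among \<open>n\<close> terms;
      \<open>n + 1\<close> keeps the divisor positive without a case distinction.\<close>
    have "eventually (\<lambda>j. \<forall>t\<in>{1..n}. f t (X (r j) t) < ereal (?F t (l t) + e / (real n + 1))) sequentially"
    proof (rule eventually_ball_finite, simp, rule ballI)
      fix t assume t: "t \<in> {1..n}"
      show "eventually (\<lambda>j. f t (X (r j) t) < ereal (?F t (l t) + e / (real n + 1))) sequentially"
        by (rule ev[OF t], subst F[OF t l0[OF t]]) (use e in simp)
    qed
    then have "eventually (\<lambda>j. p - inverse (real (Suc j)) \<le> (\<Sum>t\<in>{1..n}. ?F t (l t)) + e) sequentially"
    proof (rule eventually_mono)
      fix j assume j: "\<forall>t\<in>{1..n}. f t (X (r j) t) < ereal (?F t (l t) + e / (real n + 1))"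
      have "inverse (real (Suc (r j))) \<le> inverse (real (Suc j))"
        using seq_suble[OF r, of j] by (intro le_imp_inverse_le) auto
      then have "ereal (p - inverse (real (Suc j))) \<le> ereal (p - inverse (real (Suc (r j))))" by simp
      also have "\<dots> \<le> (\<Sum>t\<in>{1..n}. f t (X (r j) t))" by (rule X(3))
      also have "\<dots> \<le> (\<Sum>t\<in>{1..n}. ereal (?F t (l t) + e / (real n + 1)))"
        by (rule sum_mono) (use j in \<open>blast intro: less_imp_le\<close>)
      also have "\<dots> = ereal ((\<Sum>t\<in>{1..n}. ?F t (l t)) + real n * (e / (real n + 1)))"
        by (simp add: sum.distrib)
      finally have "p - inverse (real (Suc j)) \<le> (\<Sum>t\<in>{1..n}. ?F t (l t)) + real n * (e / (real n + 1))" by simp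
      also have "real n * (e / (real n + 1)) \<le> e" using e by (simp add: field_simps)
      finally show "p - inverse (real (Suc j)) \<le> (\<Sum>t\<in>{1..n}. ?F t (l t)) + e" by simp
    qed
    moreover have "(\<lambda>j. p - inverse (real (Suc j))) \<longlonglongrightarrow> p - 0"
      by (intro tendsto_diff tendsto_const LIMSEQ_inverse_real_of_nat)
    ultimately show ?thesis using tendsto_upperbound[of "\<lambda>j. p - inverse (real (Suc j))" "p - 0" sequentially] by auto
  qed
  then have "p \<le> (\<Sum>t\<in>{1..n}. ?F t (l t))" by (rule field_le_epsilon)
  moreover have "(\<Sum>t\<in>{1..n}. f t (l t)) = ereal (\<Sum>t\<in>{1..n}. ?F t (l t))"
    using F l0 by (simp flip: sum_ereal)
  then have "(\<Sum>t\<in>{1..n}. ?F t (l t)) \<le> p" using le_Pstar[OF feas] Pstar_eq by simp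
  ultimately show ?thesis using that[OF feas l0] by simp
qed

text \<open>\<open>S\<close> collects budgets \<open>u\<close> with the values attainable under
  them. Concavity makes it convex, and it misses the ray above \<open>(b, p)\<close>; a separating
  hyperplane with normal \<open>(w, c)\<close> yields the multiplier \<open>- w / c\<close>. Real
  lower bounds \<open>\<rho> t\<close> stand for the values \<open>f t (x t)\<close>, so that minus
  infinity never enters the arithmetic.\<close>

lemma dual_multiplier:
  obtains y :: "real^'m" where "\<And>i. 0 \<le> y $ i"
    "\<And>x \<rho>. (\<And>t. t \<in> {1..n} \<Longrightarrow> ereal (\<rho> t) \<le> f t (x t)) \<Longrightarrow>
       (\<Sum>t\<in>{1..n}. \<rho> t - y \<bullet> (A t *v x t)) \<le> p - y \<bullet> b"
proof -
  define S where "S = {(u, r). \<exists>x \<rho>. (\<forall>t\<in>{1..n}. (x t, \<rho> t) \<in> hypo (f t)) \<and>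
      (\<forall>i. (\<Sum>t\<in>{1..n}. A t *v x t) $ i \<le> u $ i) \<and> r \<le> (\<Sum>t\<in>{1..n}. \<rho> t)}"
  have S: "(u, r) \<in> S" if "\<And>t. t \<in> {1..n} \<Longrightarrow> ereal (\<rho> t) \<le> f t (x t)"
    "\<And>i. (\<Sum>t\<in>{1..n}. A t *v x t) $ i \<le> u $ i" "r \<le> (\<Sum>t\<in>{1..n}. \<rho> t)" for u r x \<rho>
    unfolding S_def hypo_iff mem_Collect_eq case_prod_conv using that by (intro exI conjI ballI allI)
  have S0: "(u, 0) \<in> S" if "\<And>i. 0 \<le> u $ i" for u
    by (rule S[where x = "\<lambda>_. 0" and \<rho> = "\<lambda>_. 0"]) (use that f_0 in \<open>auto simp: zero_ereal_def\<close>)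
  have "convex S"
  proof (rule convexI)
    fix z z' and s s' :: real assume z: "z \<in> S" "z' \<in> S" and s: "0 \<le> s" "0 \<le> s'" "s + s' = 1"
    obtain u r u' r' where zz: "z = (u, r)" "z' = (u', r')" by (cases z, cases z') auto
    obtain x \<rho> where x: "\<And>t. t \<in> {1..n} \<Longrightarrow> (x t, \<rho> t) \<in> hypo (f t)"
      "\<And>i. (\<Sum>t\<in>{1..n}. A t *v x t) $ i \<le> u $ i" "r \<le> (\<Sum>t\<in>{1..n}. \<rho> t)"
      using z(1) unfolding zz S_def mem_Collect_eq case_prod_conv by blast
    obtain x' \<rho>' where x': "\<And>t. t \<in> {1..n} \<Longrightarrow> (x' t, \<rho>' t) \<in> hypo (f t)"
      "\<And>i. (\<Sum>t\<in>{1..n}. A t *v x' t) $ i \<le> u' $ i" "r' \<le> (\<Sum>t\<in>{1..n}. \<rho>' t)"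
      using z(2) unfolding zz S_def mem_Collect_eq case_prod_conv by blast
    have "(s *\<^sub>R u + s' *\<^sub>R u', s * r + s' * r') \<in> S"
    proof (rule S[where x = "\<lambda>t. s *\<^sub>R x t + s' *\<^sub>R x' t" and \<rho> = "\<lambda>t. s * \<rho> t + s' * \<rho>' t"])
      show "ereal (s * \<rho> t + s' * \<rho>' t) \<le> f t (s *\<^sub>R x t + s' *\<^sub>R x' t)" if "t \<in> {1..n}" for t
        using convexD[OF class_G_simps(4)[OF G[OF that]] x(1)[OF that] x'(1)[OF that] s]
        by (simp add: hypo_iff)
      have lin: "A t *v (s *\<^sub>R x t + s' *\<^sub>R x' t) = s *\<^sub>R (A t *v x t) + s' *\<^sub>R (A t *v x' t)" for t
        by (simp add: matrix_vector_right_distrib matrix_vector_mult_scaleR)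
      show "(\<Sum>t\<in>{1..n}. A t *v (s *\<^sub>R x t + s' *\<^sub>R x' t)) $ i \<le> (s *\<^sub>R u + s' *\<^sub>R u') $ i" for i
        using mult_left_mono[OF x(2)[of i] s(1)] mult_left_mono[OF x'(2)[of i] s(2)]
        unfolding lin by (simp add: sum.distrib sum_distrib_left)
      show "s * r + s' * r' \<le> (\<Sum>t\<in>{1..n}. s * \<rho> t + s' * \<rho>' t)"
        using mult_left_mono[OF x(3) s(1)] mult_left_mono[OF x'(3) s(2)]
        by (simp add: sum.distrib sum_distrib_left)
    qed
    then show "s *\<^sub>R z + s' *\<^sub>R z' \<in> S" by (simp add: zz)
  qed
  moreover have "convex ({b} \<times> {p<..})" by (intro convex_Times) auto
  moreover have "S \<noteq> {}" using S0[of 0] by auto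
  moreover have "{b} \<times> {p<..} \<noteq> {}" using gt_ex[of p] by auto
  moreover have "S \<inter> ({b} \<times> {p<..}) = {}"
  proof (rule ccontr)
    assume "S \<inter> ({b} \<times> {p<..}) \<noteq> {}"
    then obtain r x \<rho> where r: "p < r" "\<forall>t\<in>{1..n}. ereal (\<rho> t) \<le> f t (x t)"
      "\<forall>i. (\<Sum>t\<in>{1..n}. A t *v x t) $ i \<le> b $ i" "r \<le> (\<Sum>t\<in>{1..n}. \<rho> t)"
      unfolding S_def by (auto simp: hypo_iff)
    have "ereal (\<Sum>t\<in>{1..n}. \<rho> t) \<le> (\<Sum>t\<in>{1..n}. f t (x t))"
      unfolding sum_ereal[symmetric] using r(2) by (intro sum_mono) auto
    also have "\<dots> \<le> ereal p" using le_Pstar[of x] r(3) Pstar_eq by simp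
    finally show False using r by simp
  qed
  ultimately obtain a k where a: "a \<noteq> 0" "\<And>z. z \<in> S \<Longrightarrow> a \<bullet> z \<le> k" "\<And>z. z \<in> {b} \<times> {p<..} \<Longrightarrow> k \<le> a \<bullet> z"
    using separating_hyperplane_sets[of S "{b} \<times> {p<..}"] by blast
  obtain w c where wc: "a = (w, c)" by (cases a)
  have aS: "w \<bullet> u + c * r \<le> k" if "(u, r) \<in> S" for u r using a(2)[OF that] by (simp add: wc)
  have aT: "k \<le> w \<bullet> b + c * r" if "p < r" for r using a(3)[of "(b, r)"] that by (simp add: wc)
  have c0: "0 \<le> c"
  proof -
    have "w \<bullet> b \<le> k" using aS[OF S0, of b] b_pos by (simp add: less_imp_le)
    then have "0 \<le> c * (p + 1)" using aT[of "p + 1"] by simp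
    then show ?thesis using p_pos by (simp add: zero_le_mult_iff)
  qed
  have w0: "w $ i \<le> 0" for i
  proof (rule ccontr)
    assume "\<not> w $ i \<le> 0"
    \<comment> \<open>\<open>s * w $ i\<close> is \<open>\<bar>k\<bar> + 1\<close>, beyond the bound
      \<open>k\<close>, although budgets may grow freely within \<open>S\<close>.\<close>
    define s where "s = (\<bar>k\<bar> + 1) / w $ i"
    have "0 \<le> s" using \<open>\<not> w $ i \<le> 0\<close> by (simp add: s_def)
    then have "w \<bullet> (s *\<^sub>R axis i 1) \<le> k" using aS[OF S0, of "s *\<^sub>R axis i 1"] by (simp add: axis_def)
    then have "s * w $ i \<le> k" by (simp add: inner_axis)
    then show False using \<open>\<not> w $ i \<le> 0\<close> by (simp add: s_def)
  qed
  \<comment> \<open>Slater's condition: a vertical hyperplane would give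
    \<open>0 \<le> w \<bullet> b\<close> with \<open>w \<le> 0\<close> and \<open>b > 0\<close>,
    hence \<open>w = 0\<close>.\<close>
  have "c \<noteq> 0"
  proof
    assume c: "c = 0"
    have "0 \<le> k" using aS[OF S0, of 0] by simp
    then have "0 \<le> w \<bullet> b" using aT[of "p + 1"] c by simp
    moreover have "w $ i * b $ i \<le> 0" for i using w0[of i] b_pos[of i] by (simp add: mult_le_0_iff)
    ultimately have "(\<Sum>i\<in>UNIV. - (w $ i * b $ i)) = 0"
      by (intro antisym sum_nonneg) (auto simp: inner_vec_def sum_negf)
    then have "\<forall>i. - (w $ i * b $ i) = 0"
      using \<open>\<And>i. w $ i * b $ i \<le> 0\<close> by (subst (asm) sum_nonneg_eq_0_iff) auto
    then have "w = 0" using b_pos by (simp add: vec_eq_iff less_imp_neq[symmetric] order_less_imp_not_eq2)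
    then show False using a(1) c wc by (simp add: zero_prod_def)
  qed
  then have c: "0 < c" using c0 by simp
  have k: "k \<le> w \<bullet> b + c * p"
  proof (rule field_le_epsilon)
    fix e :: real assume "0 < e"
    moreover have "c * (p + e / c) = c * p + e" using c by (simp add: distrib_left)
    ultimately show "k \<le> w \<bullet> b + c * p + e" using aT[of "p + e / c"] c by simp
  qed
  show ?thesis
  proof (rule that[of "- (1 / c) *\<^sub>R w"])
    show "0 \<le> (- (1 / c) *\<^sub>R w) $ i" for i using w0[of i] c by (simp add: divide_nonpos_pos)
    fix x \<rho> assume x: "\<And>t. t \<in> {1..n} \<Longrightarrow> ereal (\<rho> t) \<le> f t (x t)"
    have "w \<bullet> (\<Sum>t\<in>{1..n}. A t *v x t) + c * (\<Sum>t\<in>{1..n}. \<rho> t) \<le> w \<bullet> b + c * p"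
      using aS[OF S[OF x]] k by (meson order_refl order_trans)
    then have "(1 / c) * (w \<bullet> (\<Sum>t\<in>{1..n}. A t *v x t) + c * (\<Sum>t\<in>{1..n}. \<rho> t)) \<le> (1 / c) * (w \<bullet> b + c * p)"
      using c by (intro mult_left_mono) auto
    then show "(\<Sum>t\<in>{1..n}. \<rho> t - (- (1 / c) *\<^sub>R w) \<bullet> (A t *v x t)) \<le> p - (- (1 / c) *\<^sub>R w) \<bullet> b"
      using c by (simp add: sum.distrib inner_sum_right sum_distrib_left distrib_left add.commute)
  qed
qed

text \<open>The Lagrangian separates over \<open>t\<close>, so the sum of suprema is the supremum of
  the sum. \<open>h t \<ge> 0\<close> comes from \<open>x = 0\<close> and
  \<open>h t \<le> g * p\<close> from nonnegative resource use; this range makes \<open>h\<close>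
  eligible for the tail bounds.\<close>

lemma strong_duality:
  assumes g: "\<And>t x. t \<in> {1..n} \<Longrightarrow> f t x \<le> ereal (g * p)" and g0: "0 \<le> g"
  obtains y :: "real^'m" and h where "\<And>i. 0 \<le> y $ i"
    "\<And>t x. t \<in> {1..n} \<Longrightarrow> f t x \<le> ereal (h t + y \<bullet> (A t *v x))"
    "\<And>t. t \<in> {1..n} \<Longrightarrow> 0 \<le> h t \<and> h t \<le> g * p" "(\<Sum>t\<in>{1..n}. h t) + y \<bullet> b \<le> p"
proof -
  obtain y :: "real^'m" where y: "\<And>i. 0 \<le> y $ i"
    "\<And>x \<rho>. (\<And>t. t \<in> {1..n} \<Longrightarrow> ereal (\<rho> t) \<le> f t (x t)) \<Longrightarrow>
       (\<Sum>t\<in>{1..n}. \<rho> t - y \<bullet> (A t *v x t)) \<le> p - y \<bullet> b"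
    using dual_multiplier by blast
  define V where "V t = {\<rho> - y \<bullet> (A t *v x) | x \<rho>. ereal \<rho> \<le> f t x}" for t
  have V0: "0 \<in> V t" if "t \<in> {1..n}" for t
    unfolding V_def using f_0[OF that] by (auto intro!: exI[of _ 0] simp: zero_ereal_def)
  have Vle: "v \<le> g * p" if t: "t \<in> {1..n}" and "v \<in> V t" for t v
  proof -
    obtain x \<rho> where v: "v = \<rho> - y \<bullet> (A t *v x)" "ereal \<rho> \<le> f t x" using \<open>v \<in> V t\<close> unfolding V_def by blast
    then have "f t x \<noteq> -\<infinity>" by auto
    then have "0 \<le> y \<bullet> (A t *v x)"
      using y(1) Ax_nonneg[OF t] unfolding inner_vec_def by (auto intro!: sum_nonneg)
    moreover have "ereal \<rho> \<le> ereal (g * p)" using v(2) g[OF t] order_trans by blast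
    ultimately show ?thesis using v(1) by simp
  qed
  have bdd: "bdd_above (V t)" if "t \<in> {1..n}" for t using Vle[OF that] by (rule bdd_aboveI)
  show ?thesis
  proof (rule that[of y "\<lambda>t. Sup (V t)"])
    show "f t x \<le> ereal (Sup (V t) + y \<bullet> (A t *v x))" if t: "t \<in> {1..n}" for t x
    proof (cases "f t x")
      case (real r)
      then have "r - y \<bullet> (A t *v x) \<in> V t" unfolding V_def by force
      then have "r - y \<bullet> (A t *v x) \<le> Sup (V t)" using bdd[OF t] by (rule cSup_upper)
      then show ?thesis by (simp add: real)
    qed (use f_not_inf[OF t] in auto)
    show "0 \<le> Sup (V t) \<and> Sup (V t) \<le> g * p" if t: "t \<in> {1..n}" for t
      using cSup_upper[OF V0[OF t] bdd[OF t]] cSup_least[of "V t" "g * p"] V0[OF t] Vle[OF t] by auto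
    have "(\<Sum>t\<in>{1..n}. Sup (V t)) \<le> p - y \<bullet> b + e" if e: "0 < e" for e
    proof -
      have "\<exists>x \<rho>. ereal \<rho> \<le> f t x \<and> Sup (V t) - e / (real n + 1) < \<rho> - y \<bullet> (A t *v x)" if t: "t \<in> {1..n}" for t
      proof -
        have "Sup (V t) - e / (real n + 1) < Sup (V t)" using e by simp
        then obtain v where "v \<in> V t" "Sup (V t) - e / (real n + 1) < v"
          using less_cSup_iff[OF _ bdd[OF t]] V0[OF t] by blast
        then show ?thesis unfolding V_def by blast
      qed
      then obtain x \<rho> where x: "\<And>t. t \<in> {1..n} \<Longrightarrow> ereal (\<rho> t) \<le> f t (x t)"
        "\<And>t. t \<in> {1..n} \<Longrightarrow> Sup (V t) - e / (real n + 1) < \<rho> t - y \<bullet> (A t *v x t)" by metis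
      have "(\<Sum>t\<in>{1..n}. Sup (V t) - e / (real n + 1)) \<le> (\<Sum>t\<in>{1..n}. \<rho> t - y \<bullet> (A t *v x t))"
        using x(2) by (intro sum_mono less_imp_le)
      also have "\<dots> \<le> p - y \<bullet> b" by (rule y(2)[OF x(1)])
      finally have "(\<Sum>t\<in>{1..n}. Sup (V t)) \<le> p - y \<bullet> b + real n * (e / (real n + 1))" by (simp add: sum_subtractf)
      also have "real n * (e / (real n + 1)) \<le> e" using e by (simp add: field_simps)
      finally show ?thesis by simp
    qed
    then have "(\<Sum>t\<in>{1..n}. Sup (V t)) \<le> p - y \<bullet> b" by (rule field_le_epsilon)
    then show "(\<Sum>t\<in>{1..n}. Sup (V t)) + y \<bullet> b \<le> p" by simp
  qed (rule y(1))
qed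

end

lemma pexp_or_le:
  assumes "\<And>\<sigma>. \<sigma> \<in> perms n \<Longrightarrow> Q \<sigma> \<Longrightarrow> R \<sigma> \<or> R' \<sigma>"
  shows "pexp n (\<lambda>\<sigma>. of_bool (Q \<sigma>)) \<le> pexp n (\<lambda>\<sigma>. of_bool (R \<sigma>)) + pexp n (\<lambda>\<sigma>. of_bool (R' \<sigma>))"
  unfolding pexp_add[symmetric]
proof (rule pexp_mono)
  show "of_bool (Q \<sigma>) \<le> of_bool (R \<sigma>) + (of_bool (R' \<sigma>) :: real)" if "\<sigma> \<in> perms n" for \<sigma>
    using assms[OF that] by auto
qed

lemma pexp_const_union_bound:
  assumes "finite I" "\<And>\<sigma>. \<sigma> \<in> perms n \<Longrightarrow> Q \<sigma> \<Longrightarrow> \<exists>i\<in>I. R i \<sigma>"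
    and "\<And>i. i \<in> I \<Longrightarrow> pexp n (\<lambda>\<sigma>. of_bool (R i \<sigma>)) \<le> B"
  shows "pexp n (\<lambda>\<sigma>. of_bool (Q \<sigma>)) \<le> real (card I) * B"
proof -
  have "pexp n (\<lambda>\<sigma>. of_bool (Q \<sigma>)) \<le> (\<Sum>i\<in>I. pexp n (\<lambda>\<sigma>. of_bool (R i \<sigma>)))"
    using assms(1,2) by (rule pexp_union_bound)
  also have "\<dots> \<le> real (card I) * B" using assms(3) by (rule sum_bounded_above)
  finally show ?thesis .
qed

section \<open>Accuracy of the estimates\<close>

text \<open>\<open>xs\<close> is an offline optimum and \<open>(y, h)\<close> an optimal dual pair, with \<open>h t\<close> the supremum
  of \<open>f t x - y \<bullet> (A t *v x)\<close>; the former bounds the estimates from below, the latter from above.\<close>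

locale esa = scale N L n eps + packing n b f A
  for N L n :: nat and eps :: real and b :: "real^'m" and f :: "nat \<Rightarrow> real^'k \<Rightarrow> ereal" and A :: "nat \<Rightarrow> real^'k^'m" +
  fixes gamma :: real and xs :: "nat \<Rightarrow> real^'k" and y :: "real^'m" and h :: "nat \<Rightarrow> real"
  assumes gamma_pos: "0 < gamma"
    and Ax_le: "t \<in> {1..n} \<Longrightarrow> 0 \<le> f t x \<Longrightarrow> (A t *v x) $ i / b $ i \<le> gamma"
    and f_le: "t \<in> {1..n} \<Longrightarrow> f t x \<le> ereal (gamma * p)"
    and gamma_le: "gamma \<le> eps\<^sup>2 / (13 * ln (real CARD('m) / eps))"
    and xs_feasible: "(\<Sum>t\<in>{1..n}. A t *v xs t) $ i \<le> b $ i"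
    and xs_nonneg: "t \<in> {1..n} \<Longrightarrow> 0 \<le> f t (xs t)"
    and xs_optimal: "(\<Sum>t\<in>{1..n}. real_of_ereal (f t (xs t))) = p"
    and y_nonneg: "0 \<le> y $ i"
    and h_bound: "t \<in> {1..n} \<Longrightarrow> f t x \<le> ereal (h t + y \<bullet> (A t *v x))"
    and h_range: "t \<in> {1..n} \<Longrightarrow> 0 \<le> h t \<and> h t \<le> gamma * p"
    and h_sum: "(\<Sum>t\<in>{1..n}. h t) + y \<bullet> b \<le> p"
begin

text \<open>\<open>astar\<close>, \<open>phi\<close> and \<open>hp\<close> express resource use,
  value and dual value as fractions of \<open>b $ i\<close> and \<open>p\<close>. Each lies in
  \<open>[0, gamma]\<close> with total at most 1, exactly 1 for \<open>phi\<close>, as the tail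
  bounds require.\<close>

definition astar :: "'m \<Rightarrow> nat \<Rightarrow> real" where "astar i j = (A j *v xs j) $ i / b $ i"

definition phi :: "nat \<Rightarrow> real" where "phi j = real_of_ereal (f j (xs j)) / p"

definition hp :: "nat \<Rightarrow> real" where "hp j = h j / p"

definition B :: real where "B = exp (- (eps\<^sup>2 / (5 * gamma)))"

lemma f_eq: "t \<in> {1..n} \<Longrightarrow> 0 \<le> f t x \<Longrightarrow> f t x = ereal (real_of_ereal (f t x))"
  using f_not_inf[of t x] by (cases "f t x") auto

lemma f_real_range:
  assumes "t \<in> {1..n}" "0 \<le> f t x"
  shows "0 \<le> real_of_ereal (f t x)" "real_of_ereal (f t x) \<le> gamma * p"
  using f_eq[OF assms] assms(2) f_le[OF assms(1), of x] by (metis ereal_less_eq(3,5))+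

lemma a_range:
  assumes "t \<in> {1..n}" "0 \<le> f t x"
  shows "0 \<le> (A t *v x) $ i / b $ i" "(A t *v x) $ i / b $ i \<le> gamma"
  using Ax_nonneg[OF assms(1), of x i] Ax_le[OF assms] assms(2) b_pos[of i] by auto

lemma astar_range: "j \<in> {1..n} \<Longrightarrow> 0 \<le> astar i j \<and> astar i j \<le> gamma"
  unfolding astar_def using a_range xs_nonneg by blast

lemma astar_sum: "(\<Sum>j\<in>{1..n}. astar i j) \<le> 1"
  unfolding astar_def sum_divide_distrib[symmetric] sum_component[symmetric]
  using xs_feasible[of i] b_pos[of i] by simp

lemma phi_range: "j \<in> {1..n} \<Longrightarrow> 0 \<le> phi j \<and> phi j \<le> gamma"
  unfolding phi_def using f_real_range[of j "xs j"] xs_nonneg[of j] p_pos by (simp add: divide_le_eq)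

lemma phi_sum: "(\<Sum>j\<in>{1..n}. phi j) = 1"
  unfolding phi_def sum_divide_distrib[symmetric] xs_optimal using p_pos by simp

lemma hp_range: "j \<in> {1..n} \<Longrightarrow> 0 \<le> hp j \<and> hp j \<le> gamma"
  unfolding hp_def using h_range[of j] p_pos by (simp add: divide_le_eq)

lemma hp_sum: "(\<Sum>j\<in>{1..n}. hp j) \<le> 1"
proof -
  have "0 \<le> y \<bullet> b" unfolding inner_vec_def using y_nonneg less_imp_le[OF b_pos] by (auto intro!: sum_nonneg mult_nonneg_nonneg)
  then show ?thesis
    unfolding hp_def sum_divide_distrib[symmetric] using h_sum p_pos by (simp add: divide_le_eq)
qed

abbreviation "PE \<sigma> k \<equiv> Pest n eps f A b \<sigma> k"

lemma block_bounds:
  assumes "k < L" shows "{1..2 ^ k * N} \<subseteq> {1..n}" "2 ^ k * eps = real (card {1..2 ^ k * N}) / real n"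
proof -
  have "(2::nat) ^ k \<le> 2 ^ L" using assms by (intro power_increasing) auto
  then show "{1..2 ^ k * N} \<subseteq> {1..n}" unfolding n_eq by (auto simp: mult.commute intro: order_trans)
  show "2 ^ k * eps = real (card {1..2 ^ k * N}) / real n"
    using n_pos n_eps by (simp add: field_simps)
qed

lemma block_perm: "\<sigma> \<in> perms n \<Longrightarrow> k < L \<Longrightarrow> t \<in> {1..2 ^ k * N} \<Longrightarrow> \<sigma> t \<in> {1..n}"
  using block_bounds perms_in by blast

lemma theta_range: "0 < theta eps k" "theta eps k \<le> 1 / 5"
  unfolding theta_eq using wid_pos wid_le by auto

lemma Pest_nonneg:
  assumes "\<sigma> \<in> perms n" "k < L" shows "0 \<le> PE \<sigma> k"
  unfolding Pest_def
proof (rule Sup_upper, rule CollectI, intro exI[of _ "\<lambda>_. 0"] conjI allI)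
  show "0 = ereal (1 / (2 ^ k * eps * (1 - theta eps k))) * (\<Sum>t\<in>{1..2 ^ k * neps n eps}. f (\<sigma> t) 0)"
    unfolding neps_eq using f_0 block_perm[OF assms] by simp
  show "1 / (2 ^ k * eps * (1 + theta eps k)) * (\<Sum>t\<in>{1..2 ^ k * neps n eps}. A (\<sigma> t) *v 0) $ i \<le> b $ i" for i
    using b_pos[of i] by (simp add: less_imp_le)
qed

lemma Pest_finite:
  assumes "\<sigma> \<in> perms n" "k < L" shows "PE \<sigma> k \<noteq> \<infinity>"
proof -
  let ?c = "1 / (2 ^ k * eps * (1 - theta eps k))"
  have "PE \<sigma> k \<le> ereal ?c * ereal (\<Sum>t\<in>{1..2 ^ k * N}. gamma * p)"
    unfolding Pest_def neps_eq sum_ereal[symmetric]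
  proof (rule Sup_least, clarify)
    fix x :: "nat \<Rightarrow> real^'k"
    have "(\<Sum>t\<in>{1..2 ^ k * N}. f (\<sigma> t) (x t)) \<le> (\<Sum>t\<in>{1..2 ^ k * N}. ereal (gamma * p))"
      by (intro sum_mono f_le block_perm[OF assms])
    then show "ereal ?c * (\<Sum>t\<in>{1..2 ^ k * N}. f (\<sigma> t) (x t)) \<le> ereal ?c * (\<Sum>t\<in>{1..2 ^ k * N}. ereal (gamma * p))"
      using eps_pos theta_range[of k] by (intro ereal_mult_left_mono) auto
  qed
  then show ?thesis by auto
qed

text \<open>No accuracy enters: \<open>Pest\<close> is nonnegative, by the zero choice, and finite,
  and the default \<open>eps\<close> covers the value zero. The step objective is thus well behaved
  on every permutation.\<close>

lemma qq_pos:
  assumes "\<sigma> \<in> perms n" "t \<in> {N+1..n}" shows "0 < qq n eps f A b \<sigma> t"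
proof -
  have "eta n eps t - 1 < L" using eta_eq[OF assms(2)] lev_bounds[of N t L] assms(2) n_eq by simp
  from Pest_nonneg[OF assms(1) this] Pest_finite[OF assms(1) this]
  show ?thesis unfolding qq_def Let_def using eps_pos
    by (cases "PE \<sigma> (eta n eps t - 1)") auto
qed

text \<open>The offline optimum restricted to the sample is a competitor: the factor
  \<open>1 + theta\<close> in the budget makes it feasible, and the divisor \<open>1 - theta\<close>
  lifts its value to at least \<open>p\<close>.\<close>

lemma Pest_ge_p:
  assumes s: "\<sigma> \<in> perms n" "k < L"
    and phi: "2 ^ k * eps * (1 - theta eps k) \<le> (\<Sum>t\<in>{1..2 ^ k * N}. phi (\<sigma> t))"
    and a: "\<And>i. (\<Sum>t\<in>{1..2 ^ k * N}. astar i (\<sigma> t)) \<le> 2 ^ k * eps * (1 + theta eps k)"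
  shows "ereal p \<le> PE \<sigma> k"
proof -
  let ?c = "2 ^ k * eps * (1 - theta eps k)" and ?d = "2 ^ k * eps * (1 + theta eps k)"
  have cd: "0 < ?c" "0 < ?d" using eps_pos theta_range[of k] by auto
  have "(\<Sum>t\<in>{1..2 ^ k * N}. f (\<sigma> t) (xs (\<sigma> t))) = ereal (\<Sum>t\<in>{1..2 ^ k * N}. p * phi (\<sigma> t))"
    unfolding sum_ereal[symmetric]
  proof (rule sum.cong)
    fix t assume "t \<in> {1..2 ^ k * N}"
    then have "\<sigma> t \<in> {1..n}" by (rule block_perm[OF s])
    then show "f (\<sigma> t) (xs (\<sigma> t)) = ereal (p * phi (\<sigma> t))"
      using f_eq xs_nonneg p_pos unfolding phi_def by simp
  qed simp
  then have e: "ereal (1 / ?c) * (\<Sum>t\<in>{1..2 ^ k * N}. f (\<sigma> t) (xs (\<sigma> t)))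
      = ereal (p * (\<Sum>t\<in>{1..2 ^ k * N}. phi (\<sigma> t)) / ?c)"
    unfolding sum_distrib_left[symmetric] by simp
  have "p * ?c \<le> p * (\<Sum>t\<in>{1..2 ^ k * N}. phi (\<sigma> t))"
    using phi p_pos by (intro mult_left_mono) auto
  then have "ereal p \<le> ereal (1 / ?c) * (\<Sum>t\<in>{1..2 ^ k * N}. f (\<sigma> t) (xs (\<sigma> t)))"
    unfolding e using cd(1) by (simp only: ereal_less_eq(3) pos_le_divide_eq)
  also have "\<dots> \<le> PE \<sigma> k"
    unfolding Pest_def neps_eq
  proof (rule Sup_upper, rule CollectI, intro exI[of _ "\<lambda>t. xs (\<sigma> t)"] conjI allI refl)
    fix i
    have "(\<Sum>t\<in>{1..2 ^ k * N}. A (\<sigma> t) *v xs (\<sigma> t)) $ i = b $ i * (\<Sum>t\<in>{1..2 ^ k * N}. astar i (\<sigma> t))"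
      unfolding astar_def sum_component sum_distrib_left using b_pos[of i] by (intro sum.cong) auto
    also have "\<dots> \<le> b $ i * ?d" using a b_pos[of i] by (intro mult_left_mono) auto
    finally show "1 / ?d * (\<Sum>t\<in>{1..2 ^ k * N}. A (\<sigma> t) *v xs (\<sigma> t)) $ i \<le> b $ i"
      using cd(2) by (simp add: pos_divide_le_eq)
  qed
  finally show ?thesis .
qed

text \<open>Weak duality: for every competitor \<open>x\<close> the term with \<open>y\<close> is
  bounded through the budget, whatever the sample. The supremum is therefore controlled by the
  single random sum of the \<open>hp (\<sigma> t)\<close>.\<close>

lemma Pest_le:
  assumes s: "\<sigma> \<in> perms n" "k < L"
    and hp: "(\<Sum>t\<in>{1..2 ^ k * N}. hp (\<sigma> t)) \<le> 2 ^ k * eps * ((\<Sum>j\<in>{1..n}. hp j) + theta eps k)"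
  shows "PE \<sigma> k \<le> ereal (p * (1 + 2 * theta eps k) / (1 - theta eps k))"
  unfolding Pest_def neps_eq
proof (rule Sup_least, clarify)
  let ?s = "2 ^ k * eps" and ?th = "theta eps k" and ?I = "{1..2 ^ k * N}"
  fix x :: "nat \<Rightarrow> real^'k"
  assume x: "\<forall>i. 1 / (?s * (1 + ?th)) * (\<Sum>t\<in>?I. A (\<sigma> t) *v x t) $ i \<le> b $ i"
  have s0: "0 < ?s" using eps_pos by simp
  have th: "0 < ?th" "?th \<le> 1 / 5" by (rule theta_range)+
  have "y \<bullet> (\<Sum>t\<in>?I. A (\<sigma> t) *v x t) \<le> (\<Sum>i\<in>UNIV. y $ i * (?s * (1 + ?th) * b $ i))"
    unfolding inner_vec_def inner_real_def
  proof (intro sum_mono mult_left_mono y_nonneg)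
    fix i
    have "0 < ?s * (1 + ?th)" using s0 th by simp
    then show "(\<Sum>t\<in>?I. A (\<sigma> t) *v x t) $ i \<le> ?s * (1 + ?th) * b $ i"
      using x[rule_format, of i] by (simp add: pos_divide_le_eq mult.commute)
  qed
  also have "\<dots> = ?s * (1 + ?th) * (y \<bullet> b)"
    unfolding inner_vec_def sum_distrib_left by (intro sum.cong) auto
  finally have yb: "y \<bullet> (\<Sum>t\<in>?I. A (\<sigma> t) *v x t) \<le> ?s * (1 + ?th) * (y \<bullet> b)" .
  let ?H = "\<Sum>j\<in>{1..n}. h j"
  have H: "(\<Sum>j\<in>{1..n}. hp j) = ?H / p" by (simp add: hp_def sum_divide_distrib)
  have "(\<Sum>t\<in>?I. h (\<sigma> t)) = p * (\<Sum>t\<in>?I. hp (\<sigma> t))"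
    using p_pos by (simp add: hp_def sum_distrib_left)
  also have "\<dots> \<le> p * (?s * (?H / p + ?th))" using hp p_pos unfolding H by (intro mult_left_mono) auto
  also have "\<dots> = ?s * (?H + p * ?th)" using p_pos by (simp add: field_simps)
  finally have hs: "(\<Sum>t\<in>?I. h (\<sigma> t)) \<le> ?s * (?H + p * ?th)" .
  \<comment> \<open>\<open>h_sum\<close> bounds \<open>?H + y \<bullet> b\<close> by
    \<open>p\<close> and, as \<open>?H \<ge> 0\<close>, also \<open>y \<bullet> b\<close> alone. The
    error of the sample and the enlarged budget thus cost \<open>theta * p\<close> each.\<close>
  have "0 \<le> ?H" using h_range by (intro sum_nonneg) auto
  then have "?th * (y \<bullet> b) \<le> ?th * p" using h_sum th by (intro mult_left_mono) auto
  then have "?s * (?H + p * ?th + (1 + ?th) * (y \<bullet> b)) \<le> ?s * (p * (1 + 2 * ?th))"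
    using h_sum s0 by (intro mult_left_mono) (auto simp: algebra_simps)
  then have tot: "(\<Sum>t\<in>?I. h (\<sigma> t)) + y \<bullet> (\<Sum>t\<in>?I. A (\<sigma> t) *v x t) \<le> ?s * (p * (1 + 2 * ?th))"
    using hs yb by (simp add: algebra_simps)
  have "(\<Sum>t\<in>?I. f (\<sigma> t) (x t)) \<le> (\<Sum>t\<in>?I. ereal (h (\<sigma> t) + y \<bullet> (A (\<sigma> t) *v x t)))"
    by (intro sum_mono h_bound block_perm[OF s])
  also have "\<dots> = ereal ((\<Sum>t\<in>?I. h (\<sigma> t)) + y \<bullet> (\<Sum>t\<in>?I. A (\<sigma> t) *v x t))"
    by (simp add: sum.distrib inner_sum_right)
  also have "\<dots> \<le> ereal (?s * (p * (1 + 2 * ?th)))" using tot by simp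
  finally have "ereal (1 / (?s * (1 - ?th))) * (\<Sum>t\<in>?I. f (\<sigma> t) (x t))
      \<le> ereal (1 / (?s * (1 - ?th))) * ereal (?s * (p * (1 + 2 * ?th)))"
    using s0 th by (intro ereal_mult_left_mono) auto
  also have "\<dots> = ereal (p * (1 + 2 * ?th) / (1 - ?th))"
    using eps_pos by simp
  finally show "ereal (1 / (?s * (1 - ?th))) * (\<Sum>t\<in>?I. f (\<sigma> t) (x t))
      \<le> ereal (p * (1 + 2 * ?th) / (1 - ?th))" .
qed

section \<open>Failure probability and predictability of the estimates\<close>

definition good_est :: "nat \<Rightarrow> (nat \<Rightarrow> nat) \<Rightarrow> bool" where
  "good_est k \<sigma> \<longleftrightarrow> ereal p \<le> PE \<sigma> k \<and> PE \<sigma> k \<le> ereal (p * (1 + 2 * theta eps k) / (1 - theta eps k))"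

text \<open>When step \<open>t\<close> begins, \<open>t - 1\<close> indices have been seen, so
  \<open>rem_mean n c (t - 1)\<close> is the conditional mean of \<open>c (\<sigma> t)\<close>. Only
  one side matters for each quantity: not too much resource use, not too little value.\<close>

definition good_rem :: "nat \<Rightarrow> (nat \<Rightarrow> nat) \<Rightarrow> bool" where
  "good_rem t \<sigma> \<longleftrightarrow> (\<forall>i. rem_mean n (astar i) (t - 1) \<sigma> \<le> (1 + wid eps (kappa n eps t)) / real n)
     \<and> (1 - wid eps (kappa n eps t)) / real n \<le> rem_mean n phi (t - 1) \<sigma>"

lemma tail_exponent: "exp (- (2 / 5) * (2 ^ k * eps) * (theta eps k)\<^sup>2 / gamma) = B"
proof -
  have "- (2 / 5) * (2 ^ k * eps) * (theta eps k)\<^sup>2 / gamma = - (2 / 5) * (2 ^ k * eps * (wid eps (Suc k))\<^sup>2) / gamma"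
    by (simp add: theta_eq)
  also have "\<dots> = - (eps\<^sup>2 / (5 * gamma))" unfolding wid_scaled by simp
  finally show ?thesis unfolding B_def by simp
qed

lemma pexp_bad_est:
  assumes k: "k < L"
  shows "pexp n (\<lambda>\<sigma>. of_bool (\<not> good_est k \<sigma>)) \<le> real (CARD('m) + 2) * B"
proof -
  let ?s = "2 ^ k * eps" and ?th = "theta eps k" and ?I = "{1..2 ^ k * N}"
  note bb = block_bounds[OF k] and th = less_imp_le[OF theta_range(1)[of k]] theta_range(2)[of k]
  define E1 where "E1 \<sigma> \<longleftrightarrow> (\<Sum>t\<in>?I. phi (\<sigma> t)) \<le> ?s * (1 - ?th)" for \<sigma>
  define E2 where "E2 \<sigma> \<longleftrightarrow> ?s * ((\<Sum>j\<in>{1..n}. hp j) + ?th) \<le> (\<Sum>t\<in>?I. hp (\<sigma> t))" for \<sigma>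
  define E3 where "E3 i \<sigma> \<longleftrightarrow> ?s * ((\<Sum>j\<in>{1..n}. astar i j) + ?th) \<le> (\<Sum>t\<in>?I. astar i (\<sigma> t))" for i \<sigma>
  have "pexp n (\<lambda>\<sigma>. of_bool (\<not> good_est k \<sigma>))
      \<le> pexp n (\<lambda>\<sigma>. of_bool (E1 \<sigma> \<or> E2 \<sigma>)) + pexp n (\<lambda>\<sigma>. of_bool (\<exists>i. E3 i \<sigma>))"
  proof (rule pexp_or_le, rule ccontr)
    fix \<sigma> assume s: "\<sigma> \<in> perms n" "\<not> good_est k \<sigma>" and no: "\<not> ((E1 \<sigma> \<or> E2 \<sigma>) \<or> (\<exists>i. E3 i \<sigma>))"
    have "(\<Sum>t\<in>?I. astar i (\<sigma> t)) \<le> ?s * (1 + ?th)" for i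
    proof -
      have "(\<Sum>t\<in>?I. astar i (\<sigma> t)) \<le> ?s * ((\<Sum>j\<in>{1..n}. astar i j) + ?th)" using no unfolding E3_def by (meson linear)
      also have "\<dots> \<le> ?s * (1 + ?th)" using astar_sum eps_pos by (intro mult_left_mono add_right_mono) auto
      finally show ?thesis .
    qed
    then have "ereal p \<le> PE \<sigma> k" using no unfolding E1_def by (intro Pest_ge_p s k) (meson linear, blast)
    moreover have "PE \<sigma> k \<le> ereal (p * (1 + 2 * ?th) / (1 - ?th))"
      using no unfolding E2_def by (intro Pest_le s k) (meson linear)
    ultimately show False using s(2) unfolding good_est_def by blast
  qed
  also have "pexp n (\<lambda>\<sigma>. of_bool (E1 \<sigma> \<or> E2 \<sigma>)) \<le> pexp n (\<lambda>\<sigma>. of_bool (E1 \<sigma>)) + pexp n (\<lambda>\<sigma>. of_bool (E2 \<sigma>))"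
    by (rule pexp_or_le)
  also have "pexp n (\<lambda>\<sigma>. of_bool (E1 \<sigma>)) \<le> B"
    unfolding E1_def tail_exponent[of k, symmetric]
    by (rule sample_lower_tail[OF n_pos gamma_pos phi_range bb phi_sum th])
  also have "pexp n (\<lambda>\<sigma>. of_bool (E2 \<sigma>)) \<le> B"
    unfolding E2_def tail_exponent[of k, symmetric]
    by (rule sample_upper_tail[OF n_pos gamma_pos hp_range bb refl hp_sum th])
  also have "pexp n (\<lambda>\<sigma>. of_bool (\<exists>i. E3 i \<sigma>)) \<le> real CARD('m) * B"
  proof (rule pexp_const_union_bound)
    show "pexp n (\<lambda>\<sigma>. of_bool (E3 i \<sigma>)) \<le> B" for i
      unfolding E3_def tail_exponent[of k, symmetric]
      by (rule sample_upper_tail[OF n_pos gamma_pos astar_range bb refl astar_sum th])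
  qed auto
  finally show ?thesis by (simp add: algebra_simps)
qed

lemma pexp_bad_rem:
  "pexp n (\<lambda>\<sigma>. of_bool (\<exists>t\<in>{1..n - N}. \<not> good_rem t \<sigma>)) \<le> real L * (real (CARD('m) + 1) * B)"
proof -
  \<comment> \<open>At least \<open>N * 2 ^ k\<close> indices are unseen up to this time, and
    \<open>t - 1 \<le> T k\<close> for every \<open>t\<close> with
    \<open>kappa n eps t = k + 1\<close>. One maximal inequality per \<open>k\<close> thus serves
    the whole block.\<close>
  define T where "T k = n - N * 2 ^ k" for k :: nat
  define E1 where "E1 k \<sigma> \<longleftrightarrow> (\<exists>t\<le>T k. rem_mean n phi t \<sigma> \<le> (1 - theta eps k) / real n)" for k \<sigma>
  define E2 where "E2 k i \<sigma> \<longleftrightarrow> (\<exists>t\<le>T k. ((\<Sum>j\<in>{1..n}. astar i j) + theta eps k) / real n \<le> rem_mean n (astar i) t \<sigma>)" for k i \<sigma>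
  have "pexp n (\<lambda>\<sigma>. of_bool (\<exists>t\<in>{1..n - N}. \<not> good_rem t \<sigma>)) \<le> real (card {..<L}) * (real (CARD('m) + 1) * B)"
  proof (rule pexp_const_union_bound[where R = "\<lambda>k \<sigma>. E1 k \<sigma> \<or> (\<exists>i. E2 k i \<sigma>)"])
    fix \<sigma> assume "\<sigma> \<in> perms n" "\<exists>t\<in>{1..n - N}. \<not> good_rem t \<sigma>"
    then obtain t where t: "t \<in> {1..n - N}" "\<not> good_rem t \<sigma>" by blast
    have lb: "1 \<le> kappa n eps t" "kappa n eps t \<le> L" "N * 2 ^ (kappa n eps t - 1) < n - t + 1"
      unfolding kappa_eq[OF t(1)] using lev_bounds[of N "n - t + 1" L] t(1) n_eq n16 N1 by auto
    define k where "k = kappa n eps t - 1"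
    have k: "k < L" "kappa n eps t = Suc k" "t - 1 \<le> T k"
      using lb t(1) unfolding k_def T_def by auto
    have w: "wid eps (kappa n eps t) = theta eps k" by (simp add: k theta_eq)
    have "E1 k \<sigma> \<or> (\<exists>i. E2 k i \<sigma>)"
    proof (cases "(1 - theta eps k) / real n \<le> rem_mean n phi (t - 1) \<sigma>")
      case True
      then obtain i where "\<not> rem_mean n (astar i) (t - 1) \<sigma> \<le> (1 + theta eps k) / real n"
        using t(2) unfolding good_rem_def w by blast
      moreover have "((\<Sum>j\<in>{1..n}. astar i j) + theta eps k) / real n \<le> (1 + theta eps k) / real n"
        using astar_sum by (intro divide_right_mono) auto
      ultimately have "((\<Sum>j\<in>{1..n}. astar i j) + theta eps k) / real n \<le> rem_mean n (astar i) (t - 1) \<sigma>"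
        by linarith
      then show ?thesis using k(3) unfolding E2_def by blast
    next
      case False
      then have "rem_mean n phi (t - 1) \<sigma> \<le> (1 - theta eps k) / real n" by linarith
      then show ?thesis using k(3) unfolding E1_def by blast
    qed
    then show "\<exists>k\<in>{..<L}. E1 k \<sigma> \<or> (\<exists>i. E2 k i \<sigma>)" using k(1) by blast
  next
    fix k assume "k \<in> {..<L}"
    then have "(2::nat) ^ k \<le> 2 ^ L" by (intro power_increasing) auto
    then have Nk: "N * 2 ^ k \<le> n" "0 < N * 2 ^ k" using N1 unfolding n_eq by auto
    then have T: "T k < n" unfolding T_def by linarith
    have "real n - real (T k) = real N * 2 ^ k" using Nk by (simp add: T_def of_nat_diff)
    moreover have "2 ^ k * eps = real N * 2 ^ k / real n" using n_pos n_eps by (simp add: field_simps)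
    ultimately have s: "2 ^ k * eps = (real n - real (T k)) / real n" by simp
    note th = less_imp_le[OF theta_range(1)[of k]] theta_range(2)[of k]
    have "pexp n (\<lambda>\<sigma>. of_bool (E1 k \<sigma> \<or> (\<exists>i. E2 k i \<sigma>)))
        \<le> pexp n (\<lambda>\<sigma>. of_bool (E1 k \<sigma>)) + pexp n (\<lambda>\<sigma>. of_bool (\<exists>i. E2 k i \<sigma>))"
      by (rule pexp_or_le)
    also have "pexp n (\<lambda>\<sigma>. of_bool (E1 k \<sigma>)) \<le> B"
      unfolding E1_def tail_exponent[of k, symmetric]
      by (rule rem_lower_tail[OF n_pos gamma_pos phi_range T s phi_sum th])
    also have "pexp n (\<lambda>\<sigma>. of_bool (\<exists>i. E2 k i \<sigma>)) \<le> real CARD('m) * B"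
    proof (rule pexp_const_union_bound)
      show "pexp n (\<lambda>\<sigma>. of_bool (E2 k i \<sigma>)) \<le> B" for i
        unfolding E2_def tail_exponent[of k, symmetric]
        by (rule rem_upper_tail[OF n_pos gamma_pos astar_range T s refl astar_sum th])
    qed auto
    finally show "pexp n (\<lambda>\<sigma>. of_bool (E1 k \<sigma> \<or> (\<exists>i. E2 k i \<sigma>))) \<le> real (CARD('m) + 1) * B"
      by (simp add: algebra_simps)
  qed simp
  then show ?thesis by simp
qed

text \<open>Time \<open>t\<close> is included, since the conditions for step \<open>t\<close> are
  settled before \<open>\<sigma> t\<close> is drawn. The event shrinks as \<open>t\<close>
  grows.\<close>

definition Good :: "nat \<Rightarrow> (nat \<Rightarrow> nat) \<Rightarrow> bool" where
  "Good t \<sigma> \<longleftrightarrow> (\<forall>s\<in>{N+1..t}. good_est (eta n eps s - 1) \<sigma> \<and> good_rem s \<sigma>)"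

lemma eta_bounds:
  assumes "t \<in> {N+1..n}" shows "eta n eps t - 1 < L" "2 ^ (eta n eps t - 1) * N < t" "1 \<le> eta n eps t"
  using lev_bounds[of N t L] assms n_eq unfolding eta_eq[OF assms] by (auto simp: mult.commute)

text \<open>Each level contributes \<open>CARD('m) + 2\<close> events for the samples and
  \<open>CARD('m) + 1\<close> for the suffixes.\<close>

lemma pexp_not_Good:
  assumes "T \<le> n - N"
  shows "pexp n (\<lambda>\<sigma>. of_bool (\<not> Good T \<sigma>)) \<le> real L * real (2 * CARD('m) + 3) * B"
proof -
  have "pexp n (\<lambda>\<sigma>. of_bool (\<not> Good T \<sigma>))
      \<le> pexp n (\<lambda>\<sigma>. of_bool (\<exists>k<L. \<not> good_est k \<sigma>)) + pexp n (\<lambda>\<sigma>. of_bool (\<exists>t\<in>{1..n - N}. \<not> good_rem t \<sigma>))"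
  proof (rule pexp_or_le)
    fix \<sigma> assume "\<not> Good T \<sigma>"
    then obtain s where s: "s \<in> {N+1..T}" "\<not> good_est (eta n eps s - 1) \<sigma> \<or> \<not> good_rem s \<sigma>"
      unfolding Good_def by blast
    have "s \<in> {N+1..n}" "s \<in> {1..n - N}" using s(1) assms by auto
    then show "(\<exists>k<L. \<not> good_est k \<sigma>) \<or> (\<exists>t\<in>{1..n - N}. \<not> good_rem t \<sigma>)"
      using s(2) eta_bounds(1) by blast
  qed
  also have "pexp n (\<lambda>\<sigma>. of_bool (\<exists>k<L. \<not> good_est k \<sigma>)) \<le> real (card {..<L}) * (real (CARD('m) + 2) * B)"
    using pexp_bad_est by (intro pexp_const_union_bound[where R = "\<lambda>k \<sigma>. \<not> good_est k \<sigma>"]) auto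
  also note pexp_bad_rem
  finally show ?thesis by (simp add: algebra_simps)
qed

lemma Pest_cong:
  assumes "\<And>s. s \<in> {1..2 ^ k * N} \<Longrightarrow> \<sigma> s = \<sigma>' s" shows "PE \<sigma> k = PE \<sigma>' k"
proof -
  have "(\<Sum>t\<in>{1..2 ^ k * N}. f (\<sigma> t) (x t)) = (\<Sum>t\<in>{1..2 ^ k * N}. f (\<sigma>' t) (x t))"
    "(\<Sum>t\<in>{1..2 ^ k * N}. A (\<sigma> t) *v x t) = (\<Sum>t\<in>{1..2 ^ k * N}. A (\<sigma>' t) *v x t)" for x
    using assms by (auto intro!: sum.cong)
  then show ?thesis unfolding Pest_def neps_eq by presburger
qed

text \<open>The sample behind the estimate consists of the first
  \<open>2 ^ (eta n eps t - 1) * N\<close> indices, strictly fewer than \<open>t\<close>.\<close>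

lemma adapted_Pest:
  assumes "t \<in> {N+1..n}" shows "adapted n (t - 1) (\<lambda>\<sigma>. PE \<sigma> (eta n eps t - 1))"
proof (rule adaptedI, rule Pest_cong)
  fix \<sigma> \<sigma>' :: "nat \<Rightarrow> nat" and s
  assume "\<And>s. s \<in> {1..t - 1} \<Longrightarrow> \<sigma> s = \<sigma>' s" "s \<in> {1..2 ^ (eta n eps t - 1) * N}"
  then show "\<sigma> s = \<sigma>' s" using eta_bounds(2)[OF assms] by auto
qed

lemma adapted_good_rem:
  assumes "t \<in> {1..n}" shows "adapted n (t - 1) (good_rem t)"
proof (rule adaptedI)
  fix \<sigma> \<sigma>' assume s: "\<sigma> \<in> perms n" "\<sigma>' \<in> perms n" "\<And>s. s \<in> {1..t - 1} \<Longrightarrow> \<sigma> s = \<sigma>' s"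
  have "rem_mean n c (t - 1) \<sigma> = rem_mean n c (t - 1) \<sigma>'" for c
    by (rule adaptedD[OF adapted_rem_mean s]) (use assms in auto)
  then show "good_rem t \<sigma> = good_rem t \<sigma>'" unfolding good_rem_def by simp
qed

text \<open>This allows the indicator of \<open>Good t\<close> to stand inside the conditional
  expectation of step \<open>t\<close>.\<close>

lemma adapted_Good:
  assumes "t \<le> n" shows "adapted n (t - 1) (Good t)"
proof (rule adaptedI)
  fix \<sigma> \<sigma>' assume s: "\<sigma> \<in> perms n" "\<sigma>' \<in> perms n" "\<And>s. s \<in> {1..t - 1} \<Longrightarrow> \<sigma> s = \<sigma>' s"
  have "PE \<sigma> (eta n eps u - 1) = PE \<sigma>' (eta n eps u - 1)" "good_rem u \<sigma> = good_rem u \<sigma>'" if "u \<in> {N+1..t}" for u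
  proof -
    have u: "u \<in> {N+1..n}" "u \<in> {1..n}" and u1: "u - 1 \<le> t - 1" using that assms by auto
    show "PE \<sigma> (eta n eps u - 1) = PE \<sigma>' (eta n eps u - 1)"
      by (rule adaptedD[OF adapted_mono[OF adapted_Pest[OF u(1)] u1] s])
    show "good_rem u \<sigma> = good_rem u \<sigma>'"
      by (rule adaptedD[OF adapted_mono[OF adapted_good_rem[OF u(2)] u1] s])
  qed
  then show "Good t \<sigma> = Good t \<sigma>'" unfolding Good_def good_est_def by simp
qed

end

section \<open>The exponential potential\<close>

text \<open>State \<open>j\<close> belongs to time \<open>N + 1 + j\<close>. It contains
  \<open>j\<close> decisions but \<open>j + 1\<close> offsets, because each update already applies
  the offset of the following step.\<close>

lemma ESA_state_closed_form:
  fixes n :: nat and eps :: real and b :: "real^'m" and f :: "nat \<Rightarrow> real^'k \<Rightarrow> ereal"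
  defines "N \<equiv> neps n eps"
  shows "ESA_state n eps gamma b f A \<sigma> x j =
    ((\<chi> i. exp (nu eps gamma * (\<Sum>s\<in>{N+1..<N+1+j}. (A (\<sigma> s) *v x s) $ i / b $ i)
        - (\<Sum>s\<in>{N+1..<N+1+Suc j}. beta n eps gamma s)) / real CARD('m)),
     exp (- nu' eps gamma * (\<Sum>s\<in>{N+1..<N+1+j}. real_of_ereal (f (\<sigma> s) (x s)) / qq n eps f A b \<sigma> s)
        + (\<Sum>s\<in>{N+1..<N+1+Suc j}. beta' n eps gamma s)))"
proof (induction j)
  case 0
  then show ?case by (simp add: N_def)
next
  case (Suc j)
  define M where "M = N + 1 + j"
  have M: "neps n eps + 1 + j = M" "M + 1 = Suc M" "N + 1 + j = M" "N + 1 + Suc j = Suc M"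
      "N + 1 + Suc (Suc j) = Suc (Suc M)" by (simp_all add: M_def N_def)
  have sum_Suc: "(\<Sum>s\<in>{N+1..<Suc M}. g s) = (\<Sum>s\<in>{N+1..<M}. g s) + g M"
    "(\<Sum>s\<in>{N+1..<Suc (Suc M)}. g s) = (\<Sum>s\<in>{N+1..<Suc M}. g s) + g (Suc M)" for g :: "nat \<Rightarrow> real"
    by (simp_all add: M_def)
  let ?a = "\<lambda>i s. (A (\<sigma> s) *v x s) $ i / b $ i" and ?r = "\<lambda>s. real_of_ereal (f (\<sigma> s) (x s)) / qq n eps f A b \<sigma> s"
  have "exp (nu eps gamma * (\<Sum>s\<in>{N+1..<M}. ?a i s) - (\<Sum>s\<in>{N+1..<Suc M}. beta n eps gamma s)) / real CARD('m)
      * exp (nu eps gamma / b $ i * (A (\<sigma> M) *v x M) $ i - beta n eps gamma (Suc M))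
      = exp (nu eps gamma * (\<Sum>s\<in>{N+1..<Suc M}. ?a i s) - (\<Sum>s\<in>{N+1..<Suc (Suc M)}. beta n eps gamma s)) / real CARD('m)" for i
    unfolding sum_Suc(1)[of "?a i"] sum_Suc(2)[of "beta n eps gamma"]
    by (simp add: distrib_left exp_diff exp_add)
  moreover have "exp (- nu' eps gamma * (\<Sum>s\<in>{N+1..<M}. ?r s) + (\<Sum>s\<in>{N+1..<Suc M}. beta' n eps gamma s))
      * exp (- nu' eps gamma / qq n eps f A b \<sigma> M * real_of_ereal (f (\<sigma> M) (x M)) + beta' n eps gamma (Suc M))
      = exp (- nu' eps gamma * (\<Sum>s\<in>{N+1..<Suc M}. ?r s) + (\<Sum>s\<in>{N+1..<Suc (Suc M)}. beta' n eps gamma s))"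
    unfolding sum_Suc(1)[of ?r] sum_Suc(2)[of "beta' n eps gamma"] exp_add[symmetric]
    by (simp add: distrib_left)
  ultimately show ?case
    unfolding ESA_state.simps Let_def Suc.IH case_prod_conv M by (simp add: vec_eq_iff)
qed

text \<open>Step \<open>t\<close> of \<open>X\<close> may depend on the values up to
  \<open>\<sigma> t\<close> only, so ties among minimisers are resolved without looking
  ahead.\<close>

locale esa_run = esa N L n eps b f A gamma xs y h
  for N L n :: nat and eps :: real and b :: "real^'m" and f :: "nat \<Rightarrow> real^'k \<Rightarrow> ereal"
    and A :: "nat \<Rightarrow> real^'k^'m" and gamma :: real and xs :: "nat \<Rightarrow> real^'k" and y :: "real^'m" and h :: "nat \<Rightarrow> real" +
  fixes X :: "(nat \<Rightarrow> nat) \<Rightarrow> nat \<Rightarrow> real^'k"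
  assumes run: "\<sigma> permutes {1..n} \<Longrightarrow> ESA_run n eps gamma b f A \<sigma> (X \<sigma>)"
    and nonanticipating: "(\<And>s. s \<le> t \<Longrightarrow> \<sigma> s = \<sigma>' s) \<Longrightarrow> X \<sigma> t = X \<sigma>' t"
begin

abbreviation "bt t \<equiv> beta n eps gamma t"
abbreviation "bt' t \<equiv> beta' n eps gamma t"
abbreviation "q \<sigma> t \<equiv> qq n eps f A b \<sigma> t"

definition a :: "(nat \<Rightarrow> nat) \<Rightarrow> nat \<Rightarrow> 'm \<Rightarrow> real" where
  "a \<sigma> t i = (A (\<sigma> t) *v X \<sigma> t) $ i / b $ i"

definition r :: "(nat \<Rightarrow> nat) \<Rightarrow> nat \<Rightarrow> real" where
  "r \<sigma> t = real_of_ereal (f (\<sigma> t) (X \<sigma> t)) / q \<sigma> t"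

text \<open>\<open>U\<close> and \<open>V\<close> are \<open>y\<close> and \<open>y'\<close>
  stripped of the offset of the current step. The potential then starts at exactly 2, and the offset
  of step \<open>t\<close> is spent in step \<open>t\<close> against the conditional mean.\<close>

definition U :: "nat \<Rightarrow> 'm \<Rightarrow> (nat \<Rightarrow> nat) \<Rightarrow> real" where
  "U t i \<sigma> = exp (nu eps gamma * (\<Sum>s\<in>{N+1..<t}. a \<sigma> s i) - (\<Sum>s\<in>{N+1..<t}. bt s)) / real CARD('m)"

definition V :: "nat \<Rightarrow> (nat \<Rightarrow> nat) \<Rightarrow> real" where
  "V t \<sigma> = exp (- nu' eps gamma * (\<Sum>s\<in>{N+1..<t}. r \<sigma> s) + (\<Sum>s\<in>{N+1..<t}. bt' s))"

definition W :: "nat \<Rightarrow> (nat \<Rightarrow> nat) \<Rightarrow> real" where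
  "W t \<sigma> = (\<Sum>i\<in>UNIV. U t i \<sigma>) + V t \<sigma>"

lemma U_pos: "0 < U t i \<sigma>" and V_pos: "0 < V t \<sigma>"
  by (simp_all add: U_def V_def)

lemma W_nonneg: "0 \<le> W t \<sigma>"
  unfolding W_def using U_pos V_pos by (intro add_nonneg_nonneg sum_nonneg) (auto intro: less_imp_le)

lemma W_init: "W (N + 1) \<sigma> = 2"
  by (simp add: W_def U_def V_def)

lemma ESA_y_eq:
  assumes "N + 1 \<le> t"
  shows "ESA_y n eps gamma b f A \<sigma> (X \<sigma>) t $ i = U t i \<sigma> * exp (- bt t)"
    "ESA_y' n eps gamma b f A \<sigma> (X \<sigma>) t = V t \<sigma> * exp (bt' t)"
proof -
  have t: "N + 1 + (t - N - 1) = t" "N + 1 + Suc (t - N - 1) = Suc t" using assms by auto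
  have sum_Suc: "(\<Sum>s\<in>{N+1..<Suc t}. g s) = (\<Sum>s\<in>{N+1..<t}. g s) + g t" for g :: "nat \<Rightarrow> real"
    using assms by simp
  show "ESA_y n eps gamma b f A \<sigma> (X \<sigma>) t $ i = U t i \<sigma> * exp (- bt t)"
    unfolding ESA_y_def ESA_state_closed_form neps_eq t sum_Suc U_def a_def fst_conv vec_lambda_beta
    by (simp only: exp_diff exp_add exp_minus divide_inverse inverse_mult_distrib mult_ac)
  show "ESA_y' n eps gamma b f A \<sigma> (X \<sigma>) t = V t \<sigma> * exp (bt' t)"
    unfolding ESA_y'_def ESA_state_closed_form neps_eq t sum_Suc V_def r_def snd_conv
    by (simp only: exp_add mult_ac)
qed

text \<open>The competitor \<open>z = 0\<close> has objective 0, while resource use costs a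
  nonnegative amount; so the chosen point has nonnegative value. The second claim is minimality in
  real arithmetic.\<close>

lemma step_nonneg:
  assumes s: "\<sigma> \<in> perms n" and t: "t \<in> {N+1..n}"
  shows "0 \<le> f (\<sigma> t) (X \<sigma> t)"
    and "0 \<le> f (\<sigma> t) z \<Longrightarrow>
      (\<Sum>i\<in>UNIV. U t i \<sigma> * exp (- bt t) * a \<sigma> t i) - V t \<sigma> * exp (bt' t) * r \<sigma> t
      \<le> (\<Sum>i\<in>UNIV. U t i \<sigma> * exp (- bt t) * ((A (\<sigma> t) *v z) $ i / b $ i))
         - V t \<sigma> * exp (bt' t) * (real_of_ereal (f (\<sigma> t) z) / q \<sigma> t)"
proof -
  define c where "c = V t \<sigma> * exp (bt' t) / q \<sigma> t"
  define F where "F z = (\<Sum>i\<in>UNIV. U t i \<sigma> * exp (- bt t) * ((A (\<sigma> t) *v z) $ i / b $ i))" for z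
  have c: "0 < c" using qq_pos[OF s t] V_pos by (simp add: c_def)
  have st: "\<sigma> t \<in> {1..n}" by (rule perms_in[OF s]) (use t in auto)
  have obj: "ESA_obj n eps gamma b f A \<sigma> (X \<sigma>) t z = ereal (F z) - ereal c * f (\<sigma> t) z" for z
  proof -
    have "(\<Sum>i\<in>UNIV. U t i \<sigma> * exp (- bt t) / b $ i * (A (\<sigma> t) *v z) $ i) = F z"
      unfolding F_def by (intro sum.cong) auto
    moreover have "N + 1 \<le> t" using t by simp
    ultimately show ?thesis unfolding ESA_obj_def c_def by (simp only: ESA_y_eq)
  qed
  have opt: "ereal (F (X \<sigma> t)) - ereal c * f (\<sigma> t) (X \<sigma> t) \<le> ereal (F z) - ereal c * f (\<sigma> t) z" for z
    using run[of \<sigma>] s t unfolding ESA_run_def perms_def neps_eq obj[symmetric] by blast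
  have F0: "F 0 = 0" by (simp add: F_def)
  show f0: "0 \<le> f (\<sigma> t) (X \<sigma> t)"
  proof (cases "f (\<sigma> t) (X \<sigma> t)")
    case (real v)
    have "0 \<le> F (X \<sigma> t)" unfolding F_def
      using Ax_nonneg[OF st, of "X \<sigma> t"] U_pos b_pos real
      by (intro sum_nonneg mult_nonneg_nonneg divide_nonneg_pos) (auto intro: less_imp_le)
    moreover have "F (X \<sigma> t) - c * v \<le> 0" using opt[of 0] real F0 f_0[OF st] by simp
    ultimately have "0 \<le> c * v" by linarith
    then have "0 \<le> v" using c by (simp add: zero_le_mult_iff)
    then show ?thesis by (simp add: real)
  next
    case PInf then show ?thesis by simp
  next
    case MInf then show ?thesis using opt[of 0] c F0 f_0[OF st] by simp
  qed
  assume z: "0 \<le> f (\<sigma> t) z"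
  obtain v w where vw: "f (\<sigma> t) (X \<sigma> t) = ereal v" "f (\<sigma> t) z = ereal w"
    using f_eq[OF st f0] f_eq[OF st z] by blast
  then have "F (X \<sigma> t) - c * v \<le> F z - c * w" using opt[of z] by simp
  then show "(\<Sum>i\<in>UNIV. U t i \<sigma> * exp (- bt t) * a \<sigma> t i) - V t \<sigma> * exp (bt' t) * r \<sigma> t
      \<le> (\<Sum>i\<in>UNIV. U t i \<sigma> * exp (- bt t) * ((A (\<sigma> t) *v z) $ i / b $ i))
         - V t \<sigma> * exp (bt' t) * (real_of_ereal (f (\<sigma> t) z) / q \<sigma> t)"
    unfolding F_def a_def r_def c_def vw by simp
qed

lemma adapted_X:
  assumes "\<sigma> \<in> perms n" "\<sigma>' \<in> perms n" "\<And>s. s \<in> {1..t} \<Longrightarrow> \<sigma> s = \<sigma>' s"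
  shows "X \<sigma> t = X \<sigma>' t"
proof (rule nonanticipating)
  fix s assume "s \<le> t"
  \<comment> \<open>A permutation of \<open>{1..n}\<close> fixes 0, so agreement on
    \<open>{1..t}\<close> covers the index 0 required by \<open>nonanticipating\<close>.\<close>
  have "\<sigma> 0 = 0" "\<sigma>' 0 = 0" using assms(1,2) unfolding perms_def by (auto simp: permutes_def)
  then show "\<sigma> s = \<sigma>' s" using assms(3)[of s] \<open>s \<le> t\<close> by (cases s) auto
qed

lemma adapted_q:
  assumes "t \<in> {N+1..n}" shows "adapted n (t - 1) (\<lambda>\<sigma>. q \<sigma> t)"
proof (rule adaptedI)
  fix \<sigma> \<sigma>' assume s: "\<sigma> \<in> perms n" "\<sigma>' \<in> perms n" "\<And>s. s \<in> {1..t - 1} \<Longrightarrow> \<sigma> s = \<sigma>' s"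
  have "PE \<sigma> (eta n eps t - 1) = PE \<sigma>' (eta n eps t - 1)"
    by (rule adaptedD[OF adapted_Pest[OF assms] s])
  then show "q \<sigma> t = q \<sigma>' t" unfolding qq_def by simp
qed

lemma adapted_UV:
  assumes "t \<le> n" shows "adapted n (t - 1) (U t i)" "adapted n (t - 1) (V t)"
proof -
  have ar: "a \<sigma> u i = a \<sigma>' u i" "r \<sigma> u = r \<sigma>' u"
    if s: "\<sigma> \<in> perms n" "\<sigma>' \<in> perms n" "\<And>s. s \<in> {1..t - 1} \<Longrightarrow> \<sigma> s = \<sigma>' s" and u: "u \<in> {N+1..<t}" for \<sigma> \<sigma>' u
  proof -
    have "\<sigma> u = \<sigma>' u" "X \<sigma> u = X \<sigma>' u" using s u by (auto intro!: adapted_X)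
    moreover have "q \<sigma> u = q \<sigma>' u"
      by (rule adaptedD[OF adapted_q s(1,2)]) (use u assms s(3) in auto)
    ultimately show "a \<sigma> u i = a \<sigma>' u i" "r \<sigma> u = r \<sigma>' u" by (simp_all add: a_def r_def)
  qed
  show "adapted n (t - 1) (U t i)"
  proof (rule adaptedI)
    fix \<sigma> \<sigma>' assume "\<sigma> \<in> perms n" "\<sigma>' \<in> perms n" "\<And>s. s \<in> {1..t - 1} \<Longrightarrow> \<sigma> s = \<sigma>' s"
    then have "(\<Sum>s\<in>{N+1..<t}. a \<sigma> s i) = (\<Sum>s\<in>{N+1..<t}. a \<sigma>' s i)"
      by (intro sum.cong refl ar)
    then show "U t i \<sigma> = U t i \<sigma>'" by (simp only: U_def)
  qed
  show "adapted n (t - 1) (V t)"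
  proof (rule adaptedI)
    fix \<sigma> \<sigma>' assume "\<sigma> \<in> perms n" "\<sigma>' \<in> perms n" "\<And>s. s \<in> {1..t - 1} \<Longrightarrow> \<sigma> s = \<sigma>' s"
    then have "(\<Sum>s\<in>{N+1..<t}. r \<sigma> s) = (\<Sum>s\<in>{N+1..<t}. r \<sigma>' s)"
      by (intro sum.cong refl ar)
    then show "V t \<sigma> = V t \<sigma>'" by (simp only: V_def)
  qed
qed

lemma beta_eq:
  assumes "t \<le> n - N" shows "bt t = eps / (gamma * real n) * (1 + wid eps (kappa n eps t))"
  using assms by (simp add: beta_def Let_def neps_eq wid_def min_absorb1)

lemma alpha_eq: "alpha n eps t = (1 - wid eps (eta n eps t)) / (1 + 2 * wid eps (eta n eps t))"
proof -
  have "2 powr (- real (eta n eps t) / 2 + 1) = 2 powr (- real (eta n eps t) / 2) * 2 powr 1"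
    by (rule powr_add)
  then show ?thesis unfolding alpha_def wid_def by simp
qed

lemma beta'_eq:
  assumes "t \<le> n - N"
  shows "bt' t = eps / (gamma * real n) * (1 - wid eps (kappa n eps t)) * alpha n eps t"
  using assms by (simp add: beta'_def Let_def neps_eq wid_def min_absorb1)

text \<open>\<open>alpha\<close> is the reciprocal of the factor
  \<open>(1 + 2 * d) / (1 - d)\<close> by which the estimate may exceed \<open>p\<close>, with
  \<open>d\<close> the width at level \<open>eta\<close>.\<close>

lemma good_q:
  assumes s: "\<sigma> \<in> perms n" and t: "t \<in> {N+1..n}" and good: "Good t \<sigma>"
  shows "p \<le> q \<sigma> t" "alpha n eps t \<le> p / q \<sigma> t"
proof -
  define k where "k = eta n eps t - 1"
  have k: "k < L" "eta n eps t = Suc k" using eta_bounds[OF t] by (auto simp: k_def)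
  have ge: "good_est k \<sigma>" using good t unfolding Good_def k_def by auto
  have "PE \<sigma> k \<noteq> \<infinity>" by (rule Pest_finite[OF s k(1)])
  then obtain v where v: "PE \<sigma> k = ereal v" using ge unfolding good_est_def by (cases "PE \<sigma> k") auto
  have pv: "p \<le> v" "v \<le> p * (1 + 2 * theta eps k) / (1 - theta eps k)" using ge unfolding good_est_def v by simp_all
  have q: "q \<sigma> t = v" unfolding qq_def Let_def k_def[symmetric] v using pv(1) p_pos by simp
  show "p \<le> q \<sigma> t" using q pv by simp
  have th: "0 < theta eps k" "theta eps k \<le> 1 / 5" by (rule theta_range)+
  then have "v * (1 - theta eps k) \<le> p * (1 + 2 * theta eps k)" using pv(2) by (simp add: pos_le_divide_eq)
  then show "alpha n eps t \<le> p / q \<sigma> t"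
    unfolding alpha_eq k(2) theta_eq[symmetric] q using th pv(1) p_pos by (simp add: divide_simps mult.commute)
qed

text \<open>Here the estimate must not be too small: values are bounded by \<open>gamma\<close> in
  units of \<open>p\<close>, and \<open>p \<le> q\<close> carries this over to units of
  \<open>q\<close>, as the chord bound requires.\<close>

lemma r_range:
  assumes s: "\<sigma> \<in> perms n" and t: "t \<in> {N+1..n}" and good: "Good t \<sigma>"
  shows "0 \<le> r \<sigma> t" "r \<sigma> t \<le> gamma"
proof -
  have st: "\<sigma> t \<in> {1..n}" by (rule perms_in[OF s]) (use t in auto)
  note ff = f_real_range[OF st step_nonneg(1)[OF s t]]
  show "0 \<le> r \<sigma> t" using ff(1) qq_pos[OF s t] by (simp add: r_def)
  have "gamma * p \<le> gamma * q \<sigma> t" using good_q(1)[OF assms] gamma_pos by simp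
  then show "r \<sigma> t \<le> gamma" using ff(2) qq_pos[OF s t] by (simp add: r_def pos_divide_le_eq)
qed

lemma exp_nu_le:
  assumes "0 \<le> x" "x \<le> gamma"
  shows "exp (nu eps gamma * x) \<le> 1 + eps / gamma * x" "exp (- nu' eps gamma * x) \<le> 1 - eps / gamma * x"
proof -
  have "exp (nu eps gamma * gamma) = 1 + eps" "exp (- nu' eps gamma * gamma) = 1 - eps"
    using gamma_pos eps_pos eps_le by (simp_all add: nu_def nu'_def)
  then show "exp (nu eps gamma * x) \<le> 1 + eps / gamma * x" "exp (- nu' eps gamma * x) \<le> 1 - eps / gamma * x"
    using exp_le_chord_scaled[OF assms gamma_pos, of "nu eps gamma"]
      exp_le_chord_scaled[OF assms gamma_pos, of "- nu' eps gamma"] by simp_all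
qed

lemma UV_Suc:
  assumes "N + 1 \<le> t"
  shows "U (t + 1) i \<sigma> = U t i \<sigma> * exp (- bt t) * exp (nu eps gamma * a \<sigma> t i)"
    "V (t + 1) \<sigma> = V t \<sigma> * exp (bt' t) * exp (- nu' eps gamma * r \<sigma> t)"
proof -
  have sum_Suc: "(\<Sum>s\<in>{N+1..<t+1}. g s) = (\<Sum>s\<in>{N+1..<t}. g s) + g t" for g :: "nat \<Rightarrow> real"
    using assms by simp
  show "U (t + 1) i \<sigma> = U t i \<sigma> * exp (- bt t) * exp (nu eps gamma * a \<sigma> t i)"
    "V (t + 1) \<sigma> = V t \<sigma> * exp (bt' t) * exp (- nu' eps gamma * r \<sigma> t)"
    unfolding U_def V_def sum_Suc distrib_left
    by (simp_all only: exp_diff exp_add exp_minus divide_inverse inverse_mult_distrib mult_ac)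
qed

text \<open>The chord bound makes the next potential affine in the step, minimality passes to the
  offline optimum, and averaging leaves conditional means. On \<open>Good t\<close> these are at
  most \<open>bt t\<close> for resources and at least \<open>bt' t\<close> for value, up to the
  factor \<open>eps / gamma\<close>; \<open>1 + x \<le> exp x\<close> then cancels the
  offsets.\<close>

lemma supermartingale_step:
  assumes t: "t \<in> {N+1..n - N}"
  shows "pexp n (\<lambda>\<sigma>. of_bool (Good t \<sigma>) * W (t + 1) \<sigma>) \<le> pexp n (\<lambda>\<sigma>. of_bool (Good (t - 1) \<sigma>) * W t \<sigma>)"
proof -
  have tn: "t \<in> {N+1..n}" "1 \<le> t" "t \<le> n" using t by auto
  define Y where "Y i \<sigma> = U t i \<sigma> * exp (- bt t)" for i \<sigma>
  define Y' where "Y' \<sigma> = V t \<sigma> * exp (bt' t)" for \<sigma>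
  have Y0: "0 \<le> Y i \<sigma>" "0 \<le> Y' \<sigma>" for i \<sigma> using U_pos[of t i \<sigma>] V_pos[of t \<sigma>] by (simp_all add: Y_def Y'_def)
  \<comment> \<open>The bound for the next potential, with \<open>X\<close> replaced by the offline
    optimum. Its coefficients are known before \<open>\<sigma> t\<close> is drawn.\<close>
  define H where "H \<sigma> j = (\<Sum>i\<in>UNIV. Y i \<sigma> * (1 + eps / gamma * astar i j))
      + Y' \<sigma> * (1 - eps / gamma * (p * phi j / q \<sigma> t))" for \<sigma> j
  define c where "c = real n - real t + 1"
  have c: "0 < c" using tn by (simp add: c_def)
  have rm: "(\<Sum>u\<in>{t..n}. g (\<sigma> u)) = c * rem_mean n g (t - 1) \<sigma>" for g \<sigma>
  proof -
    have "t - 1 + 1 = t" "real n - real (t - 1) = c" using tn by (auto simp: c_def of_nat_diff)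
    then show ?thesis using c unfolding rem_mean_def by simp
  qed
  have sH: "(\<Sum>u\<in>{t..n}. H \<sigma> (\<sigma> u)) / c = (\<Sum>i\<in>UNIV. Y i \<sigma> * (1 + eps / gamma * rem_mean n (astar i) (t - 1) \<sigma>))
      + Y' \<sigma> * (1 - eps / gamma * (p * rem_mean n phi (t - 1) \<sigma> / q \<sigma> t))" for \<sigma>
  proof -
    have cd: "(\<Sum>u\<in>{t..n}. 1) = c" using tn by (simp add: c_def of_nat_diff)
    have aff: "(\<Sum>u\<in>{t..n}. k * (1 + l * g (\<sigma> u))) = c * (k * (1 + l * rem_mean n g (t - 1) \<sigma>))" for k l and g :: "nat \<Rightarrow> real"
    proof -
      have "(\<Sum>u\<in>{t..n}. k * (1 + l * g (\<sigma> u))) = k * ((\<Sum>u\<in>{t..n}. 1) + l * (\<Sum>u\<in>{t..n}. g (\<sigma> u)))"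
        by (simp add: sum.distrib sum_distrib_left[symmetric])
      then show ?thesis unfolding cd rm by (simp add: algebra_simps)
    qed
    have aff': "Y' \<sigma> * (1 - eps / gamma * (p * x / q \<sigma> t)) = Y' \<sigma> * (1 + (- (eps / gamma * p / q \<sigma> t)) * x)" for x by simp
    have "(\<Sum>u\<in>{t..n}. H \<sigma> (\<sigma> u)) = (\<Sum>i\<in>UNIV. \<Sum>u\<in>{t..n}. Y i \<sigma> * (1 + eps / gamma * astar i (\<sigma> u)))
        + (\<Sum>u\<in>{t..n}. Y' \<sigma> * (1 + (- (eps / gamma * p / q \<sigma> t)) * phi (\<sigma> u)))"
      unfolding H_def aff' sum.distrib by (subst sum.swap) (rule refl)
    also have "\<dots> = c * ((\<Sum>i\<in>UNIV. Y i \<sigma> * (1 + eps / gamma * rem_mean n (astar i) (t - 1) \<sigma>))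
      + Y' \<sigma> * (1 + (- (eps / gamma * p / q \<sigma> t)) * rem_mean n phi (t - 1) \<sigma>))"
      unfolding aff by (simp only: distrib_left sum_distrib_left)
    finally show ?thesis unfolding aff' using c by simp
  qed
  have "pexp n (\<lambda>\<sigma>. of_bool (Good t \<sigma>) * W (t + 1) \<sigma>) \<le> pexp n (\<lambda>\<sigma>. of_bool (Good t \<sigma>) * H \<sigma> (\<sigma> t))"
  proof (rule pexp_mono)
    fix \<sigma> assume s: "\<sigma> \<in> perms n"
    have st: "\<sigma> t \<in> {1..n}" by (rule perms_in[OF s]) (use tn in auto)
    show "of_bool (Good t \<sigma>) * W (t + 1) \<sigma> \<le> of_bool (Good t \<sigma>) * H \<sigma> (\<sigma> t)"
    proof (cases "Good t \<sigma>")
      case True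
      note rr = r_range[OF s tn(1) True]
      have "W (t + 1) \<sigma> = (\<Sum>i\<in>UNIV. Y i \<sigma> * exp (nu eps gamma * a \<sigma> t i)) + Y' \<sigma> * exp (- nu' eps gamma * r \<sigma> t)"
        unfolding W_def Y_def Y'_def using UV_Suc tn by simp
      also have "\<dots> \<le> (\<Sum>i\<in>UNIV. Y i \<sigma> * (1 + eps / gamma * a \<sigma> t i)) + Y' \<sigma> * (1 - eps / gamma * r \<sigma> t)"
        by (intro add_mono sum_mono mult_left_mono Y0 exp_nu_le rr)
          (simp_all only: a_def a_range[OF st step_nonneg(1)[OF s tn(1)]])
      also have "\<dots> = (\<Sum>i\<in>UNIV. Y i \<sigma>) + Y' \<sigma> + eps / gamma * ((\<Sum>i\<in>UNIV. Y i \<sigma> * a \<sigma> t i) - Y' \<sigma> * r \<sigma> t)"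
        by (simp add: sum.distrib sum_distrib_left algebra_simps)
      \<comment> \<open>The bracket is the objective of the algorithm itself, so its minimality
        permits the comparison with \<open>xs (\<sigma> t)\<close>.\<close>
      also have "\<dots> \<le> (\<Sum>i\<in>UNIV. Y i \<sigma>) + Y' \<sigma> + eps / gamma * ((\<Sum>i\<in>UNIV. Y i \<sigma> * astar i (\<sigma> t)) - Y' \<sigma> * (p * phi (\<sigma> t) / q \<sigma> t))"
      proof (intro add_left_mono mult_left_mono)
        have "p * phi (\<sigma> t) = real_of_ereal (f (\<sigma> t) (xs (\<sigma> t)))" using p_pos by (simp add: phi_def)
        then show "(\<Sum>i\<in>UNIV. Y i \<sigma> * a \<sigma> t i) - Y' \<sigma> * r \<sigma> t \<le> (\<Sum>i\<in>UNIV. Y i \<sigma> * astar i (\<sigma> t)) - Y' \<sigma> * (p * phi (\<sigma> t) / q \<sigma> t)"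
          using step_nonneg(2)[OF s tn(1) xs_nonneg[OF st]] unfolding Y_def Y'_def astar_def by simp
      qed (use eps_pos gamma_pos in auto)
      also have "\<dots> = H \<sigma> (\<sigma> t)"
        unfolding H_def by (simp add: sum.distrib sum_distrib_left algebra_simps)
      finally show ?thesis using True by simp
    qed simp
  qed
  also have "\<dots> = pexp n (\<lambda>\<sigma>. (\<Sum>u\<in>{t..n}. of_bool (Good t \<sigma>) * H \<sigma> (\<sigma> u)) / (real n - real t + 1))"
  proof (rule pexp_conditional)
    fix j
    show "adapted n (t - 1) (\<lambda>\<sigma>. of_bool (Good t \<sigma>) * H \<sigma> j)"
    proof (rule adaptedI)
      fix \<sigma> \<sigma>' assume s: "\<sigma> \<in> perms n" "\<sigma>' \<in> perms n" "\<And>s. s \<in> {1..t - 1} \<Longrightarrow> \<sigma> s = \<sigma>' s"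
      have "Good t \<sigma> = Good t \<sigma>'" by (rule adaptedD[OF adapted_Good[OF tn(3)] s])
      moreover have "q \<sigma> t = q \<sigma>' t" by (rule adaptedD[OF adapted_q[OF tn(1)] s])
      moreover have "U t i \<sigma> = U t i \<sigma>'" for i by (rule adaptedD[OF adapted_UV(1)[OF tn(3)] s])
      moreover have "V t \<sigma> = V t \<sigma>'" by (rule adaptedD[OF adapted_UV(2)[OF tn(3)] s])
      ultimately show "of_bool (Good t \<sigma>) * H \<sigma> j = of_bool (Good t \<sigma>') * H \<sigma>' j"
        unfolding H_def Y_def Y'_def by simp
    qed
  qed (use tn in auto)
  also have "\<dots> \<le> pexp n (\<lambda>\<sigma>. of_bool (Good (t - 1) \<sigma>) * W t \<sigma>)"
  proof (rule pexp_mono)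
    fix \<sigma> assume s: "\<sigma> \<in> perms n"
    have e: "(\<Sum>u\<in>{t..n}. of_bool (Good t \<sigma>) * H \<sigma> (\<sigma> u)) / (real n - real t + 1)
        = of_bool (Good t \<sigma>) * ((\<Sum>u\<in>{t..n}. H \<sigma> (\<sigma> u)) / c)"
      by (simp add: sum_distrib_left c_def)
    show "(\<Sum>u\<in>{t..n}. of_bool (Good t \<sigma>) * H \<sigma> (\<sigma> u)) / (real n - real t + 1) \<le> of_bool (Good (t - 1) \<sigma>) * W t \<sigma>"
    proof (cases "Good t \<sigma>")
      case True
      \<comment> \<open>Accuracy at \<open>t\<close> includes accuracy earlier, so the indicator on
        the right is 1 as well; if \<open>Good t\<close> fails, the left side is 0.\<close>
      then have prev: "Good (t - 1) \<sigma>" unfolding Good_def by auto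
      let ?d = "wid eps (kappa n eps t)"
      have rem: "good_rem t \<sigma>" using True tn unfolding Good_def by auto
      have eg: "0 \<le> eps / gamma" using eps_pos gamma_pos by simp
      have "Y i \<sigma> * (1 + eps / gamma * rem_mean n (astar i) (t - 1) \<sigma>) \<le> U t i \<sigma>" for i
      proof -
        have "1 + eps / gamma * rem_mean n (astar i) (t - 1) \<sigma> \<le> 1 + eps / gamma * ((1 + ?d) / real n)"
          using rem eg unfolding good_rem_def by (intro add_left_mono mult_left_mono) auto
        also have "\<dots> = 1 + bt t" using t by (simp add: beta_eq)
        also have "\<dots> \<le> exp (bt t)" by simp
        finally have "Y i \<sigma> * (1 + eps / gamma * rem_mean n (astar i) (t - 1) \<sigma>) \<le> Y i \<sigma> * exp (bt t)"
          using Y0(1) by (rule mult_left_mono)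
        also have "Y i \<sigma> * exp (bt t) = U t i \<sigma>" by (simp add: Y_def mult.assoc flip: exp_add)
        finally show ?thesis .
      qed
      moreover have "Y' \<sigma> * (1 - eps / gamma * (p * rem_mean n phi (t - 1) \<sigma> / q \<sigma> t)) \<le> V t \<sigma>"
      proof -
        have q0: "0 < q \<sigma> t" by (rule qq_pos[OF s tn(1)])
        have kap: "1 \<le> kappa n eps t"
          using kappa_eq[of t] lev_bounds[of N "n - t + 1" L] t n_eq n16 N1 by auto
        have "(1 - ?d) * alpha n eps t \<le> (1 - ?d) * (p / q \<sigma> t)"
          using good_q(2)[OF s tn(1) True] wid_le[OF kap] by (intro mult_left_mono) auto
        then have "(1 - ?d) * alpha n eps t / real n \<le> (1 - ?d) * (p / q \<sigma> t) / real n"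
          by (rule divide_right_mono) simp
        also have "\<dots> = (p / q \<sigma> t) * ((1 - ?d) / real n)" by simp
        also have "\<dots> \<le> (p / q \<sigma> t) * rem_mean n phi (t - 1) \<sigma>"
          using rem q0 p_pos unfolding good_rem_def by (intro mult_left_mono) auto
        finally have "eps / gamma * ((1 - ?d) * alpha n eps t / real n) \<le> eps / gamma * ((p / q \<sigma> t) * rem_mean n phi (t - 1) \<sigma>)"
          using eg by (rule mult_left_mono)
        then have "1 - eps / gamma * (p * rem_mean n phi (t - 1) \<sigma> / q \<sigma> t) \<le> 1 + - bt' t"
          using t by (simp add: beta'_eq)
        also have "\<dots> \<le> exp (- bt' t)" by (rule exp_ge_add_one_self)
        finally have "Y' \<sigma> * (1 - eps / gamma * (p * rem_mean n phi (t - 1) \<sigma> / q \<sigma> t)) \<le> Y' \<sigma> * exp (- bt' t)"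
          using Y0(2) by (rule mult_left_mono)
        also have "Y' \<sigma> * exp (- bt' t) = V t \<sigma>" by (simp add: Y'_def mult.assoc flip: exp_add)
        finally show ?thesis .
      qed
      ultimately show ?thesis unfolding e sH W_def using True prev by (simp add: sum_mono add_mono)
    next
      case False
      then show ?thesis unfolding e using W_nonneg by simp
    qed
  qed
  finally show ?thesis .
qed

lemma pexp_W_le:
  assumes "N \<le> T" "T \<le> n - N"
  shows "pexp n (\<lambda>\<sigma>. of_bool (Good T \<sigma>) * W (T + 1) \<sigma>) \<le> 2"
  using assms
proof (induction T rule: dec_induct)
  case base
  then show ?case by (simp add: Good_def W_init[simplified])
next
  case (step t)
  then show ?case using supermartingale_step[of "Suc t"] by simp
qed

end

section \<open>Success probability and value\<close>

text \<open>\<open>16 / 15\<close> is \<open>1 / (1 - x)\<close> at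
  \<open>x = 1 / 16\<close>.\<close>

lemma neg_ln_one_minus_le:
  fixes x :: real
  assumes "0 < x" "x \<le> 1 / 16"
  shows "- ln (1 - x) \<le> x * (1 + 16 / 15 * x)"
proof -
  have "ln (1 / (1 - x)) \<le> 1 / (1 - x) - 1" using assms by (intro ln_le_minus_one) auto
  then have "- ln (1 - x) \<le> 1 / (1 - x) - 1" using assms by (simp add: ln_div)
  also have "\<dots> = x + x * x / (1 - x)" using assms by (simp add: field_simps)
  also have "x * x / (1 - x) \<le> x * x / (15 / 16)" using assms by (intro divide_left_mono) auto
  finally show ?thesis by (simp add: algebra_simps)
qed

context esa_run
begin

text \<open>Value is counted up to this time only: the last \<open>2 n \<epsilon>\<close> steps are the slack that keeps
  every constraint satisfied with high probability.\<close>

definition T :: nat where "T = n - 2 * N"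

lemma T_bounds: "N + 1 \<le> T" "T \<le> n - N" "T \<le> n" "real T = real n - 2 * real N"
  using n16 N1 by (auto simp: T_def of_nat_diff)

definition l :: real where "l = ln (real CARD('m) / eps)"

lemma exp_l: "exp l = real CARD('m) / eps"
  using eps_pos by (simp add: l_def)

lemma l_pos: "0 < l"
proof -
  have "1 \<le> real CARD('m)" by (simp add: Suc_leI)
  then have "eps < real CARD('m)" using eps_le by linarith
  then have "1 < real CARD('m) / eps" using eps_pos by (simp add: less_divide_eq)
  then show ?thesis by (simp add: l_def)
qed

lemma eps_gamma_ge: "13 * l \<le> eps\<^sup>2 / gamma"
  using gamma_le gamma_pos l_pos unfolding l_def[symmetric] by (simp add: pos_le_divide_eq mult.commute)

text \<open>Time reversal, from \<open>t\<close> to \<open>n - t + 1\<close>, turns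
  \<open>kappa\<close> into \<open>lev\<close> and reduces this to the sum over all levels.\<close>

lemma wid_kappa_sum: "(\<Sum>t\<in>{N+1..T}. wid eps (kappa n eps t)) \<le> (12 / 7) * real N"
proof -
  have T: "T \<le> n - N" "T + N < n + 1" using T_bounds n16 by auto
  have "(\<Sum>t\<in>{N+1..T}. wid eps (kappa n eps t)) = (\<Sum>t\<in>{N+1..T}. wid eps (lev N (n - t + 1)))"
    using T by (intro sum.cong) (auto simp: kappa_eq)
  also have "\<dots> = (\<Sum>t\<in>(\<lambda>t. n - t + 1) ` {N+1..T}. wid eps (lev N t))"
    using T by (subst sum.reindex) (auto simp: inj_on_def)
  also have "\<dots> \<le> (\<Sum>t\<in>{N+1..n}. wid eps (lev N t))"
    using T wid_pos by (intro sum_mono2) (auto intro: less_imp_le)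
  also note wid_sum_le
  finally show ?thesis .
qed

lemma wid_eta_sum: "(\<Sum>t\<in>{N+1..T}. wid eps (eta n eps t)) \<le> (12 / 7) * real N"
proof -
  have "(\<Sum>t\<in>{N+1..T}. wid eps (eta n eps t)) = (\<Sum>t\<in>{N+1..T}. wid eps (lev N t))"
    using T_bounds by (intro sum.cong) (auto simp: eta_eq)
  also have "\<dots> \<le> (\<Sum>t\<in>{N+1..n}. wid eps (lev N t))"
    using T_bounds wid_pos by (intro sum_mono2) (auto intro: less_imp_le)
  also note wid_sum_le
  finally show ?thesis .
qed

lemma card_window: "(\<Sum>t\<in>{N+1..T}. 1 :: real) = real n - 3 * real N"
  using T_bounds by (simp add: of_nat_diff)

lemma N_over_n: "real N / real n = eps"
  using n_eps n_pos by (simp add: field_simps)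

text \<open>The window has \<open>n - 3 * N\<close> steps and the widths give back at most
  \<open>12 / 7 * N\<close>, a deficit of \<open>9 / 7 * eps\<close>. It has to exceed the
  \<open>eps / 2\<close> lost in \<open>ln (1 + eps)\<close>; for a window up to
  \<open>n - N\<close> the same estimate would leave only \<open>2 / 7 * eps\<close>.\<close>

lemma beta_sum: "(\<Sum>t\<in>{N+1..T}. bt t) \<le> eps / gamma * (1 - (9 / 7) * eps)"
proof -
  have "(\<Sum>t\<in>{N+1..T}. bt t) = (\<Sum>t\<in>{N+1..T}. eps / (gamma * real n) * (1 + wid eps (kappa n eps t)))"
    using T_bounds by (intro sum.cong) (auto simp: beta_eq)
  also have "\<dots> = eps / (gamma * real n) * ((real n - 3 * real N) + (\<Sum>t\<in>{N+1..T}. wid eps (kappa n eps t)))"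
    by (simp only: sum_distrib_left[symmetric] sum.distrib card_window)
  also have "\<dots> \<le> eps / (gamma * real n) * ((real n - 3 * real N) + (12 / 7) * real N)"
    using wid_kappa_sum eps_pos gamma_pos by (intro mult_left_mono add_left_mono) auto
  also have "\<dots> = eps / gamma * (1 - (9 / 7) * (real N / real n))"
    using n_pos gamma_pos by (simp add: field_simps)
  finally show ?thesis unfolding N_over_n .
qed

text \<open>As \<open>alpha \<ge> 1 - 3 * w\<close> for the width \<open>w\<close>, the loss is 3
  for the missing steps, \<open>12 / 7\<close> for the widths of \<open>kappa\<close> and three
  times \<open>12 / 7\<close> for those of \<open>eta\<close>: \<open>69 / 7\<close> in all.\<close>

lemma beta'_sum: "eps / gamma * (1 - (69 / 7) * eps) \<le> (\<Sum>t\<in>{N+1..T}. bt' t)"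
proof -
  let ?d = "\<lambda>t. wid eps (kappa n eps t)" and ?w = "\<lambda>t. wid eps (eta n eps t)"
  have "eps / gamma * (1 - (69 / 7) * eps) = eps / gamma * (1 - (69 / 7) * (real N / real n))" by (simp only: N_over_n)
  also have "\<dots> = eps / (gamma * real n) * ((real n - 3 * real N) - ((12 / 7) * real N + 3 * ((12 / 7) * real N)))"
    using n_pos gamma_pos by (simp add: field_simps)
  also have "\<dots> \<le> eps / (gamma * real n) * ((real n - 3 * real N) - ((\<Sum>t\<in>{N+1..T}. ?d t) + 3 * (\<Sum>t\<in>{N+1..T}. ?w t)))"
    using wid_kappa_sum wid_eta_sum eps_pos gamma_pos by (intro mult_left_mono diff_left_mono add_mono) auto
  also have "\<dots> = (\<Sum>t\<in>{N+1..T}. eps / (gamma * real n) * (1 - (?d t + 3 * ?w t)))"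
    by (simp only: sum_distrib_left[symmetric] sum.distrib sum_subtractf card_window)
  also have "\<dots> \<le> (\<Sum>t\<in>{N+1..T}. bt' t)"
  proof (rule sum_mono)
    fix t assume t: "t \<in> {N+1..T}"
    then have tt: "t \<in> {N+1..n}" "t \<le> n - N" "t \<in> {1..n - N}" using T_bounds by auto
    have kap: "1 \<le> kappa n eps t"
      using kappa_eq[OF tt(3)] lev_bounds[of N "n - t + 1" L] tt n_eq n16 N1 by auto
    have d: "0 < ?d t" "?d t \<le> 1 / 5" using wid_pos wid_le[OF kap] by auto
    have w: "0 < ?w t" "?w t \<le> 1 / 5" using wid_pos wid_le[OF eta_bounds(3)[OF tt(1)]] by auto
    have "1 - 3 * ?w t \<le> alpha n eps t"
    proof -
      have "0 \<le> ?w t * ?w t" by simp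
      then have "(1 - 3 * ?w t) * (1 + 2 * ?w t) \<le> 1 - ?w t" by (simp add: algebra_simps)
      moreover have "0 < 1 + 2 * ?w t" using w by simp
      ultimately show ?thesis unfolding alpha_eq by (subst pos_le_divide_eq)
    qed
    then have "(1 - ?d t) * (1 - 3 * ?w t) \<le> (1 - ?d t) * alpha n eps t"
      using d by (intro mult_left_mono) auto
    moreover have "1 - (?d t + 3 * ?w t) \<le> (1 - ?d t) * (1 - 3 * ?w t)"
      using d w by (simp add: algebra_simps)
    ultimately have "1 - (?d t + 3 * ?w t) \<le> (1 - ?d t) * alpha n eps t" by linarith
    then have "eps / (gamma * real n) * (1 - (?d t + 3 * ?w t)) \<le> eps / (gamma * real n) * ((1 - ?d t) * alpha n eps t)"
      using eps_pos gamma_pos by (intro mult_left_mono) auto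
    then show "eps / (gamma * real n) * (1 - (?d t + 3 * ?w t)) \<le> bt' t"
      unfolding beta'_eq[OF tt(2)] by (simp only: mult.assoc)
  qed
  finally show ?thesis .
qed

definition rho :: real where "rho = 1 - (23 / 2) * eps"

lemma rho_pos: "0 < rho" using eps_le by (simp add: rho_def)

definition success :: "(nat \<Rightarrow> nat) \<Rightarrow> bool" where
  "success \<sigma> \<longleftrightarrow> Good T \<sigma> \<and> (\<forall>i. (\<Sum>t\<in>{N+1..T}. a \<sigma> t i) \<le> 1) \<and> rho \<le> (\<Sum>t\<in>{N+1..T}. r \<sigma> t)"

text \<open>A violated constraint gives one \<open>U\<close> an exponent of
  \<open>(9 / 7 - 1 / 2) * eps\<^sup>2 / gamma\<close>, at least \<open>3 * l\<close>, of which one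
  \<open>l\<close> is spent on the factor \<open>1 / CARD('m)\<close>. Too little value gives
  \<open>V\<close> an exponent of at least \<open>eps\<^sup>2 / (2 * gamma)\<close>, hence
  \<open>2 * l\<close>.\<close>

lemma W_large:
  assumes "Good T \<sigma>" "\<not> success \<sigma>"
  shows "exp (2 * l) \<le> W (T + 1) \<sigma>"
proof -
  have iv: "{N+1..<T+1} = {N+1..T}" by auto
  have eg: "0 < eps / gamma" using eps_pos gamma_pos by simp
  consider (U) i where "1 < (\<Sum>t\<in>{N+1..T}. a \<sigma> t i)" | (V) "(\<Sum>t\<in>{N+1..T}. r \<sigma> t) < rho"
    using assms unfolding success_def by (meson linear not_le)
  then show ?thesis
  proof cases
    case U
    have nu: "eps / gamma * (1 - eps / 2) \<le> nu eps gamma"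
    proof -
      have "eps - eps\<^sup>2 / 2 \<le> ln (1 + eps)" using eps_pos by (intro ln_one_plus_ge) simp
      then have "(eps - eps\<^sup>2 / 2) / gamma \<le> ln (1 + eps) / gamma" using gamma_pos by (intro divide_right_mono) auto
      then show ?thesis unfolding nu_def by (simp add: power2_eq_square algebra_simps diff_divide_distrib)
    qed
    have nu0: "0 \<le> nu eps gamma" using eps_pos gamma_pos by (simp add: nu_def)
    have "3 * l \<le> (11 / 14) * (eps\<^sup>2 / gamma)" using eps_gamma_ge l_pos by linarith
    also have "\<dots> = eps / gamma * (1 - eps / 2) - eps / gamma * (1 - (9 / 7) * eps)"
      by (simp add: power2_eq_square algebra_simps)
    also have "\<dots> \<le> nu eps gamma * (\<Sum>t\<in>{N+1..T}. a \<sigma> t i) - (\<Sum>t\<in>{N+1..T}. bt t)"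
      using nu beta_sum mult_left_mono[OF less_imp_le[OF U] nu0] by linarith
    finally have "exp (3 * l) \<le> exp (nu eps gamma * (\<Sum>t\<in>{N+1..T}. a \<sigma> t i) - (\<Sum>t\<in>{N+1..T}. bt t))" by simp
    then have le: "exp (3 * l) / real CARD('m) \<le> U (T + 1) i \<sigma>"
      unfolding U_def iv by (rule divide_right_mono) simp
    have "real CARD('m) \<le> exp l" unfolding exp_l using eps_pos eps_le by (simp add: field_simps)
    then have "exp (2 * l) * real CARD('m) \<le> exp (2 * l) * exp l" by (intro mult_left_mono) auto
    also have "\<dots> = exp (3 * l)" by (simp add: exp_add[symmetric])
    finally have "exp (2 * l) \<le> exp (3 * l) / real CARD('m)" by (simp add: pos_le_divide_eq)
    also note le
    also have "U (T + 1) i \<sigma> \<le> (\<Sum>i\<in>UNIV. U (T + 1) i \<sigma>)"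
      using U_pos by (intro member_le_sum) (auto intro: less_imp_le)
    also have "\<dots> \<le> W (T + 1) \<sigma>" unfolding W_def using V_pos[of "T + 1" \<sigma>] by simp
    finally show ?thesis .
  next
    case V
    have nu': "nu' eps gamma \<le> eps / gamma * (1 + 16 / 15 * eps)"
    proof -
      have "- ln (1 - eps) / gamma \<le> eps * (1 + 16 / 15 * eps) / gamma"
        using neg_ln_one_minus_le[OF eps_pos eps_le] gamma_pos by (intro divide_right_mono) auto
      then show ?thesis unfolding nu'_def by simp
    qed
    have nu'0: "0 \<le> nu' eps gamma"
      using eps_pos eps_le gamma_pos by (simp add: nu'_def divide_nonpos_pos)
    have "2 * l \<le> (1 / 2) * (eps\<^sup>2 / gamma)" using eps_gamma_ge l_pos by linarith
    also have "\<dots> = eps / gamma * (eps / 2)" by (simp add: power2_eq_square)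
    also have "\<dots> \<le> eps / gamma * ((1 - (69 / 7) * eps) - (1 + 16 / 15 * eps) * rho)"
    proof (rule mult_left_mono)
      have "0 \<le> eps * eps" by simp
      moreover have "(1 + 16 / 15 * eps) * rho = 1 - (23 / 2) * eps + 16 / 15 * eps - (184 / 15) * (eps * eps)"
        unfolding rho_def by (simp add: field_simps)
      ultimately show "eps / 2 \<le> (1 - (69 / 7) * eps) - (1 + 16 / 15 * eps) * rho" using eps_pos by linarith
    qed (use eg in simp)
    also have "\<dots> = eps / gamma * (1 - (69 / 7) * eps) - (eps / gamma * (1 + 16 / 15 * eps)) * rho"
      by (simp only: right_diff_distrib mult.assoc)
    also have "\<dots> \<le> (\<Sum>t\<in>{N+1..T}. bt' t) - nu' eps gamma * (\<Sum>t\<in>{N+1..T}. r \<sigma> t)"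
    proof -
      have "nu' eps gamma * (\<Sum>t\<in>{N+1..T}. r \<sigma> t) \<le> nu' eps gamma * rho"
        using V nu'0 by (intro mult_left_mono) auto
      also have "\<dots> \<le> (eps / gamma * (1 + 16 / 15 * eps)) * rho"
        using nu' rho_pos by (intro mult_right_mono) auto
      finally show ?thesis using beta'_sum by linarith
    qed
    finally have "exp (2 * l) \<le> V (T + 1) \<sigma>" unfolding V_def iv by simp
    also have "\<dots> \<le> W (T + 1) \<sigma>" unfolding W_def using U_pos by (simp add: sum_nonneg less_imp_le)
    finally show ?thesis .
  qed
qed

lemma exp_neg_l: "exp (- l) = eps / real CARD('m)" "exp (- l) \<le> eps"
proof -
  show e: "exp (- l) = eps / real CARD('m)" by (simp add: exp_minus exp_l)
  have "eps / real CARD('m) \<le> eps / 1" using eps_pos by (intro divide_left_mono) auto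
  then show "exp (- l) \<le> eps" unfolding e by simp
qed

text \<open>Markov's inequality costs \<open>2 * eps\<^sup>2 \<le> eps / 8\<close>. Inaccurate
  estimates cost \<open>5 / 16 * eps\<close>: in
  \<open>B \<le> (eps / CARD('m)) * eps * sqrt eps\<close> the first factor absorbs the number of
  constraints, the last one the number of levels.\<close>

lemma pexp_success: "1 - eps / 2 \<le> pexp n (\<lambda>\<sigma>. of_bool (success \<sigma>))"
proof -
  have m1: "1 \<le> real CARD('m)" by (simp add: Suc_leI)
  have "pexp n (\<lambda>\<sigma>. of_bool (Good T \<sigma> \<and> \<not> success \<sigma>)) \<le> pexp n (\<lambda>\<sigma>. exp (- (2 * l)) * (of_bool (Good T \<sigma>) * W (T + 1) \<sigma>))"
  proof (rule pexp_mono)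
    fix \<sigma>
    have "exp (- (2 * l)) * exp (2 * l) \<le> exp (- (2 * l)) * W (T + 1) \<sigma>" if "Good T \<sigma>" "\<not> success \<sigma>"
      using W_large[OF that] by (intro mult_left_mono) auto
    then show "of_bool (Good T \<sigma> \<and> \<not> success \<sigma>) \<le> exp (- (2 * l)) * (of_bool (Good T \<sigma>) * W (T + 1) \<sigma>)"
      using W_nonneg[of "T + 1" \<sigma>] by (auto simp: exp_add[symmetric])
  qed
  also have "\<dots> \<le> exp (- (2 * l)) * 2"
    unfolding pexp_cmult using pexp_W_le T_bounds by (intro mult_left_mono) auto
  also have "exp (- (2 * l)) = exp (- l) * exp (- l)" by (simp add: exp_add[symmetric])
  also have "\<dots> \<le> eps * eps" using exp_neg_l(2) eps_pos by (intro mult_mono) auto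
  also have "eps * eps \<le> eps * (1 / 16)" using eps_le eps_pos by (intro mult_left_mono) auto
  finally have bad: "pexp n (\<lambda>\<sigma>. of_bool (Good T \<sigma> \<and> \<not> success \<sigma>)) \<le> eps / 8" by simp
  have "B \<le> exp (- l + - l + - l / 2)"
  proof -
    \<comment> \<open>The constant 13 enters here, through
      \<open>13 / 5 \<ge> 5 / 2\<close>.\<close>
    have "(5 / 2) * l \<le> (1 / 5) * (eps\<^sup>2 / gamma)" using eps_gamma_ge l_pos by linarith
    then show ?thesis unfolding B_def by simp
  qed
  also have "\<dots> = exp (- l) * exp (- l) * exp (- l / 2)" by (simp only: exp_add)
  also have "\<dots> \<le> (eps / real CARD('m)) * eps * sqrt eps"
  proof (intro mult_mono)
    have "(exp (- l / 2))\<^sup>2 = exp (- l)" by (simp add: power2_eq_square exp_add[symmetric])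
    then have "(exp (- l / 2))\<^sup>2 \<le> eps" using exp_neg_l(2) by simp
    then show "exp (- l / 2) \<le> sqrt eps" by (rule real_le_rsqrt)
  qed (use exp_neg_l eps_pos in auto)
  finally have "real L * real (2 * CARD('m) + 3) * B \<le> real L * (5 * real CARD('m)) * ((eps / real CARD('m)) * eps * sqrt eps)"
    using m1 by (intro mult_mono) (auto simp: B_def)
  also have "\<dots> = 5 * eps * eps * (real L * sqrt eps)" by simp
  also have "\<dots> \<le> 5 * eps * eps * 1" using L_sqrt_eps eps_pos by (intro mult_left_mono) auto
  also have "\<dots> \<le> 5 * eps * (1 / 16)" using eps_le eps_pos by simp
  finally have "pexp n (\<lambda>\<sigma>. of_bool (\<not> Good T \<sigma>)) \<le> (5 / 16) * eps"
    using pexp_not_Good[OF T_bounds(2)] by simp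
  moreover have "pexp n (\<lambda>\<sigma>. of_bool (\<not> success \<sigma>))
      \<le> pexp n (\<lambda>\<sigma>. of_bool (\<not> Good T \<sigma>)) + pexp n (\<lambda>\<sigma>. of_bool (Good T \<sigma> \<and> \<not> success \<sigma>))"
    by (rule pexp_or_le) blast
  moreover have "pexp n (\<lambda>\<sigma>. of_bool (success \<sigma>)) + pexp n (\<lambda>\<sigma>. of_bool (\<not> success \<sigma>)) = pexp n (\<lambda>\<sigma>. 1)"
    unfolding pexp_add[symmetric] by (rule pexp_cong) auto
  ultimately show ?thesis using bad eps_pos by simp
qed

section \<open>Feasibility and value of the accepted steps\<close>

abbreviation "chk \<sigma> t \<equiv> ESA_check n eps b A \<sigma> (X \<sigma>) t"

lemma partial_sum_nonneg:
  assumes s: "\<sigma> \<in> perms n" and t: "t \<in> {N+1..n}"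
  shows "0 \<le> (A (\<sigma> t) *v X \<sigma> t) $ i"
proof -
  have st: "\<sigma> t \<in> {1..n}" by (rule perms_in[OF s]) (use t in auto)
  show ?thesis by (rule Ax_nonneg[OF st]) (use step_nonneg(1)[OF s t] in auto)
qed

text \<open>The check always sums the whole sequence \<open>X\<close>, skipped steps included. At
  the last accepted step this larger total is within \<open>b\<close>, and afterwards nothing is
  added. It holds on every permutation, so \<open>psi\<close> is always zero.\<close>

lemma chk_feasible:
  assumes s: "\<sigma> \<in> perms n" and "t \<le> n"
  shows "(\<Sum>u\<in>{1..t}. A (\<sigma> u) *v chk \<sigma> u) $ i \<le> b $ i"
  using assms(2)
proof (induction t)
  case 0
  then show ?case using b_pos[of i] by (simp add: less_imp_le)
next
  case (Suc t)
  show ?case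
  proof (cases "chk \<sigma> (Suc t) = 0")
    case True
    then show ?thesis using Suc by simp
  next
    case False
    then have t: "N + 1 \<le> Suc t" and ok: "\<forall>i. (\<Sum>u\<in>{N+1..Suc t}. A (\<sigma> u) *v X \<sigma> u) $ i \<le> b $ i"
      unfolding ESA_check_def neps_eq by (auto split: if_splits)
    have "(\<Sum>u\<in>{1..Suc t}. (A (\<sigma> u) *v chk \<sigma> u) $ i) = (\<Sum>u\<in>{N+1..Suc t}. (A (\<sigma> u) *v chk \<sigma> u) $ i)"
      using t by (intro sum.mono_neutral_right) (auto simp: ESA_check_def neps_eq)
    also have "\<dots> \<le> (\<Sum>u\<in>{N+1..Suc t}. (A (\<sigma> u) *v X \<sigma> u) $ i)"
    proof (rule sum_mono)
      fix u assume "u \<in> {N+1..Suc t}"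
      then have "u \<in> {N+1..n}" using Suc.prems by auto
      from partial_sum_nonneg[OF s this, of i]
      show "(A (\<sigma> u) *v chk \<sigma> u) $ i \<le> (A (\<sigma> u) *v X \<sigma> u) $ i" by (simp add: ESA_check_def)
    qed
    also have "\<dots> \<le> b $ i" using ok by (simp only: sum_component)
    finally show ?thesis by (simp only: sum_component)
  qed
qed

lemma ESA_value_eq:
  assumes "\<sigma> \<in> perms n"
  shows "ESA_value n eps b f A \<sigma> (X \<sigma>) = (\<Sum>t\<in>{1..n}. f (\<sigma> t) (chk \<sigma> t))"
  unfolding ESA_value_def psi_def using chk_feasible[OF assms order_refl] by simp

lemma chk_value_nonneg:
  assumes s: "\<sigma> \<in> perms n" and t: "t \<in> {1..n}" shows "0 \<le> f (\<sigma> t) (chk \<sigma> t)"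
proof (cases "chk \<sigma> t = 0")
  case True then show ?thesis using f_0 perms_in[OF s t] by simp
next
  case False
  then have "chk \<sigma> t = X \<sigma> t" "t \<in> {N+1..n}" using t unfolding ESA_check_def neps_eq by (auto split: if_splits)
  then show ?thesis using step_nonneg(1)[OF s] by simp
qed

text \<open>Resource use only grows, so constraints that hold at \<open>T\<close> mean that no step
  in the window up to \<open>T\<close> was skipped. The ratios \<open>r\<close> are in units of
  \<open>q \<ge> p\<close>, hence the value is at least \<open>p\<close> times their sum; the steps
  after \<open>T\<close> add nothing negative.\<close>

lemma ESA_value_ge:
  assumes s: "\<sigma> \<in> perms n"
  shows "ereal (rho * p * of_bool (success \<sigma>)) \<le> ESA_value n eps b f A \<sigma> (X \<sigma>)"
proof (cases "success \<sigma>")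
  case False
  have "0 \<le> (\<Sum>t\<in>{1..n}. f (\<sigma> t) (chk \<sigma> t))" by (intro sum_nonneg chk_value_nonneg[OF s])
  then show ?thesis using False unfolding ESA_value_eq[OF s] by (simp only: of_bool_eq mult_zero_right zero_ereal_def)
next
  case True
  have chk: "chk \<sigma> t = X \<sigma> t" if t: "t \<in> {N+1..T}" for t
  proof -
    have "(\<Sum>u\<in>{N+1..t}. A (\<sigma> u) *v X \<sigma> u) $ i \<le> b $ i" for i
    proof -
      have "(\<Sum>u\<in>{N+1..t}. (A (\<sigma> u) *v X \<sigma> u) $ i) \<le> (\<Sum>u\<in>{N+1..T}. (A (\<sigma> u) *v X \<sigma> u) $ i)"
      proof (rule sum_mono2)
        fix u assume "u \<in> {N+1..T} - {N+1..t}"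
        then have "u \<in> {N+1..n}" using T_bounds by auto
        then show "0 \<le> (A (\<sigma> u) *v X \<sigma> u) $ i" by (rule partial_sum_nonneg[OF s])
      qed (use t in auto)
      also have "\<dots> = (\<Sum>u\<in>{N+1..T}. a \<sigma> u i) * b $ i"
        unfolding a_def sum_distrib_right using b_pos[of i] by (intro sum.cong) auto
      also have "\<dots> \<le> 1 * b $ i"
        using True b_pos[of i] unfolding success_def by (intro mult_right_mono) auto
      finally show ?thesis by (simp add: sum_component)
    qed
    then show ?thesis using t unfolding ESA_check_def neps_eq by auto
  qed
  have "rho * p \<le> p * (\<Sum>t\<in>{N+1..T}. r \<sigma> t)"
    using True p_pos unfolding success_def by (simp add: mult.commute)
  also have "\<dots> \<le> (\<Sum>t\<in>{N+1..T}. q \<sigma> t * r \<sigma> t)"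
    unfolding sum_distrib_left
  proof (intro sum_mono mult_right_mono)
    fix t assume t: "t \<in> {N+1..T}"
    then have tn: "t \<in> {N+1..n}" using T_bounds by auto
    have good: "Good t \<sigma>" using True t unfolding success_def Good_def by auto
    show "p \<le> q \<sigma> t" by (rule good_q[OF s tn good])
    show "0 \<le> r \<sigma> t" by (rule r_range[OF s tn good])
  qed
  also have "\<dots> = (\<Sum>t\<in>{N+1..T}. real_of_ereal (f (\<sigma> t) (chk \<sigma> t)))"
  proof (rule sum.cong)
    fix t assume t: "t \<in> {N+1..T}"
    then have tn: "t \<in> {N+1..n}" using T_bounds by auto
    show "q \<sigma> t * r \<sigma> t = real_of_ereal (f (\<sigma> t) (chk \<sigma> t))"
      unfolding chk[OF t] r_def using qq_pos[OF s tn] by simp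
  qed simp
  finally have "ereal (rho * p) \<le> (\<Sum>t\<in>{N+1..T}. ereal (real_of_ereal (f (\<sigma> t) (chk \<sigma> t))))"
    by simp
  also have "\<dots> = (\<Sum>t\<in>{N+1..T}. f (\<sigma> t) (chk \<sigma> t))"
  proof (rule sum.cong)
    fix t assume "t \<in> {N+1..T}"
    then have "t \<in> {1..n}" using T_bounds by auto
    then show "ereal (real_of_ereal (f (\<sigma> t) (chk \<sigma> t))) = f (\<sigma> t) (chk \<sigma> t)"
      using f_eq[OF perms_in[OF s] chk_value_nonneg[OF s]] by simp
  qed simp
  also have "\<dots> \<le> (\<Sum>t\<in>{1..n}. f (\<sigma> t) (chk \<sigma> t))"
    using T_bounds chk_value_nonneg[OF s] by (intro sum_mono2) auto
  finally show ?thesis unfolding ESA_value_eq[OF s] using True by simp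
qed

lemma expected_value_ge:
  "ereal (1 - 12 * eps) * ereal p
    \<le> (\<Sum>\<sigma>\<in>perms n. ESA_value n eps b f A \<sigma> (X \<sigma>)) / ereal (real (card (perms n)))"
proof -
  \<comment> \<open>\<open>23 / 2 + 1 / 2 = 12\<close>; the product of the two losses is positive
    and is dropped.\<close>
  have "1 - 12 * eps \<le> rho * (1 - eps / 2)"
    unfolding rho_def by (simp add: algebra_simps)
  also have "\<dots> \<le> rho * pexp n (\<lambda>\<sigma>. of_bool (success \<sigma>))"
    using pexp_success rho_pos by (intro mult_left_mono) auto
  finally have "(1 - 12 * eps) * p \<le> rho * pexp n (\<lambda>\<sigma>. of_bool (success \<sigma>)) * p"
    using p_pos by (intro mult_right_mono) auto
  also have "\<dots> = (\<Sum>\<sigma>\<in>perms n. rho * p * of_bool (success \<sigma>)) / real (card (perms n))"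
    by (simp add: pexp_def sum_distrib_left[symmetric])
  finally have "ereal ((1 - 12 * eps) * p)
      \<le> ereal ((\<Sum>\<sigma>\<in>perms n. rho * p * of_bool (success \<sigma>)) / real (card (perms n)))"
    by (simp only: ereal_less_eq(3))
  also have "\<dots> = ereal (\<Sum>\<sigma>\<in>perms n. rho * p * of_bool (success \<sigma>)) / ereal (real (card (perms n)))"
  proof -
    have "ereal (S / c) = ereal S / ereal c" if "c \<noteq> 0" for S c using that by simp
    then show ?thesis using card_perms_pos[of n] by (metis less_irrefl of_nat_0_less_iff)
  qed
  also have "\<dots> \<le> (\<Sum>\<sigma>\<in>perms n. ESA_value n eps b f A \<sigma> (X \<sigma>)) / ereal (real (card (perms n)))"
    unfolding sum_ereal[symmetric] using ESA_value_ge
    by (intro ereal_divide_right_mono sum_mono) auto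
  finally show ?thesis by simp
qed

end

lemma scale_exists:
  assumes "0 < n" "0 < eps" "log 2 (1 / eps) \<in> \<int>" "real n * eps \<in> \<int>" "eps \<le> 1 / 12"
  obtains N L where "scale N L n eps"
proof -
  obtain l where l: "log 2 (1 / eps) = of_int l" using assms(3) by (auto elim: Ints_cases)
  have e: "1 / eps = 2 powr real_of_int l" using assms(2) by (simp add: l[symmetric])
  \<comment> \<open>\<open>1 / eps \<ge> 12 > 8\<close>, so the integer logarithm is at least
    4.\<close>
  have "log 2 8 < log 2 (1 / eps)" using assms(2,5) by (simp add: field_simps)
  moreover have "log 2 8 = (3::real)" using log_pow_cancel[of 2 3] by simp
  ultimately have l4: "4 \<le> l" using l by linarith
  define L where "L = nat l"
  have L: "4 \<le> L" "eps = 1 / 2 ^ L"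
  proof -
    show "4 \<le> L" using l4 by (simp add: L_def)
    have "real_of_int l = real L" using l4 by (simp add: L_def)
    then have "1 / eps = 2 ^ L" using e by (simp add: powr_realpow)
    then show "eps = 1 / 2 ^ L" using assms(2) by (simp add: field_simps)
  qed
  obtain k where k: "real n * eps = of_int k" using assms(4) by (auto elim: Ints_cases)
  define N where "N = nat k"
  have "0 < real_of_int k" unfolding k[symmetric] using assms(1,2) by simp
  then have N: "1 \<le> N" "real n * eps = real N" using k by (auto simp: N_def)
  then have "real n = real (N * 2 ^ L)" using L(2) by (simp add: field_simps)
  then have "n = N * 2 ^ L" by (simp only: of_nat_eq_iff)
  then have "scale N L n eps" using N(1) L by unfold_locales
  then show ?thesis by (rule that)
qed

theorem theorem2:
  fixes n :: nat and eps gamma :: real and b :: "real^'m"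
    and f :: "nat \<Rightarrow> real^'k \<Rightarrow> ereal" and A :: "nat \<Rightarrow> real^'k^'m"
    and X :: "(nat \<Rightarrow> nat) \<Rightarrow> nat \<Rightarrow> real^'k"
  assumes "0 < n"
    and "\<forall>i. 0 < b $ i"
    and "\<forall>t\<in>{1..n}. class_G (f t)"
    and "\<forall>t\<in>{1..n}. \<forall>i j. 0 \<le> A t $ i $ j"
    and "0 < Pstar n f A b"
    and "0 < gamma"
    and "\<forall>t\<in>{1..n}. \<forall>x. 0 \<le> f t x \<longrightarrow> (\<forall>i. (A t *v x) $ i / b $ i \<le> gamma)"
    and "\<forall>t\<in>{1..n}. \<forall>x. f t x \<noteq> -\<infinity> \<longrightarrow> f t x \<le> ereal gamma * Pstar n f A b"
    and "0 < eps" and "eps < 1"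
    and "log 2 (1 / eps) \<in> \<int>" and "real n * eps \<in> \<int>"
    and "eps \<le> 1 / 12"
    and "gamma \<le> eps\<^sup>2 / (13 * ln (real CARD('m) / eps))"
    and "\<forall>\<sigma>. \<sigma> permutes {1..n} \<longrightarrow> ESA_run n eps gamma b f A \<sigma> (X \<sigma>)"
    and "\<forall>\<sigma> \<sigma>' t. (\<forall>s\<le>t. \<sigma> s = \<sigma>' s) \<longrightarrow> X \<sigma> t = X \<sigma>' t"
  shows "(\<Sum>\<sigma>\<in>{\<sigma>. \<sigma> permutes {1..n}}. ESA_value n eps b f A \<sigma> (X \<sigma>))
           / ereal (real (card {\<sigma>. \<sigma> permutes {1..n}}))
         \<ge> ereal (1 - 12 * eps) * Pstar n f A b"
proof -
  interpret packing n b f A using assms(2-5) by unfold_locales auto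
  obtain N L where sc: "scale N L n eps"
    using scale_exists[OF assms(1,9,11,12,13)] .
  have f_le: "f t x \<le> ereal (gamma * p)" if "t \<in> {1..n}" for t x
  proof (cases "f t x = -\<infinity>")
    case False
    then show ?thesis using assms(8) that Pstar_eq by (metis times_ereal.simps(1))
  qed simp
  obtain xs where xs: "\<And>i. (\<Sum>t\<in>{1..n}. A t *v xs t) $ i \<le> b $ i" "\<And>t. t \<in> {1..n} \<Longrightarrow> 0 \<le> f t (xs t)"
    "(\<Sum>t\<in>{1..n}. real_of_ereal (f t (xs t))) = p"
    using optimal_solution by blast
  obtain y h where y: "\<And>i. 0 \<le> y $ i"
    "\<And>t x. t \<in> {1..n} \<Longrightarrow> f t x \<le> ereal (h t + y \<bullet> (A t *v x))"
    "\<And>t. t \<in> {1..n} \<Longrightarrow> 0 \<le> h t \<and> h t \<le> gamma * p" "(\<Sum>t\<in>{1..n}. h t) + y \<bullet> b \<le> p"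
    by (rule strong_duality[OF f_le less_imp_le[OF assms(6)]]) (assumption, blast)
  have "esa_run N L n eps b f A gamma xs y h X"
  proof (intro esa_run.intro esa.intro sc packing_axioms esa_axioms.intro esa_run_axioms.intro)
    show "(A t *v x) $ i / b $ i \<le> gamma" if "t \<in> {1..n}" "0 \<le> f t x" for t x i
      using assms(7) that by blast
    show "ESA_run n eps gamma b f A \<sigma> (X \<sigma>)" if "\<sigma> permutes {1..n}" for \<sigma>
      using assms(15) that by blast
    show "X \<sigma> t = X \<sigma>' t" if "\<And>s. s \<le> t \<Longrightarrow> \<sigma> s = \<sigma>' s" for \<sigma> \<sigma>' t
      using assms(16) that by blast
  qed (fact assms(6,14) f_le xs y)+
  from esa_run.expected_value_ge[OF this] show ?thesis
    unfolding perms_def Pstar_eq .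
qed

end
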